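(* Let $\mathcal{B}\in\mathcal{L}^{2m(\mathcal{B})}$ with $n(\mathcal{B})>0$ be a controllable system with vector relative degree $r(\mathcal{B})=(r_1,\ldots,r_{m(\mathcal{B})})\in\mathbb{N}_0^{m(\mathcal{B})}$, and let $\mathcal{D}=(u_d,y_d)\in\mathcal{B}_{[0,T]}$ be a sampled data sequence such that $u_d$ is persistently exciting of order $L+n(\mathcal{B})$ for some $L\ge l(\mathcal{B})+\max_{1\le j\le m(\mathcal{B})}r_j+1$. Let $\tilde Q\in\mathbb{R}^{d\times d}$, $d=n(\mathcal{B})-\sum_{j=1}^{m(\mathcal{B})}r_j$, be the matrix constructed from the data as described in the context. Then the zero dynamics of $\mathcal{B}$ are stable if, and only if, $\tilde Q$ is a stable matrix, i.e. all eigenvalues of $\tilde Q$ have absolute value strictly less than $1$ (for $d=0$ the empty matrix counts as stable).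
   Context: Discrete-time systems. $\mathcal{L}^w$ is the class of behaviors $\mathcal{B}\subseteq(\mathbb{R}^w)^{\mathbb{N}_0}$ that are linear subspaces, shift-invariant ($\sigma\mathcal{B}\subseteq\mathcal{B}$ with $(\sigma f)(t)=f(t+1)$) and closed under pointwise convergence. $\mathcal{B}_{[a,b]}$ is the set of restrictions to $\{a,\dots,b\}$ of trajectories in $\mathcal{B}$. The input cardinality $m(\mathcal{B})$ is the maximal dimension of a free subspace of signals (one whose components can follow any sequence irrespective of the past), and $p(\mathcal{B})=w-m(\mathcal{B})$; here $p(\mathcal{B})=m(\mathcal{B})$ (square system). Signals are partitioned as $(u,y)$ with $u\in\mathbb{R}^{m(\mathcal{B})}$, $y\in\mathbb{R}^{p(\mathcal{B})}$. Every $\mathcal{B}\in\mathcal{L}^w$ has a state space representation $(A,B,C,D)$: $\mathcal{B}$ is the set of all $(u,y)$ for which there is a state sequence $x:\mathbb{N}_0\to\mathbb{R}^n$ with $x(t+1)=Ax(t)+Bu(t)$, $y(t)=Cx(t)+Du(t)$ for all $t\in\mathbb{N}_0$. It is minimal if $n$ is the smallest possible; this smallest $n$ is the McMillan degree $n(\mathcal{B})$. The lag $l(\mathcal{B})$ is the smallest $L\in\mathbb{N}_0$ such that, for a minimal representation, $[C^\top,(CA)^\top,\ldots,(CA^{L-1})^\top]^\top$ has rank $n(\mathcal{B})$ (independent of the minimal representation). $\mathcal{B}$ is controllable if for every $w_p\in\mathcal{B}_{[0,T]}$, $T\in\mathbb{N}$, and every $w_f\in\mathcal{B}$ there are $\tilde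 T\in\mathbb{N}$ and $v\in\mathcal{B}$ with $v|_{[0,T]}=w_p$ and $v(t)=w_f(t-T-\tilde T)$ for all $t\ge T+\tilde T$. For $f:\{0,\dots,T\}\to\mathbb{R}^k$ and $L\le T+1$, the Hankel matrix $\mathcal{H}_L(f)$ has $L$ block rows and $T-L+2$ columns, with block $(i,j)$ equal to $f(i+j-2)$. $f$ is persistently exciting of order $L$ if $\operatorname{rk}\mathcal{H}_L(f)=Lk$. Vector relative degree: $\mathcal{B}$ with representation $(A,B,C,D)$ has vector relative degree $(r_1,\ldots,r_p)\in\mathbb{N}_0^p$ if (i) $C_jA^kB=0$ for all $1\le j\le p$, $0\le k\le r_j-2$, and $D_j=0$ if $r_j>0$; and (ii) the decoupling matrix $G$ with rows $G_j=D_j$ if $r_j=0$, $G_j=C_jA^{r_j-1}B$ if $r_j>0$, has rank $p$ (subscript $j$ = $j$-th row). Zero dynamics: $\mathcal{B}_{ZD}=\{u:\mathbb{N}_0\to\mathbb{R}^{m(\mathcal{B})}:(u,0)\in\mathcal{B}\}$. They are stable if for every $u\in\mathcal{B}_{ZD}$ and every minimal state space representation, the state sequence $x$ corresponding to the trajectory $(u,0)$ satisfies $(x(i),u(i))\to0$ as $i\to\infty$. Construction of $\tilde Q$. Write $m=m(\mathcal{B})$, $l=l(\mathcal{B})$. Let $M=\{u\in(\mathbb{R}^m)^L:(u,0)\in\mathcal{B}_{[0,L-1]}\}$, which under the stated persistency of excitation equals $\{\mathcal{H}_L(u_d)g:\mathcal{H}_L(y_d)g=0\}$, and let $\pi_k:\mathbb{R}^{mL}\to\mathbb{R}^{mk}$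 be the projection onto the first $mk$ entries. Then $\dim\pi_lM=d$. Fix a basis $v_1,\ldots,v_d$ of $\pi_lM$, $v_k=(v_{k,1},\ldots,v_{k,l})$ with $v_{k,i}\in\mathbb{R}^m$. For each $k$ there is a unique $u_k\in\mathbb{R}^m$ with $(v_k,u_k)\in\pi_{l+1}M$, and $z_k:=(v_{k,2},\ldots,v_{k,l},u_k)\in\pi_lM$. Let $q_{k,i}\in\mathbb{R}$ be the unique coefficients with $z_k=\sum_{i=1}^dq_{k,i}v_i$, and $\tilde Q=(q_{k,i})_{1\le k,i\le d}$. *)

theory Defs
  imports
    Complex_Main
    "HOL-Library.FuncSet"
    "Jordan_Normal_Form.DL_Rank"
    "Jordan_Normal_Form.Char_Poly"
begin

section \<open>Behaviors\<close>

type_synonym signal = "nat \<Rightarrow> real vec"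

definition signals :: "nat \<Rightarrow> signal set" where
  "signals q = {f. \<forall>t. f t \<in> carrier_vec q}"

definition vec_converges :: "nat \<Rightarrow> (nat \<Rightarrow> real vec) \<Rightarrow> real vec \<Rightarrow> bool" where
  "vec_converges q f v \<longleftrightarrow> (\<forall>i<q. (\<lambda>k. f k $ i) \<longlonglongrightarrow> v $ i)"

text \<open>The class $\mathcal{L}^q$. Sequential closedness suffices, since the topology of pointwise
  convergence on $(\mathbb{R}^q)^{\mathbb{N}}$ is metrizable.\<close>

definition behaviors :: "nat \<Rightarrow> signal set set" where
  "behaviors q = {\<B>. \<B> \<subseteq> signals q
     \<and> (\<lambda>t. 0\<^sub>v q) \<in> \<B>
     \<and> (\<forall>f\<in>\<B>. \<forall>g\<in>\<B>. (\<lambda>t. f t + g t) \<in> \<B>)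
     \<and> (\<forall>c. \<forall>f\<in>\<B>. (\<lambda>t. c \<cdot>\<^sub>v f t) \<in> \<B>)
     \<and> (\<forall>f\<in>\<B>. (\<lambda>t. f (t + 1)) \<in> \<B>)
     \<and> (\<forall>F f. (\<forall>k. F k \<in> \<B>) \<and> f \<in> signals q \<and> (\<forall>t. vec_converges q (\<lambda>k. F k t) (f t))
          \<longrightarrow> f \<in> \<B>)}"

definition restr :: "signal set \<Rightarrow> nat \<Rightarrow> nat \<Rightarrow> signal set" where
  "restr \<B> a b = (\<lambda>w. restrict w {a..b}) ` \<B>"

text \<open>A \<open>k\<close>-dimensional subspace of the signals is given by \<open>k\<close> linearly independent linear
  functionals on the signal space, the rows of \<open>S\<close>; it is free if the components of \<open>S w\<close> can
  follow any sequence from any time on, whatever the trajectory was before.\<close>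

definition free_signals :: "nat \<Rightarrow> signal set \<Rightarrow> nat \<Rightarrow> real mat \<Rightarrow> bool" where
  "free_signals q \<B> k S \<longleftrightarrow> S \<in> carrier_mat k q \<and> vec_space.rank k S = k
     \<and> (\<forall>w\<in>\<B>. \<forall>T. \<forall>f\<in>signals k. \<exists>v\<in>\<B>. (\<forall>t<T. v t = w t) \<and> (\<forall>t\<ge>T. S *\<^sub>v v t = f t))"

definition input_cardinality :: "nat \<Rightarrow> signal set \<Rightarrow> nat" where
  "input_cardinality q \<B> = Max {k. \<exists>S. free_signals q \<B> k S}"

definition controllable :: "signal set \<Rightarrow> bool" where
  "controllable \<B> \<longleftrightarrow>
     (\<forall>T\<ge>1. \<forall>wp\<in>restr \<B> 0 T. \<forall>wf\<in>\<B>. \<exists>T'\<ge>1. \<exists>v\<in>\<B>.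
        restrict v {0..T} = wp \<and> (\<forall>t\<ge>T + T'. v t = wf (t - T - T')))"

section \<open>State space representations\<close>

text \<open>Trajectories are \<open>u t @\<^sub>v y t\<close>, the first \<open>m\<close> components being the inputs and the
  remaining \<open>p\<close> components the outputs.\<close>

definition state_trajectory ::
    "real mat \<Rightarrow> real mat \<Rightarrow> real mat \<Rightarrow> real mat \<Rightarrow> signal \<Rightarrow> signal \<Rightarrow> signal \<Rightarrow> bool" where
  "state_trajectory A B C D x u y \<longleftrightarrow>
     (\<forall>t. x (t + 1) = A *\<^sub>v x t + B *\<^sub>v u t \<and> y t = C *\<^sub>v x t + D *\<^sub>v u t)"

definition state_rep ::
    "nat \<Rightarrow> nat \<Rightarrow> signal set \<Rightarrow> nat \<Rightarrow> real mat \<Rightarrow> real mat \<Rightarrow> real mat \<Rightarrow> real mat \<Rightarrow> bool" where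
  "state_rep m p \<B> n A B C D \<longleftrightarrow>
     A \<in> carrier_mat n n \<and> B \<in> carrier_mat n m \<and> C \<in> carrier_mat p n \<and> D \<in> carrier_mat p m
     \<and> \<B> = {(\<lambda>t. u t @\<^sub>v y t) | u y. u \<in> signals m \<and> y \<in> signals p
               \<and> (\<exists>x\<in>signals n. state_trajectory A B C D x u y)}"

definition mcmillan_degree :: "nat \<Rightarrow> nat \<Rightarrow> signal set \<Rightarrow> nat" where
  "mcmillan_degree m p \<B> = (LEAST n. \<exists>A B C D. state_rep m p \<B> n A B C D)"

definition minimal_rep ::
    "nat \<Rightarrow> nat \<Rightarrow> signal set \<Rightarrow> nat \<Rightarrow> real mat \<Rightarrow> real mat \<Rightarrow> real mat \<Rightarrow> real mat \<Rightarrow> bool" where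
  "minimal_rep m p \<B> n A B C D \<longleftrightarrow>
     state_rep m p \<B> n A B C D \<and> n = mcmillan_degree m p \<B>"

text \<open>The block rows \<open>C\<close>, \<open>C A\<close>, \<dots>, \<open>C A^(L-1)\<close> stacked on top of each other.\<close>

definition obs_mat :: "nat \<Rightarrow> nat \<Rightarrow> real mat \<Rightarrow> real mat \<Rightarrow> nat \<Rightarrow> real mat" where
  "obs_mat n p A C L = mat (L * p) n (\<lambda>(i, j). (C * A ^\<^sub>m (i div p)) $$ (i mod p, j))"

definition lag :: "nat \<Rightarrow> nat \<Rightarrow> signal set \<Rightarrow> nat" where
  "lag m p \<B> = (LEAST L. \<exists>n A B C D. minimal_rep m p \<B> n A B C D
      \<and> vec_space.rank (L * p) (obs_mat n p A C L) = mcmillan_degree m p \<B>)"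

definition decoupling_mat ::
    "nat \<Rightarrow> nat \<Rightarrow> real mat \<Rightarrow> real mat \<Rightarrow> real mat \<Rightarrow> real mat \<Rightarrow> (nat \<Rightarrow> nat) \<Rightarrow> real mat" where
  "decoupling_mat m p A B C D r =
     mat\<^sub>r p m (\<lambda>j. if r j = 0 then row D j else row (C * A ^\<^sub>m (r j - 1) * B) j)"

text \<open>Components are numbered from \<open>0\<close>; only the values \<open>r j\<close> with \<open>j < p\<close> matter. Any
  representation may be used: the Markov parameters \<open>D\<close>, \<open>C A^k B\<close> depend only on the behavior.
  The inequality \<open>k + 2 \<le> r j\<close> avoids truncated subtraction.\<close>

definition has_vector_relative_degree ::
    "nat \<Rightarrow> nat \<Rightarrow> signal set \<Rightarrow> (nat \<Rightarrow> nat) \<Rightarrow> bool" where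
  "has_vector_relative_degree m p \<B> r \<longleftrightarrow>
     (\<exists>n A B C D. state_rep m p \<B> n A B C D
        \<and> (\<forall>j<p. (\<forall>k. k + 2 \<le> r j \<longrightarrow> row (C * A ^\<^sub>m k * B) j = 0\<^sub>v m)
                 \<and> (r j > 0 \<longrightarrow> row D j = 0\<^sub>v m))
        \<and> vec_space.rank p (decoupling_mat m p A B C D r) = p)"

section \<open>Zero dynamics\<close>

definition zero_dynamics :: "nat \<Rightarrow> nat \<Rightarrow> signal set \<Rightarrow> signal set" where
  "zero_dynamics m p \<B> = {u \<in> signals m. (\<lambda>t. u t @\<^sub>v 0\<^sub>v p) \<in> \<B>}"

definition stable_zero_dynamics :: "nat \<Rightarrow> nat \<Rightarrow> signal set \<Rightarrow> bool" where
  "stable_zero_dynamics m p \<B> \<longleftrightarrow>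
     (\<forall>u\<in>zero_dynamics m p \<B>. \<forall>n A B C D. minimal_rep m p \<B> n A B C D \<longrightarrow>
        (\<forall>x\<in>signals n. state_trajectory A B C D x u (\<lambda>t. 0\<^sub>v p) \<longrightarrow>
           vec_converges (n + m) (\<lambda>i. x i @\<^sub>v u i) (0\<^sub>v (n + m))))"

section \<open>Data\<close>

text \<open>The Hankel matrix of a \<open>k\<close>-dimensional sequence on \<open>{0..T}\<close>, for \<open>L \<le> T + 1\<close>.\<close>

definition hankel :: "nat \<Rightarrow> nat \<Rightarrow> nat \<Rightarrow> signal \<Rightarrow> real mat" where
  "hankel k T L f = mat (L * k) (T + 2 - L) (\<lambda>(i, j). f (i div k + j) $ (i mod k))"

definition persistently_exciting :: "nat \<Rightarrow> nat \<Rightarrow> nat \<Rightarrow> signal \<Rightarrow> bool" where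
  "persistently_exciting k T L f \<longleftrightarrow>
     L \<le> T + 1 \<and> vec_space.rank (L * k) (hankel k T L f) = L * k"

definition stack :: "nat \<Rightarrow> nat \<Rightarrow> signal \<Rightarrow> real vec" where
  "stack m L u = vec (L * m) (\<lambda>i. u (i div m) $ (i mod m))"

text \<open>The set $M$ of stacked inputs; meaningful for \<open>L \<ge> 1\<close>.\<close>

definition zero_output_inputs :: "nat \<Rightarrow> nat \<Rightarrow> signal set \<Rightarrow> nat \<Rightarrow> real vec set" where
  "zero_output_inputs m p \<B> L = {stack m L u | u. u \<in> signals m
      \<and> restrict (\<lambda>t. u t @\<^sub>v 0\<^sub>v p) {0..L - 1} \<in> restr \<B> 0 (L - 1)}"

definition zero_output_data :: "nat \<Rightarrow> nat \<Rightarrow> nat \<Rightarrow> nat \<Rightarrow> signal \<Rightarrow> signal \<Rightarrow> real vec set" where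
  "zero_output_data m p T L ud yd = {hankel m T L ud *\<^sub>v g | g. g \<in> carrier_vec (T + 2 - L)
      \<and> hankel p T L yd *\<^sub>v g = 0\<^sub>v (L * p)}"

definition proj_blocks :: "nat \<Rightarrow> nat \<Rightarrow> real vec set \<Rightarrow> real vec set" where
  "proj_blocks m k M = (\<lambda>v. vec_first v (k * m)) ` M"

definition basis_list :: "nat \<Rightarrow> real vec set \<Rightarrow> real vec list \<Rightarrow> bool" where
  "basis_list N W vs \<longleftrightarrow> set vs \<subseteq> carrier_vec N \<and> distinct vs
     \<and> \<not> module.lin_dep class_ring (module_vec TYPE(real) N) (set vs)
     \<and> LinearCombinations.module.span class_ring (module_vec TYPE(real) N) (set vs) = W"

text \<open>For \<open>v = (v\<^sub>1, \<dots>, v\<^sub>l)\<close> and the unique \<open>u\<close> with \<open>(v, u) \<in> \<pi>\<^sub>l\<^sub>+\<^sub>1 M\<close>, the vector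
  \<open>(v\<^sub>2, \<dots>, v\<^sub>l, u)\<close>.\<close>

definition shift_window :: "nat \<Rightarrow> nat \<Rightarrow> real vec set \<Rightarrow> real vec \<Rightarrow> real vec" where
  "shift_window m l M v =
     vec_last (v @\<^sub>v (THE u. u \<in> carrier_vec m \<and> v @\<^sub>v u \<in> proj_blocks m (l + 1) M)) (l * m)"

text \<open>The matrix $\tilde Q$; the product below is $\sum_i q_{k,i} v_i$.\<close>

definition Q_tilde :: "nat \<Rightarrow> nat \<Rightarrow> real vec set \<Rightarrow> real vec list \<Rightarrow> real mat" where
  "Q_tilde m l M vs = (THE Q. Q \<in> carrier_mat (length vs) (length vs)
     \<and> (\<forall>k<length vs. shift_window m l M (vs ! k) = mat_of_cols (l * m) vs *\<^sub>v row Q k))"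

definition stable_mat :: "real mat \<Rightarrow> bool" where
  "stable_mat Q \<longleftrightarrow> (\<forall>c. eigenvalue (map_mat complex_of_real Q) c \<longrightarrow> cmod c < 1)"

end

theory Submission
  imports Defs "Jordan_Normal_Form.Spectral_Radius"
begin

text \<open>By the relative degree conditions, the output \<open>y\<^sub>j\<close> shifted by \<open>k < r\<^sub>j\<close> steps is \<open>C\<^sub>j A\<^sup>k x\<close>, and shifted
  by \<open>r\<^sub>j\<close> steps it is \<open>H\<^sub>j x + G\<^sub>j u\<close>, where \<open>H\<^sub>j = C\<^sub>j A\<^bsup>r\<^sub>j\<^esup>\<close> and \<open>G\<close> is the invertible decoupling matrix. Hence the output
  vanishes iff the state starts in the subspace \<open>V\<close> defined by the vanishing of the \<open>C\<^sub>j A\<^sup>k x\<close>, \<open>k < r\<^sub>j\<close>, and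
  the input is the feedback \<open>u = F x\<close> with \<open>F = - G\<^sup>-\<^sup>1 H\<close>. The zero dynamics are thus the motion
  of \<open>A + B F\<close> on its invariant subspace \<open>V\<close>, whose codimension is the sum of the \<open>r\<^sub>j\<close>. An input window of length equal to
  the lag determines the state in \<open>V\<close>, so \<open>V\<close> is isomorphic to the space of such windows, and \<open>\<sigma>\<close> acting on
  windows, i.e. the transpose of the data matrix, represents \<open>A + B F\<close> on \<open>V\<close>. Finally, by observability the
  states of any minimal representation tend to zero as soon as the inputs do.

  That the data determine the windows is the fundamental lemma of Willems et al.: controllability and persistency
  of excitation make the rows of the matrix of stacked states and inputs linearly independent, so its columns generate
  every initial state and input.\<close>

section \<open>Matrices over the reals\<close>

text \<open>The length condition on \<open>L\<close> is a look-ahead condition. That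
  \<open>x t\<close> lies in \<open>V\<close> and that \<open>u t\<close> is the feedback value is
  read off from outputs up to time \<open>t + rmax\<close>, so \<open>L\<close> zero outputs control
  only the first \<open>L - rmax\<close> inputs. The shift on windows needs \<open>l + 1\<close>
  blocks free of this end effect: \<open>l\<close> for the window and one for its next input. The
  notions of the statement refer to different representations: the relative degree to some arbitrary
  one, the lag to some minimal one, stability to all minimal ones. No isomorphism of minimal
  representations is built. The Markov parameters, which depend on the behavior only, carry the
  relative degree over to one minimal representation that attains the lag; all further work takes
  place there, and the other minimal representations enter only through the inputs that they share
  with it.\<close>

lemma mult_mat_zero_vec [simp]:
  "A \<in> carrier_mat nr nc \<Longrightarrow> A *\<^sub>v 0\<^sub>v nc = (0\<^sub>v nr :: 'a :: semiring_0 vec)"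
  by (intro eq_vecI) auto

text \<open>Padding with zero rows to a square \<open>A'\<close> puts \<open>unit_vec nc nr\<close>
  into the kernel of the transpose, so \<open>det A' = 0\<close>, and a kernel vector of
  \<open>A'\<close> is one of \<open>A\<close>.\<close>

lemma wide_mat_kernel:
  fixes A :: "real mat"
  assumes A: "A \<in> carrier_mat nr nc" and less: "nr < nc"
  obtains v where "v \<in> carrier_vec nc" "v \<noteq> 0\<^sub>v nc" "A *\<^sub>v v = 0\<^sub>v nr"
proof -
  define A' where "A' = mat nc nc (\<lambda>(i,j). if i < nr then A $$ (i,j) else 0)"
  have A': "A' \<in> carrier_mat nc nc" by (simp add: A'_def)
  have "A'\<^sup>T *\<^sub>v unit_vec nc nr = 0\<^sub>v nc"
    using less by (intro eq_vecI) (auto simp: A'_def)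
  moreover have "unit_vec nc nr \<noteq> (0\<^sub>v nc :: real vec)"
    using less by (metis index_unit_vec(1) index_zero_vec(1) zero_neq_one)
  ultimately have "det A'\<^sup>T = 0"
    using A' by (subst det_0_iff_vec_prod_zero_field[of _ nc]) (auto intro!: exI[of _ "unit_vec nc nr"])
  then have "det A' = 0" using det_transpose[OF A'] by simp
  then obtain v where v: "v \<in> carrier_vec nc" "v \<noteq> 0\<^sub>v nc" "A' *\<^sub>v v = 0\<^sub>v nc"
    using det_0_iff_vec_prod_zero_field[OF A'] by auto
  have "A *\<^sub>v v = 0\<^sub>v nr"
  proof (intro eq_vecI)
    fix i assume i: "i < dim_vec (0\<^sub>v nr :: real vec)"
    have "row A i = row A' i" using i A less by (intro eq_vecI) (auto simp: A'_def)
    then show "(A *\<^sub>v v) $ i = 0\<^sub>v nr $ i"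
      using i less A A' arg_cong[OF v(3), of "\<lambda>w. w $ i"] by auto
  qed (use A in auto)
  with v that show thesis by blast
qed

lemma trivial_kernel_le:
  fixes A :: "real mat"
  assumes A: "A \<in> carrier_mat nr nc"
    and ker: "\<And>v. v \<in> carrier_vec nc \<Longrightarrow> A *\<^sub>v v = 0\<^sub>v nr \<Longrightarrow> v = 0\<^sub>v nc"
  shows "nc \<le> nr"
  using wide_mat_kernel[OF A] ker by (metis not_le)

lemma square_trivial_kernel_inverse:
  fixes A :: "real mat"
  assumes A: "A \<in> carrier_mat n n"
    and ker: "\<And>v. v \<in> carrier_vec n \<Longrightarrow> A *\<^sub>v v = 0\<^sub>v n \<Longrightarrow> v = 0\<^sub>v n"
  obtains B where "B \<in> carrier_mat n n" "A * B = 1\<^sub>m n" "B * A = 1\<^sub>m n"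
proof -
  have "det A \<noteq> 0" using det_0_iff_vec_prod_zero_field[OF A] ker by auto
  from det_non_zero_imp_unit[OF A this, of undefined] that
  show thesis by (auto simp: Units_def ring_mat_def)
qed

text \<open>A kernel vector \<open>v\<close> of the Gram matrix \<open>P * P\<^sup>T\<close> makes
  the squared length of \<open>P\<^sup>T *\<^sub>v v\<close> zero. So the Gram matrix has an inverse
  \<open>B\<close>, and \<open>P\<^sup>T * B\<close> is a right inverse.\<close>

lemma right_inverse_exists:
  fixes P :: "real mat"
  assumes P: "P \<in> carrier_mat k n"
    and ker: "\<And>v. v \<in> carrier_vec k \<Longrightarrow> P\<^sup>T *\<^sub>v v = 0\<^sub>v n \<Longrightarrow> v = 0\<^sub>v k"
  obtains R where "R \<in> carrier_mat n k" "P * R = 1\<^sub>m k"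
proof -
  have Pt: "P\<^sup>T \<in> carrier_mat n k" using P by simp
  have PP: "P * P\<^sup>T \<in> carrier_mat k k" using P Pt by simp
  have inj: "v = 0\<^sub>v k" if v: "v \<in> carrier_vec k" "(P * P\<^sup>T) *\<^sub>v v = 0\<^sub>v k" for v
  proof -
    have w: "P\<^sup>T *\<^sub>v v \<in> carrier_vec n" using Pt v by simp
    have "(P\<^sup>T *\<^sub>v v) \<bullet> (P\<^sup>T *\<^sub>v v) = v \<bullet> (P *\<^sub>v (P\<^sup>T *\<^sub>v v))"
      by (rule transpose_vec_mult_scalar[OF P w v(1)])
    also have "\<dots> = 0" using v P Pt by (simp flip: assoc_mult_mat_vec)
    finally have "P\<^sup>T *\<^sub>v v = 0\<^sub>v n"
      using conjugate_square_eq_0_vec[OF w] by simp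
    with ker v show ?thesis by simp
  qed
  obtain B where B: "B \<in> carrier_mat k k" "P * P\<^sup>T * B = 1\<^sub>m k"
    using square_trivial_kernel_inverse[OF PP inj] by blast
  show thesis
  proof
    show "P\<^sup>T * B \<in> carrier_mat n k" using Pt B by simp
    show "P * (P\<^sup>T * B) = 1\<^sub>m k" using B assoc_mult_mat[OF P Pt B(1)] by simp
  qed
qed

lemma left_inverse_exists:
  fixes A :: "real mat"
  assumes A: "A \<in> carrier_mat n k"
    and ker: "\<And>v. v \<in> carrier_vec k \<Longrightarrow> A *\<^sub>v v = 0\<^sub>v n \<Longrightarrow> v = 0\<^sub>v k"
  obtains Z where "Z \<in> carrier_mat k n" "Z * A = 1\<^sub>m k"
proof -
  have "A\<^sup>T \<in> carrier_mat k n" using A by simp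
  from right_inverse_exists[OF this] ker
  obtain R where R: "R \<in> carrier_mat n k" "A\<^sup>T * R = 1\<^sub>m k" by auto
  have "R\<^sup>T * A = (A\<^sup>T * R)\<^sup>T" using A R(1) transpose_mult[of "A\<^sup>T" k n R k] by (metis transpose_carrier_mat transpose_transpose)
  with R that[of "R\<^sup>T"] show thesis by simp
qed

text \<open>The rank is the size of a maximal independent set of columns. Here it has
  \<open>nr\<close> members, which form an invertible square matrix \<open>E\<close>, and
  \<open>v\<close> is orthogonal to all of them.\<close>

lemma full_row_rank_left_kernel:
  fixes A :: "real mat"
  assumes A: "A \<in> carrier_mat nr nc" and rk: "vec_space.rank nr A = nr"
    and v: "v \<in> carrier_vec nr" and ker: "\<And>j. j < nc \<Longrightarrow> v \<bullet> col A j = 0"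
  shows "v = 0\<^sub>v nr"
proof -
  interpret vec_space "TYPE(real)" nr .
  obtain S where S: "finite S" "maximal S (\<lambda>T. T \<subseteq> set (cols A) \<and> lin_indpt T)"
    using maximal_exists_superset[of "set (cols A)" "\<lambda>T. T \<subseteq> set (cols A) \<and> lin_indpt T" "{}"]
    by (auto simp: finite_lin_indpt2)
  then have cS: "card S = nr" and sub: "S \<subseteq> set (cols A)" and li: "lin_indpt S"
    using rank_card_indpt[OF A S(2)] rk by (auto simp: maximal_def)
  obtain ss where ss: "set ss = S" "distinct ss" using finite_distinct_list[OF S(1)] by blast
  have len: "length ss = nr" using ss cS distinct_card by metis
  have carr: "set ss \<subseteq> carrier_vec nr" using sub ss cols_dim[of A] A by auto
  define E where "E = mat_of_cols nr ss"
  have E: "E \<in> carrier_mat nr nr" using len by (simp add: E_def carrier_matI)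
  have cE: "cols E = ss" using carr by (simp add: E_def)
  have "det E \<noteq> 0"
    using det_0_iff_vec_prod_zero_field[OF E] lin_depI[OF E] ss cE li by metis
  then have "det E\<^sup>T \<noteq> 0" using det_transpose[OF E] by simp
  moreover have "E\<^sup>T *\<^sub>v v = 0\<^sub>v nr"
  proof (intro eq_vecI)
    fix i assume "i < dim_vec (0\<^sub>v nr :: real vec)"
    then have i: "i < nr" by simp
    then have "col E i \<in> set (cols A)" using cE sub ss len E
      by (metis carrier_matD(2) cols_length cols_nth nth_mem subset_code(1))
    then obtain j where j: "j < nc" "col E i = col A j"
      using A by (auto simp: in_set_conv_nth)
    have cc: "col A j \<in> carrier_vec nr" using A by auto
    show "(E\<^sup>T *\<^sub>v v) $ i = 0\<^sub>v nr $ i" using i E ker[OF j(1)] j v cc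
      by (simp add: comm_scalar_prod[OF cc v])
  qed (use E in auto)
  ultimately show ?thesis using det_0_iff_vec_prod_zero_field[of "E\<^sup>T" nr] v E by auto
qed

text \<open>Rank is measured on the set of columns, so repeated columns must be excluded before
  independence of that set can be read as a trivial kernel.\<close>

lemma full_col_rank_iff:
  fixes A :: "real mat"
  assumes A: "A \<in> carrier_mat nr nc"
  shows "vec_space.rank nr A = nc \<longleftrightarrow>
    (\<forall>v\<in>carrier_vec nc. A *\<^sub>v v = 0\<^sub>v nr \<longrightarrow> v = 0\<^sub>v nc)"
proof -
  interpret vec_space "TYPE(real)" nr .
  show ?thesis
  proof
    assume rk: "rank A = nc"
    obtain S where S: "finite S" "maximal S (\<lambda>T. T \<subseteq> set (cols A) \<and> lin_indpt T)"
      using maximal_exists_superset[of "set (cols A)" "\<lambda>T. T \<subseteq> set (cols A) \<and> lin_indpt T" "{}"]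
      by (auto simp: finite_lin_indpt2)
    then have "card S = nc" "S \<subseteq> set (cols A)"
      using rank_card_indpt[OF A S(2)] rk by (auto simp: maximal_def)
    then have "nc \<le> card (set (cols A))" using card_mono by blast
    then have dist: "distinct (cols A)"
      using A card_length[of "cols A"] by (intro card_distinct) auto
    show "\<forall>v\<in>carrier_vec nc. A *\<^sub>v v = 0\<^sub>v nr \<longrightarrow> v = 0\<^sub>v nc"
      using full_rank_lin_indpt[OF A rk dist] lin_depI[OF A _ _ _ dist] by blast
  next
    assume ker: "\<forall>v\<in>carrier_vec nc. A *\<^sub>v v = 0\<^sub>v nr \<longrightarrow> v = 0\<^sub>v nc"
    have dist: "distinct (cols A)"
    proof (rule ccontr)
      assume "\<not> distinct (cols A)"
      then obtain i j where ij: "i < nc" "j < nc" "i \<noteq> j" "col A i = col A j"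
        using A by (auto simp: distinct_conv_nth)
      let ?v = "unit_vec nc i - unit_vec nc j :: real vec"
      have "A *\<^sub>v ?v = col A i - col A j"
        using A ij(1,2,3)
        by (intro eq_vecI) (auto simp: scalar_prod_minus_distrib[of _ nc] scalar_prod_right_unit)
      also have "\<dots> = 0\<^sub>v nr" using ij A by (intro eq_vecI) auto
      finally have "?v = 0\<^sub>v nc" using ker by auto
      then have "?v $ i = 0" using ij by simp
      with ij show False by (simp add: unit_vec_def)
    qed
    then show "rank A = nc"
      using lin_indpt_full_rank[OF A dist] lin_depE[OF A _ dist] ker by metis
  qed
qed

lemma basis_list_mat:
  assumes "basis_list N W vs"
  shows basis_list_span: "W = {mat_of_cols N vs *\<^sub>v c | c. c \<in> carrier_vec (length vs)}"
    and basis_list_indep: "c \<in> carrier_vec (length vs) \<Longrightarrow> mat_of_cols N vs *\<^sub>v c = 0\<^sub>v N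
      \<Longrightarrow> c = 0\<^sub>v (length vs)"
proof -
  interpret vec_space "TYPE(real)" N .
  let ?A = "mat_of_cols N vs"
  have vs: "set vs \<subseteq> carrier_vec N" "distinct vs" "lin_indpt (set vs)" "span (set vs) = W"
    using assms by (auto simp: basis_list_def)
  have A: "?A \<in> carrier_mat N (length vs)" by simp
  have cA: "cols ?A = vs" using vs by simp
  show "W = {?A *\<^sub>v c | c. c \<in> carrier_vec (length vs)}"
  proof (intro equalityI subsetI)
    fix w assume "w \<in> W"
    then obtain a where "w = lincomb a (set vs)"
      using vs finite_in_span[of "set vs" w] by auto
    then show "w \<in> {?A *\<^sub>v c | c. c \<in> carrier_vec (length vs)}"
      using mat_mult_eq_lincomb[OF A, of a] cA vs(2)
      by (auto intro!: exI[of _ "vec (length vs) (\<lambda>i. a (col ?A i))"])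
  next
    fix w assume "w \<in> {?A *\<^sub>v c | c. c \<in> carrier_vec (length vs)}"
    then obtain c where c: "c \<in> carrier_vec (length vs)" "w = ?A *\<^sub>v c" by auto
    then have "w = lincomb (\<lambda>a. c $ find_first a (cols ?A)) (set vs)"
      using lincomb_eq_mat_mult[OF A c(1)] cA vs(2) by simp
    then show "w \<in> W" using vs in_spanI[of _ _ "set vs"] by auto
  qed
  show "c = 0\<^sub>v (length vs)" if "c \<in> carrier_vec (length vs)" "?A *\<^sub>v c = 0\<^sub>v N"
    using lin_depI[OF A that(1) _ that(2)] cA vs by auto
qed

section \<open>Powers of a matrix and linear recursions\<close>

lemma pow_mat_Suc_vec:
  fixes A :: "'a :: comm_semiring_1 mat"
  assumes "A \<in> carrier_mat n n" "x \<in> carrier_vec n"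
  shows "A ^\<^sub>m Suc k *\<^sub>v x = A *\<^sub>v (A ^\<^sub>m k *\<^sub>v x)"
  using assms(2)
proof (induction k arbitrary: x)
  case (Suc k)
  have "A ^\<^sub>m Suc (Suc k) *\<^sub>v x = A ^\<^sub>m Suc k *\<^sub>v (A *\<^sub>v x)"
    using assms(1) Suc.prems by (subst pow_mat.simps(2)) (rule assoc_mult_mat_vec[of _ n n _ n], simp_all del: pow_mat.simps)
  also have "\<dots> = A *\<^sub>v (A ^\<^sub>m k *\<^sub>v (A *\<^sub>v x))"
    using assms(1) Suc.prems by (intro Suc.IH) simp
  also have "A ^\<^sub>m k *\<^sub>v (A *\<^sub>v x) = A ^\<^sub>m Suc k *\<^sub>v x"
    using assoc_mult_mat_vec[of "A ^\<^sub>m k" n n A n x] assms(1) Suc.prems by simp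
  finally show ?case .
qed (use assms in simp)

lemma pow_mat_vec_carrier [simp]:
  "A \<in> carrier_mat n n \<Longrightarrow> x \<in> carrier_vec n \<Longrightarrow> A ^\<^sub>m k *\<^sub>v x \<in> carrier_vec n"
  by (rule mult_mat_vec_carrier[of _ n n]) simp_all

lemma pow_mat_add_vec:
  fixes A :: "'a :: comm_semiring_1 mat"
  assumes A: "A \<in> carrier_mat n n" "x \<in> carrier_vec n"
  shows "A ^\<^sub>m (j + k) *\<^sub>v x = A ^\<^sub>m j *\<^sub>v (A ^\<^sub>m k *\<^sub>v x)"
proof (induction j)
  case (Suc j)
  have "A ^\<^sub>m (Suc j + k) *\<^sub>v x = A *\<^sub>v (A ^\<^sub>m (j + k) *\<^sub>v x)"
    using pow_mat_Suc_vec[OF A, of "j + k"] by simp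
  also have "\<dots> = A ^\<^sub>m Suc j *\<^sub>v (A ^\<^sub>m k *\<^sub>v x)"
    using Suc A pow_mat_Suc_vec[OF A(1), of "A ^\<^sub>m k *\<^sub>v x" j]
    by (simp del: pow_mat.simps(2) add: mult_mat_vec_carrier[of _ n n])
  finally show ?case .
qed (use A in \<open>simp add: mult_mat_vec_carrier[of _ n n]\<close>)

text \<open>A replacement for the Cayley--Hamilton theorem: the vectors \<open>x, A x, \<dots>, A^n x\<close> are
  linearly dependent.\<close>

lemma annihilating_polynomial:
  fixes A :: "real mat"
  assumes A: "A \<in> carrier_mat n n" and x: "x \<in> carrier_vec n"
  obtains k \<alpha> where "k \<le> n"
    "\<And>t y. y \<in> carrier_vec n \<Longrightarrow>
      y \<bullet> (A ^\<^sub>m (k + t) *\<^sub>v x) = (\<Sum>i<k. \<alpha> i * (y \<bullet> (A ^\<^sub>m (i + t) *\<^sub>v x)))"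
proof -
  define K where "K = mat n (Suc n) (\<lambda>(i,k). (A ^\<^sub>m k *\<^sub>v x) $ i)"
  have K: "K \<in> carrier_mat n (Suc n)" by (simp add: K_def)
  obtain v where v: "v \<in> carrier_vec (Suc n)" "v \<noteq> 0\<^sub>v (Suc n)" "K *\<^sub>v v = 0\<^sub>v n"
    using wide_mat_kernel[OF K] by auto
  \<comment> \<open>The last nonzero coefficient is singled out: dividing by it makes the relation
    monic of degree \<open>k\<close>.\<close>
  define k where "k = Max {i. i < Suc n \<and> v $ i \<noteq> 0}"
  have ne: "{i. i < Suc n \<and> v $ i \<noteq> 0} \<noteq> {}"
    using v by (auto simp: vec_eq_iff)
  have k: "k < Suc n" "v $ k \<noteq> 0" using Max_in[OF _ ne] by (auto simp: k_def)
  have zero: "v $ i = 0" if "k < i" "i < Suc n" for i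
    using that Max_ge[of "{i. i < Suc n \<and> v $ i \<noteq> 0}" i] unfolding k_def by fastforce
  have base: "(\<Sum>i<Suc n. v $ i * (z \<bullet> (A ^\<^sub>m i *\<^sub>v x))) = 0" if z: "z \<in> carrier_vec n" for z
  proof -
    have "0 = z \<bullet> (K *\<^sub>v v)" using v z by simp
    also have "\<dots> = (K\<^sup>T *\<^sub>v z) \<bullet> v" using transpose_vec_mult_scalar[OF K v(1) z] by simp
    also have "\<dots> = (\<Sum>i<Suc n. (K\<^sup>T *\<^sub>v z) $ i * v $ i)"
      using v by (simp add: scalar_prod_def lessThan_atLeast0)
    also have "\<dots> = (\<Sum>i<Suc n. v $ i * (z \<bullet> (A ^\<^sub>m i *\<^sub>v x)))"
    proof (intro sum.cong refl)
      fix i assume i: "i \<in> {..<Suc n}"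
      have "col K i = A ^\<^sub>m i *\<^sub>v x" using i A by (intro eq_vecI) (auto simp: K_def)
      then show "(K\<^sup>T *\<^sub>v z) $ i * v $ i = v $ i * (z \<bullet> (A ^\<^sub>m i *\<^sub>v x))"
        using i K z A x
          by (auto simp: comm_scalar_prod[of z n] mult_mat_vec_carrier[of _ n n])
    qed
    finally show ?thesis by simp
  qed
  show thesis
  proof (rule that[of k "\<lambda>i. - v $ i / v $ k"])
    fix t and y :: "real vec" assume y: "y \<in> carrier_vec n"
    have At: "A ^\<^sub>m t \<in> carrier_mat n n" using A by simp
    \<comment> \<open>The extra factor \<open>A ^\<^sub>m t\<close> is moved to the functional, so
      the one relation among the vectors holds at every shift.\<close>
    define z where "z = (A ^\<^sub>m t)\<^sup>T *\<^sub>v y"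
    have z: "z \<in> carrier_vec n" using y A by (simp add: z_def mult_mat_vec_carrier[of _ n n])
    have zx: "z \<bullet> (A ^\<^sub>m i *\<^sub>v x) = y \<bullet> (A ^\<^sub>m (i + t) *\<^sub>v x)" for i
    proof -
      have "z \<bullet> (A ^\<^sub>m i *\<^sub>v x) = y \<bullet> (A ^\<^sub>m t *\<^sub>v (A ^\<^sub>m i *\<^sub>v x))"
        unfolding z_def using A x y by (intro transpose_vec_mult_scalar[OF At]) (auto intro!: mult_mat_vec_carrier[of _ n n])
      then show ?thesis using pow_mat_add_vec[OF A x, of t i] by (simp add: add.commute)
    qed
    have "0 = (\<Sum>i<Suc n. v $ i * (y \<bullet> (A ^\<^sub>m (i + t) *\<^sub>v x)))"
      using base[OF z] zx by simp
    also have "\<dots> = (\<Sum>i<Suc k. v $ i * (y \<bullet> (A ^\<^sub>m (i + t) *\<^sub>v x)))"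
      using k zero by (intro sum.mono_neutral_right) auto
    finally have "v $ k * (y \<bullet> (A ^\<^sub>m (k + t) *\<^sub>v x)) = - (\<Sum>i<k. v $ i * (y \<bullet> (A ^\<^sub>m (i + t) *\<^sub>v x)))"
      by simp
    then have "y \<bullet> (A ^\<^sub>m (k + t) *\<^sub>v x) = - (\<Sum>i<k. v $ i * (y \<bullet> (A ^\<^sub>m (i + t) *\<^sub>v x))) / v $ k"
      using k by (simp add: field_simps)
    also have "\<dots> = (\<Sum>i<k. - v $ i / v $ k * (y \<bullet> (A ^\<^sub>m (i + t) *\<^sub>v x)))"
      by (simp add: sum_divide_distrib sum_negf)
    finally show "y \<bullet> (A ^\<^sub>m (k + t) *\<^sub>v x) =
      (\<Sum>i<k. - v $ i / v $ k * (y \<bullet> (A ^\<^sub>m (i + t) *\<^sub>v x)))" .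
  qed (use k in simp)
qed

text \<open>The monic relation is a linear recursion of order at most \<open>n\<close> for these
  values, so \<open>n\<close> initial zeros propagate to all times.\<close>

lemma annihilated_orbit:
  fixes A :: "real mat"
  assumes A: "A \<in> carrier_mat n n" and x: "x \<in> carrier_vec n" and y: "y \<in> carrier_vec n"
    and z: "\<And>t. t < n \<Longrightarrow> y \<bullet> (A ^\<^sub>m t *\<^sub>v x) = 0"
  shows "y \<bullet> (A ^\<^sub>m t *\<^sub>v x) = 0"
proof -
  obtain k \<alpha> where k: "k \<le> n" "\<And>t. y \<bullet> (A ^\<^sub>m (k + t) *\<^sub>v x) = (\<Sum>i<k. \<alpha> i * (y \<bullet> (A ^\<^sub>m (i + t) *\<^sub>v x)))"
    using annihilating_polynomial[OF A x] y by metis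
  show ?thesis
  proof (induction t rule: less_induct)
    case (less t)
    show ?case
    proof (cases "t < n")
      case False
      then have "t = k + (t - k)" using k by simp
      moreover have "(\<Sum>i<k. \<alpha> i * (y \<bullet> (A ^\<^sub>m (i + (t - k)) *\<^sub>v x))) = 0"
        using False k less.IH by (intro sum.neutral) auto
      ultimately show ?thesis using k(2)[of "t - k"] by simp
    qed (use z in simp)
  qed
qed

text \<open>A right inverse requires independent rows. While some combination of the functionals
  vanishes, one with nonzero coefficient is dropped; the others force it to vanish, so the common
  kernel does not change.\<close>

lemma common_kernel_as_mat_kernel:
  fixes S :: "real vec set"
  assumes "finite S" "S \<subseteq> carrier_vec n"
  shows "\<exists>k P R. P \<in> carrier_mat k n \<and> R \<in> carrier_mat n k \<and> P * R = 1\<^sub>m k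
    \<and> (\<forall>v\<in>carrier_vec n. P *\<^sub>v v = 0\<^sub>v k \<longleftrightarrow> (\<forall>s\<in>S. s \<bullet> v = 0))"
  using assms
proof (induction "card S" arbitrary: S rule: less_induct)
  case less
  obtain ss where ss: "set ss = S" "distinct ss" using finite_distinct_list less.prems(1) by blast
  define k where "k = length ss"
  define P where "P = mat_of_rows n ss"
  have P: "P \<in> carrier_mat k n" by (simp add: P_def k_def)
  have row: "row P i = ss ! i" if "i < k" for i
    using that ss less.prems(2) unfolding P_def k_def by (intro mat_of_rows_row) auto
  have kerP: "P *\<^sub>v v = 0\<^sub>v k \<longleftrightarrow> (\<forall>s\<in>S. s \<bullet> v = 0)" if "v \<in> carrier_vec n" for v
  proof -
    have "P *\<^sub>v v = 0\<^sub>v k \<longleftrightarrow> (\<forall>i<k. ss ! i \<bullet> v = 0)"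
    proof -
      have "P *\<^sub>v v = 0\<^sub>v k \<longleftrightarrow> (\<forall>i<k. (P *\<^sub>v v) $ i = 0)"
        using P by (auto simp: vec_eq_iff)
      then show ?thesis using P row by simp
    qed
    also have "\<dots> \<longleftrightarrow> (\<forall>s\<in>S. s \<bullet> v = 0)"
      unfolding ss(1)[symmetric] k_def by (metis in_set_conv_nth)
    finally show ?thesis .
  qed
  show ?case
  proof (cases "\<forall>\<xi>\<in>carrier_vec k. P\<^sup>T *\<^sub>v \<xi> = 0\<^sub>v n \<longrightarrow> \<xi> = 0\<^sub>v k")
    case True
    then obtain R where "R \<in> carrier_mat n k" "P * R = 1\<^sub>m k"
      using right_inverse_exists[OF P] by blast
    with P kerP show ?thesis by blast
  next
    case False
    then obtain \<xi> i where \<xi>: "\<xi> \<in> carrier_vec k" "P\<^sup>T *\<^sub>v \<xi> = 0\<^sub>v n" and i: "i < k" "\<xi> $ i \<noteq> 0"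
      by (auto simp: vec_eq_iff)
    let ?S = "S - {ss ! i}"
    have si: "ss ! i \<in> S" using i ss by (auto simp: k_def)
    have "ss ! i \<bullet> v = 0" if v: "v \<in> carrier_vec n" "\<forall>s\<in>?S. s \<bullet> v = 0" for v
    proof -
      have "0 = (P\<^sup>T *\<^sub>v \<xi>) \<bullet> v" using \<xi> v by simp
      also have "\<dots> = \<xi> \<bullet> (P *\<^sub>v v)" by (rule transpose_vec_mult_scalar[OF P v(1) \<xi>(1)])
      also have "\<dots> = (\<Sum>j<k. \<xi> $ j * (ss ! j \<bullet> v))"
        using P row by (auto simp: scalar_prod_def[of \<xi>] lessThan_atLeast0 intro!: sum.cong)
      also have "\<dots> = (\<Sum>j\<in>{i}. \<xi> $ j * (ss ! j \<bullet> v))"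
      proof (rule sum.mono_neutral_right)
        show "\<forall>j\<in>{..<k} - {i}. \<xi> $ j * (ss ! j \<bullet> v) = 0"
        proof
          fix j assume j: "j \<in> {..<k} - {i}"
          then have "ss ! j \<in> ?S" using ss i by (auto simp: k_def nth_eq_iff_index_eq)
          with v show "\<xi> $ j * (ss ! j \<bullet> v) = 0" by simp
        qed
      qed (use i in auto)
      finally show ?thesis using i by simp
    qed
    then have eq: "(\<forall>s\<in>?S. s \<bullet> v = 0) \<longleftrightarrow> (\<forall>s\<in>S. s \<bullet> v = 0)" if "v \<in> carrier_vec n" for v
      using that si by auto
    have "card ?S < card S" using si less.prems(1) by (rule card_Diff1_less[rotated])
    moreover have "finite ?S" "?S \<subseteq> carrier_vec n" using less.prems by auto
    ultimately obtain k' P' R' where "P' \<in> carrier_mat k' n" "R' \<in> carrier_mat n k'" "P' * R' = 1\<^sub>m k'"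
      "\<forall>v\<in>carrier_vec n. P' *\<^sub>v v = 0\<^sub>v k' \<longleftrightarrow> (\<forall>s\<in>?S. s \<bullet> v = 0)"
      using less.hyps by blast
    then show ?thesis using eq by (intro exI[of _ k'] exI[of _ P'] exI[of _ R']) simp
  qed
qed

text \<open>\<open>R\<close> is injective, which gives \<open>k \<le> n\<close>; for
  \<open>k = n\<close> the matrix \<open>P\<close> would be invertible, against its kernel vector
  \<open>x\<close>.\<close>

lemma right_inverse_dims:
  fixes P :: "real mat"
  assumes P: "P \<in> carrier_mat k n" and R: "R \<in> carrier_mat n k" and PR: "P * R = 1\<^sub>m k"
    and x: "x \<in> carrier_vec n" "x \<noteq> 0\<^sub>v n" "P *\<^sub>v x = 0\<^sub>v k"
  shows "k < n"
proof -
  have "v = 0\<^sub>v k" if v: "v \<in> carrier_vec k" "R *\<^sub>v v = 0\<^sub>v n" for v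
  proof -
    have "v = P *\<^sub>v (R *\<^sub>v v)" using v(1) PR assoc_mult_mat_vec[OF P R v(1)] by simp
    also have "\<dots> = 0\<^sub>v k" unfolding v(2) using P by (intro eq_vecI) auto
    finally show ?thesis .
  qed
  then have "k \<le> n" by (rule trivial_kernel_le[OF R])
  moreover have "k \<noteq> n"
  proof
    assume [simp]: "k = n"
    have "R * P = 1\<^sub>m n" using mat_mult_left_right_inverse[of P n R] P R PR by simp
    then have "x = R *\<^sub>v (P *\<^sub>v x)" using x P R assoc_mult_mat_vec[of R n n P n x] by simp
    also have "\<dots> = 0\<^sub>v n" unfolding x(3) using R by simp
    finally show False using x by simp
  qed
  ultimately show ?thesis by simp
qed

section \<open>Convergence of matrix powers and eigenvalues\<close>

lemma vec_converges_zero_iff: "vec_converges q f (0\<^sub>v q) \<longleftrightarrow> (\<forall>i<q. (\<lambda>t. f t $ i) \<longlonglongrightarrow> 0)"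
  by (simp add: vec_converges_def)

lemma vec_converges_mult_mat:
  assumes M: "M \<in> carrier_mat a b" and f: "\<And>t. f t \<in> carrier_vec b"
    and conv: "vec_converges b f (0\<^sub>v b)"
  shows "vec_converges a (\<lambda>t. M *\<^sub>v f t) (0\<^sub>v a)"
  unfolding vec_converges_zero_iff
proof (intro allI impI)
  fix i assume i: "i < a"
  have df: "dim_vec (f t) = b" for t using f by (rule carrier_vecD)
  have "(\<lambda>t. \<Sum>j<b. M $$ (i, j) * f t $ j) \<longlonglongrightarrow> 0"
    using conv unfolding vec_converges_zero_iff by (intro tendsto_null_sum tendsto_mult_right_zero) auto
  moreover have "(M *\<^sub>v f t) $ i = (\<Sum>j<b. M $$ (i, j) * f t $ j)" for t
    using i M by (simp add: scalar_prod_def df lessThan_atLeast0)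
  ultimately show "(\<lambda>t. (M *\<^sub>v f t) $ i) \<longlonglongrightarrow> 0" by simp
qed

lemma pow_mat_smult:
  fixes A :: "'a :: comm_ring_1 mat"
  assumes A: "A \<in> carrier_mat n n"
  shows "(c \<cdot>\<^sub>m A) ^\<^sub>m k = c ^ k \<cdot>\<^sub>m A ^\<^sub>m k"
proof (induction k)
  case 0
  show ?case using A by (intro eq_matI) auto
next
  case (Suc k)
  have Ak: "A ^\<^sub>m k \<in> carrier_mat n n" using A by simp
  have "(c \<cdot>\<^sub>m A) ^\<^sub>m Suc k = (c ^ k \<cdot>\<^sub>m A ^\<^sub>m k) * (c \<cdot>\<^sub>m A)" using Suc by simp
  also have "\<dots> = c ^ Suc k \<cdot>\<^sub>m A ^\<^sub>m Suc k"
    using A Ak by (intro eq_matI) (auto simp: scalar_prod_def sum_distrib_left intro!: sum.cong)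
  finally show ?case .
qed

lemma of_real_pow_mat:
  fixes A :: "real mat"
  assumes A: "A \<in> carrier_mat n n"
  shows "map_mat complex_of_real (A ^\<^sub>m k) = (map_mat complex_of_real A) ^\<^sub>m k"
  using A by (rule of_real_hom.mat_hom_pow)

text \<open>Spectral radius below 1 yields bounded powers, not yet decay. The bound is therefore
  applied to the matrix scaled by \<open>1 / s\<close>, with \<open>s\<close> between the spectral
  radius and 1; this leaves \<open>b * s ^ k\<close> as a bound for the entries of
  \<open>A ^\<^sub>m k\<close>.\<close>

lemma powers_converge_if_eigenvalues_less_1:
  fixes A :: "real mat"
  assumes A: "A \<in> carrier_mat n n" and x: "x \<in> carrier_vec n"
    and ev: "\<And>c. eigenvalue (map_mat complex_of_real A) c \<Longrightarrow> cmod c < 1"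
  shows "vec_converges n (\<lambda>t. A ^\<^sub>m t *\<^sub>v x) (0\<^sub>v n)"
\<comment> \<open>The spectral radius is a maximum over the spectrum, which is empty for
  \<open>n = 0\<close>.\<close>
proof (cases "n = 0")
  case False
  define Z where "Z = map_mat complex_of_real A"
  have Z: "Z \<in> carrier_mat n n" using A by (simp add: Z_def)
  define \<rho> where "\<rho> = spectral_radius Z"
  have "\<rho> \<in> norm ` spectrum Z" and max: "\<And>c. eigenvalue Z c \<Longrightarrow> cmod c \<le> \<rho>"
    using spectral_radius_mem_max[OF Z] False unfolding \<rho>_def spectrum_def by auto
  then have \<rho>: "0 \<le> \<rho>" "\<rho> < 1" using ev unfolding spectrum_def Z_def by auto
  define s where "s = (1 + \<rho>) / 2"
  have s: "0 < s" "s < 1" "\<rho> < s" using \<rho> by (auto simp: s_def)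
  define Y where "Y = complex_of_real (1 / s) \<cdot>\<^sub>m Z"
  have Y: "Y \<in> carrier_mat n n" using Z by (simp add: Y_def)
  have "cmod c < 1" if "eigenvalue Y c" for c
  proof -
    obtain v where v: "v \<in> carrier_vec n" "v \<noteq> 0\<^sub>v n" "Y *\<^sub>v v = c \<cdot>\<^sub>v v"
      using \<open>eigenvalue Y c\<close> Y unfolding eigenvalue_def eigenvector_def by auto
    have "Z = complex_of_real s \<cdot>\<^sub>m Y" using Z s by (intro eq_matI) (auto simp: Y_def)
    moreover have "(complex_of_real s \<cdot>\<^sub>m Y) *\<^sub>v v = complex_of_real s \<cdot>\<^sub>v (Y *\<^sub>v v)"
      using Y v(1) by (intro eq_vecI) auto
    ultimately have "Z *\<^sub>v v = complex_of_real s \<cdot>\<^sub>v (Y *\<^sub>v v)" by simp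
    also have "\<dots> = (complex_of_real s * c) \<cdot>\<^sub>v v" by (simp add: v smult_smult_assoc)
    finally have "eigenvalue Z (complex_of_real s * c)"
      using v Z unfolding eigenvalue_def eigenvector_def by auto
    from max[OF this] have "s * cmod c \<le> \<rho>" using s by (simp add: norm_mult)
    with s have "s * cmod c < s * 1" by linarith
    then show ?thesis using s mult_less_cancel_left_pos[of s "cmod c" 1] by blast
  qed
  then have "spectral_radius Y < 1"
    using spectral_radius_mem_max(1)[OF Y] False unfolding spectrum_def by auto
  then obtain b where b: "\<And>k. norm_bound (Y ^\<^sub>m k) b"
    using spectral_radius_jnf_norm_bound_less_1_upper_triangular[OF Y] by blast
  have bound: "\<bar>(A ^\<^sub>m k) $$ (i, j)\<bar> \<le> b * s ^ k" if ij: "i < n" "j < n" for i j k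
  proof -
    have Ak: "A ^\<^sub>m k \<in> carrier_mat n n" using A by simp
    have "Y ^\<^sub>m k = complex_of_real (1 / s) ^ k \<cdot>\<^sub>m map_mat complex_of_real (A ^\<^sub>m k)"
      unfolding Y_def pow_mat_smult[OF Z] by (simp add: Z_def of_real_pow_mat[OF A])
    then have "(Y ^\<^sub>m k) $$ (i, j) = complex_of_real ((1 / s) ^ k * (A ^\<^sub>m k) $$ (i, j))"
      using ij Ak A by simp
    moreover have "norm ((Y ^\<^sub>m k) $$ (i, j)) \<le> b"
      using b[of k] ij Y pow_carrier_mat[OF Y, of k] unfolding norm_bound_def by auto
    ultimately have "\<bar>(1 / s) ^ k * (A ^\<^sub>m k) $$ (i, j)\<bar> \<le> b" by (simp only: norm_of_real)
    then show ?thesis using s by (simp add: abs_mult power_divide field_simps)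
  qed
  show ?thesis unfolding vec_converges_zero_iff
  proof (intro allI impI)
    fix i assume i: "i < n"
    have "(\<lambda>k. (A ^\<^sub>m k) $$ (i, j)) \<longlonglongrightarrow> 0" if "j < n" for j
    proof (rule tendsto_0_le)
      show "\<forall>\<^sub>F k in sequentially. norm ((A ^\<^sub>m k) $$ (i, j)) \<le> norm (b * s ^ k) * 1"
        using order_trans[OF bound[OF i that] abs_ge_self] by simp
      show "(\<lambda>k. b * s ^ k) \<longlonglongrightarrow> 0"
        using s by (intro tendsto_mult_right_zero LIMSEQ_realpow_zero) auto
    qed
    then have "(\<lambda>k. \<Sum>j<n. (A ^\<^sub>m k) $$ (i, j) * x $ j) \<longlonglongrightarrow> 0"
      by (intro tendsto_null_sum tendsto_mult_left_zero) auto
    moreover have "(A ^\<^sub>m k *\<^sub>v x) $ i = (\<Sum>j<n. (A ^\<^sub>m k) $$ (i, j) * x $ j)" for k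
      using i x A pow_carrier_mat[OF A, of k] by (simp add: scalar_prod_def lessThan_atLeast0)
    ultimately show "(\<lambda>t. (A ^\<^sub>m t *\<^sub>v x) $ i) \<longlonglongrightarrow> 0" by simp
  qed
qed (simp add: vec_converges_def)

text \<open>The eigenvector is complex, while convergence is assumed for real vectors. Its real and
  imaginary parts are followed separately, and at a nonzero entry they show that
  \<open>c ^ t\<close> tends to zero.\<close>

lemma eigenvalues_less_1_if_powers_converge:
  fixes A :: "real mat"
  assumes A: "A \<in> carrier_mat n n"
    and conv: "\<And>x. x \<in> carrier_vec n \<Longrightarrow> vec_converges n (\<lambda>t. A ^\<^sub>m t *\<^sub>v x) (0\<^sub>v n)"
    and ev: "eigenvalue (map_mat complex_of_real A) c"
  shows "cmod c < 1"
proof -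
  define Z where "Z = map_mat complex_of_real A"
  have Z: "Z \<in> carrier_mat n n" using A by (simp add: Z_def)
  obtain z where ez: "eigenvector Z z c" using ev by (auto simp: eigenvalue_def Z_def)
  then have z: "z \<in> carrier_vec n" "z \<noteq> 0\<^sub>v n" using Z unfolding eigenvector_def by auto
  then obtain i where i: "i < n" "z $ i \<noteq> 0" by (auto simp: vec_eq_iff)
  define a b where "a = map_vec Re z" and "b = map_vec Im z"
  have ab: "a \<in> carrier_vec n" "b \<in> carrier_vec n" using z by (auto simp: a_def b_def)
  have pow: "c ^ t * z $ i = Complex ((A ^\<^sub>m t *\<^sub>v a) $ i) ((A ^\<^sub>m t *\<^sub>v b) $ i)" for t
  proof -
    have At: "A ^\<^sub>m t \<in> carrier_mat n n" using A by simp
    have "c ^ t * z $ i = (Z ^\<^sub>m t *\<^sub>v z) $ i"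
      using eigenvector_pow[OF Z ez, of t] i z by simp
    also have "\<dots> = (\<Sum>j<n. complex_of_real ((A ^\<^sub>m t) $$ (i, j)) * z $ j)"
      unfolding Z_def of_real_pow_mat[OF A, symmetric]
      using i At z A by (simp add: scalar_prod_def lessThan_atLeast0)
    also have "\<dots> = Complex (\<Sum>j<n. (A ^\<^sub>m t) $$ (i, j) * a $ j) (\<Sum>j<n. (A ^\<^sub>m t) $$ (i, j) * b $ j)"
      using z by (simp add: complex_eq_iff a_def b_def)
    finally show ?thesis
      using i At ab A by (simp add: scalar_prod_def lessThan_atLeast0)
  qed
  have "(\<lambda>t. c ^ t * z $ i) \<longlonglongrightarrow> Complex 0 0"
    unfolding pow using conv[OF ab(1)] conv[OF ab(2)] i
    by (intro tendsto_Complex) (auto simp: vec_converges_zero_iff simp del: index_mult_mat_vec)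
  then have "(\<lambda>t. c ^ t * z $ i) \<longlonglongrightarrow> 0" by (simp flip: zero_complex.code)
  then have "(\<lambda>t. c ^ t * z $ i / z $ i) \<longlonglongrightarrow> 0"
    by (rule tendsto_divide_zero)
  then have "(\<lambda>t. c ^ t) \<longlonglongrightarrow> 0" using i by simp
  then have "(\<lambda>t. cmod (c ^ t)) \<longlonglongrightarrow> 0" by (rule tendsto_norm_zero)
  then have lim: "(\<lambda>t. cmod c ^ t) \<longlonglongrightarrow> 0" by (simp add: norm_power)
  show ?thesis
  proof (rule ccontr)
    assume "\<not> cmod c < 1"
    then have "1 \<le> cmod c ^ t" for t by (intro one_le_power) simp
    then have "1 \<le> (0::real)" by (intro LIMSEQ_le_const[OF lim]) auto
    then show False by simp
  qed
qed

text \<open>The rows of the data matrix hold the coordinates of images of basis vectors, so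
  coordinate vectors evolve under the transpose. It has the same characteristic polynomial, hence
  the same eigenvalues.\<close>

lemma stable_mat_iff_powers_converge:
  assumes Q: "Q \<in> carrier_mat d d"
  shows "stable_mat Q \<longleftrightarrow> (\<forall>c\<in>carrier_vec d. vec_converges d (\<lambda>t. (Q\<^sup>T) ^\<^sub>m t *\<^sub>v c) (0\<^sub>v d))"
proof -
  let ?h = "map_mat complex_of_real"
  have Qt: "Q\<^sup>T \<in> carrier_mat d d" and hQ: "?h Q \<in> carrier_mat d d" "(?h Q)\<^sup>T \<in> carrier_mat d d" using Q by auto
  have "?h (Q\<^sup>T) = (?h Q)\<^sup>T" using Q by (intro eq_matI) auto
  then have "eigenvalue (?h (Q\<^sup>T)) c \<longleftrightarrow> eigenvalue (?h Q) c" for c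
    using char_poly_transpose_mat[OF hQ(1)]
    by (simp add: eigenvalue_root_char_poly[OF hQ(1)] eigenvalue_root_char_poly[OF hQ(2)])
  then show ?thesis
    unfolding stable_mat_def
    using powers_converge_if_eigenvalues_less_1[OF Qt] eigenvalues_less_1_if_powers_converge[OF Qt] by blast
qed

section \<open>State space representations\<close>

lemma signals_carrier [simp, intro]: "f \<in> signals q \<Longrightarrow> f t \<in> carrier_vec q"
  unfolding signals_def by blast

lemma signalsI: "(\<And>t. f t \<in> carrier_vec q) \<Longrightarrow> f \<in> signals q"
  unfolding signals_def by blast

lemma state_rep_iff:
  assumes "state_rep m p \<B> n A B C D" "u \<in> signals m" "y \<in> signals p"
  shows "(\<lambda>t. u t @\<^sub>v y t) \<in> \<B> \<longleftrightarrow> (\<exists>x\<in>signals n. state_trajectory A B C D x u y)"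
proof -
  have "u' = u \<and> y' = y"
    if "(\<lambda>t. u t @\<^sub>v y t) = (\<lambda>t. u' t @\<^sub>v y' t)" "u' \<in> signals m" for u' y'
    using that assms(2) append_vec_eq[of "u _" m "u' _"] by (auto simp: fun_eq_iff)
  then show ?thesis using assms unfolding state_rep_def by blast
qed

lemma state_rep_cases:
  assumes "state_rep m p \<B> n A B C D" "w \<in> \<B>"
  obtains u y x where "w = (\<lambda>t. u t @\<^sub>v y t)" "u \<in> signals m" "y \<in> signals p"
    "x \<in> signals n" "state_trajectory A B C D x u y"
  using assms unfolding state_rep_def by blast

section \<open>Trajectories and observability of a fixed system\<close>

locale linear_system =
  fixes n m p :: nat and A B C D :: "real mat"
  assumes A [simp]: "A \<in> carrier_mat n n" and B [simp]: "B \<in> carrier_mat n m"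
    and C [simp]: "C \<in> carrier_mat p n" and D [simp]: "D \<in> carrier_mat p m"
begin

abbreviation trajectory :: "signal \<Rightarrow> signal \<Rightarrow> signal \<Rightarrow> bool" where
  "trajectory x u y \<equiv> x \<in> signals n \<and> u \<in> signals m \<and> y \<in> signals p \<and> state_trajectory A B C D x u y"

lemma mult_carriers [simp]:
  "v \<in> carrier_vec n \<Longrightarrow> A *\<^sub>v v \<in> carrier_vec n"
  "w \<in> carrier_vec m \<Longrightarrow> B *\<^sub>v w \<in> carrier_vec n"
  "v \<in> carrier_vec n \<Longrightarrow> C *\<^sub>v v \<in> carrier_vec p"
  "w \<in> carrier_vec m \<Longrightarrow> D *\<^sub>v w \<in> carrier_vec p"
  by (rule mult_mat_vec_carrier; simp)+

lemma dims [simp]: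
  "dim_row A = n" "dim_col A = n" "dim_row B = n" "dim_col B = m"
  "dim_row C = p" "dim_col C = n" "dim_row D = p" "dim_col D = m"
  using A B C D by blast+

lemma mult_zero [simp]:
  "A *\<^sub>v 0\<^sub>v n = 0\<^sub>v n" "B *\<^sub>v 0\<^sub>v m = 0\<^sub>v n" "C *\<^sub>v 0\<^sub>v n = 0\<^sub>v p" "D *\<^sub>v 0\<^sub>v m = 0\<^sub>v p"
  by (rule mult_mat_zero_vec; simp)+

lemma trajectory_state: "trajectory x u y \<Longrightarrow> x (Suc t) = A *\<^sub>v x t + B *\<^sub>v u t"
  and trajectory_output: "trajectory x u y \<Longrightarrow> y t = C *\<^sub>v x t + D *\<^sub>v u t"
  by (auto simp: state_trajectory_def)

lemma trajectory_exists:
  assumes "x0 \<in> carrier_vec n" "u \<in> signals m"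
  obtains x y where "trajectory x u y" "x 0 = x0"
proof -
  define x where "x = rec_nat x0 (\<lambda>t v. A *\<^sub>v v + B *\<^sub>v u t)"
  have x: "x t \<in> carrier_vec n" for t
    using assms by (induction t) (auto simp: x_def)
  show thesis
  proof
    show "trajectory x u (\<lambda>t. C *\<^sub>v x t + D *\<^sub>v u t)"
      using x assms by (auto intro!: signalsI simp: state_trajectory_def) (auto simp: x_def)
  qed (simp add: x_def)
qed

lemma trajectory_shift:
  "trajectory x u y \<Longrightarrow> trajectory (\<lambda>t. x (s + t)) (\<lambda>t. u (s + t)) (\<lambda>t. y (s + t))"
  by (auto simp: state_trajectory_def intro!: signalsI)

lemma trajectory_diff:
  assumes "trajectory x u y" "trajectory x' u' y'"
  shows "trajectory (\<lambda>t. x t - x' t) (\<lambda>t. u t - u' t) (\<lambda>t. y t - y' t)"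
proof -
  have c: "x t \<in> carrier_vec n" "x' t \<in> carrier_vec n" "u t \<in> carrier_vec m" "u' t \<in> carrier_vec m"
    "y t \<in> carrier_vec p" "y' t \<in> carrier_vec p" for t
    using assms by auto
  have cc: "A *\<^sub>v x t \<in> carrier_vec n" "A *\<^sub>v x' t \<in> carrier_vec n"
    "B *\<^sub>v u t \<in> carrier_vec n" "B *\<^sub>v u' t \<in> carrier_vec n"
    "C *\<^sub>v x t \<in> carrier_vec p" "C *\<^sub>v x' t \<in> carrier_vec p"
    "D *\<^sub>v u t \<in> carrier_vec p" "D *\<^sub>v u' t \<in> carrier_vec p" for t
    using c by auto
  have "x (Suc t) - x' (Suc t) = A *\<^sub>v (x t - x' t) + B *\<^sub>v (u t - u' t)"
    "y t - y' t = C *\<^sub>v (x t - x' t) + D *\<^sub>v (u t - u' t)" for t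
    unfolding trajectory_state[OF assms(1)] trajectory_state[OF assms(2)]
      trajectory_output[OF assms(1)] trajectory_output[OF assms(2)]
      mult_minus_distrib_mat_vec[OF A c(1,2)] mult_minus_distrib_mat_vec[OF B c(3,4)]
      mult_minus_distrib_mat_vec[OF C c(1,2)] mult_minus_distrib_mat_vec[OF D c(3,4)]
    using cc(1-4)[of t, THEN carrier_vecD] cc(5-8)[of t, THEN carrier_vecD]
    by (auto intro!: eq_vecI simp del: index_mult_mat_vec)
  then show ?thesis
    using assms c by (auto simp: state_trajectory_def intro!: signalsI)
qed

lemma zero_input_state:
  assumes "trajectory x u y" "\<And>t. t < K \<Longrightarrow> u t = 0\<^sub>v m" "t \<le> K"
  shows "x t = A ^\<^sub>m t *\<^sub>v x 0"
  using assms(3)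
proof (induction t)
  case (Suc t)
  have c: "x t \<in> carrier_vec n" "x 0 \<in> carrier_vec n" using assms by auto
  have "x (Suc t) = A *\<^sub>v x t" using trajectory_state[OF assms(1)] assms(2)[of t] Suc.prems c by simp
  then show ?case using Suc pow_mat_Suc_vec[OF A c(2)] by simp
qed (use assms in auto)

lemma zero_input_output:
  assumes "trajectory x u y" "\<And>t. t < K \<Longrightarrow> u t = 0\<^sub>v m" "t < K"
  shows "y t = C *\<^sub>v (A ^\<^sub>m t *\<^sub>v x 0)"
proof -
  have c: "x t \<in> carrier_vec n" "x 0 \<in> carrier_vec n" using assms by auto
  show ?thesis
  using trajectory_output[OF assms(1), of t] assms(2)[OF assms(3)] zero_input_state[OF assms(1,2), of K t] assms(3) c
  by simp
qed

lemma trajectory_agree: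
  assumes "trajectory x u y" "trajectory x' u' y'" "x 0 = x' 0" "\<And>t. t < K \<Longrightarrow> u t = u' t"
  shows "t \<le> K \<Longrightarrow> x t = x' t" and "t < K \<Longrightarrow> y t = y' t"
proof -
  show *: "x t = x' t" if "t \<le> K" for t
    using that
  proof (induction t)
    case (Suc t)
    then show ?case using trajectory_state[OF assms(1), of t] trajectory_state[OF assms(2), of t] assms(4)[of t] by simp
  qed (use assms in simp)
  show "y t = y' t" if "t < K"
    using trajectory_output[OF assms(1), of t] trajectory_output[OF assms(2), of t] assms(4)[of t] *[of t] that by simp
qed

text \<open>The free response is kept: when two representations are compared, the initial state of
  one of them is only known to be unobservable, not to be zero.\<close>

lemma impulse_state:
  assumes tr: "trajectory x u y" and e: "e \<in> carrier_vec m"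
    and u: "\<And>t. u t = (if t = K then e else 0\<^sub>v m)"
  shows "x (Suc (K + k)) = A ^\<^sub>m Suc (K + k) *\<^sub>v x 0 + A ^\<^sub>m k *\<^sub>v (B *\<^sub>v e)"
proof (induction k)
  case 0
  have c: "x 0 \<in> carrier_vec n" using tr by auto
  have "x K = A ^\<^sub>m K *\<^sub>v x 0" using zero_input_state[OF tr, of K K] u by simp
  then show ?case using trajectory_state[OF tr, of K] u[of K] e pow_mat_Suc_vec[OF A c, of K]
    by simp
next
  case (Suc k)
  have c: "x 0 \<in> carrier_vec n" "x (Suc (K + k)) \<in> carrier_vec n" using tr by auto
  have "x (Suc (K + Suc k)) = A *\<^sub>v x (Suc (K + k))"
    using trajectory_state[OF tr, of "Suc (K + k)"] u c by simp
  also have "\<dots> = A *\<^sub>v (A ^\<^sub>m Suc (K + k) *\<^sub>v x 0) + A *\<^sub>v (A ^\<^sub>m k *\<^sub>v (B *\<^sub>v e))"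
    unfolding Suc using c e by (intro mult_add_distrib_mat_vec[of _ n n]) (auto simp del: pow_mat.simps)
  also have "\<dots> = A ^\<^sub>m Suc (Suc (K + k)) *\<^sub>v x 0 + A ^\<^sub>m Suc k *\<^sub>v (B *\<^sub>v e)"
    using c e by (simp only: pow_mat_Suc_vec[OF A] mult_carriers)
  finally show ?case by simp
qed

lemma unobservable_all_times:
  assumes v: "v \<in> carrier_vec n" and z: "\<And>t. t < n \<Longrightarrow> C *\<^sub>v (A ^\<^sub>m t *\<^sub>v v) = 0\<^sub>v p"
  shows "C *\<^sub>v (A ^\<^sub>m t *\<^sub>v v) = 0\<^sub>v p"
proof (intro eq_vecI)
  fix i assume "i < dim_vec (0\<^sub>v p :: real vec)"
  then have i: "i < p" by simp
  have idx: "(C *\<^sub>v (A ^\<^sub>m t *\<^sub>v v)) $ i = row C i \<bullet> (A ^\<^sub>m t *\<^sub>v v)" for t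
    using i by simp
  have "row C i \<bullet> (A ^\<^sub>m t *\<^sub>v v) = 0"
  proof (rule annihilated_orbit[OF A v])
    show "row C i \<in> carrier_vec n" using row_carrier[of C i] by simp
    show "row C i \<bullet> (A ^\<^sub>m t *\<^sub>v v) = 0" if "t < n" for t
      using idx[of t] z[OF that] i by simp
  qed
  then show "(C *\<^sub>v (A ^\<^sub>m t *\<^sub>v v)) $ i = 0\<^sub>v p $ i" using i by simp
qed (use C in auto)

definition observable :: bool where
  "observable \<longleftrightarrow> (\<forall>v\<in>carrier_vec n. (\<forall>t<n. C *\<^sub>v (A ^\<^sub>m t *\<^sub>v v) = 0\<^sub>v p) \<longrightarrow> v = 0\<^sub>v n)"

text \<open>Reachability in dual form: no nonzero vector is orthogonal to all reachable directions.
  In this form it refutes left annihilators of the data.\<close>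

definition reachable :: bool where
  "reachable \<longleftrightarrow> (\<forall>\<xi>\<in>carrier_vec n.
     (\<forall>k. \<forall>w\<in>carrier_vec m. \<xi> \<bullet> (A ^\<^sub>m k *\<^sub>v (B *\<^sub>v w)) = 0) \<longrightarrow> \<xi> = 0\<^sub>v n)"

text \<open>\<open>P\<close> gives coordinates on the quotient by the unobservable subspace, and
  \<open>R\<close> is a section of it.\<close>

lemma unobservable_as_mat_kernel:
  obtains k P R where "P \<in> carrier_mat k n" "R \<in> carrier_mat n k" "P * R = 1\<^sub>m k"
    "\<And>v. v \<in> carrier_vec n \<Longrightarrow> P *\<^sub>v v = 0\<^sub>v k \<longleftrightarrow> (\<forall>t. C *\<^sub>v (A ^\<^sub>m t *\<^sub>v v) = 0\<^sub>v p)"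
proof -
  define S where "S = (\<lambda>(t,i). row (C * A ^\<^sub>m t) i) ` ({..<n} \<times> {..<p})"
  have "finite S" by (simp add: S_def)
  moreover have "S \<subseteq> carrier_vec n"
    by (auto simp: S_def intro!: carrier_vecI)
  moreover have "(\<forall>s\<in>S. s \<bullet> v = 0) \<longleftrightarrow> (\<forall>t. C *\<^sub>v (A ^\<^sub>m t *\<^sub>v v) = 0\<^sub>v p)" if v: "v \<in> carrier_vec n" for v
  proof -
    have At: "A ^\<^sub>m t \<in> carrier_mat n n" for t by simp
    have "row (C * A ^\<^sub>m t) i \<bullet> v = (C *\<^sub>v (A ^\<^sub>m t *\<^sub>v v)) $ i" if "i < p" for t i
      unfolding assoc_mult_mat_vec[OF C At v, symmetric] using that by simp
    then have "(\<forall>s\<in>S. s \<bullet> v = 0) \<longleftrightarrow> (\<forall>t<n. \<forall>i<p. (C *\<^sub>v (A ^\<^sub>m t *\<^sub>v v)) $ i = 0)"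
      by (auto simp: S_def simp del: index_mult_mat_vec)
    also have "\<dots> \<longleftrightarrow> (\<forall>t<n. C *\<^sub>v (A ^\<^sub>m t *\<^sub>v v) = 0\<^sub>v p)"
      by (auto simp: vec_eq_iff simp del: index_mult_mat_vec)
    also have "\<dots> \<longleftrightarrow> (\<forall>t. C *\<^sub>v (A ^\<^sub>m t *\<^sub>v v) = 0\<^sub>v p)"
      using unobservable_all_times[OF v] by blast
    finally show ?thesis .
  qed
  ultimately show thesis
    using common_kernel_as_mat_kernel[of S n] that by (smt (verit))
qed

end

lemma state_rep_linear_system:
  "state_rep m p \<B> n A B C D \<Longrightarrow> linear_system n m p A B C D"
  by (simp add: state_rep_def linear_system_def)

text \<open>Otherwise the quotient by the unobservable subspace would realize the same behavior with
  \<open>k < n\<close> states. It inherits the dynamics because this subspace is invariant under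
  \<open>A\<close> and annihilated by \<open>C\<close>.\<close>

lemma minimal_rep_observable:
  assumes min: "minimal_rep m p \<B> n A B C D"
  shows "linear_system.observable n p A C"
proof -
  have rep: "state_rep m p \<B> n A B C D" using min unfolding minimal_rep_def by blast
  interpret linear_system n m p A B C D by (rule state_rep_linear_system[OF rep])
  obtain k P R where P: "P \<in> carrier_mat k n" and R: "R \<in> carrier_mat n k" and PR: "P * R = 1\<^sub>m k"
    and ker: "\<And>v. v \<in> carrier_vec n \<Longrightarrow> P *\<^sub>v v = 0\<^sub>v k \<longleftrightarrow> (\<forall>t. C *\<^sub>v (A ^\<^sub>m t *\<^sub>v v) = 0\<^sub>v p)"
    by (rule unobservable_as_mat_kernel) blast
  define A' B' C' where "A' = P * (A * R)" and "B' = P * B" and "C' = C * R"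
  interpret red: linear_system k m p A' B' C' D
    using P R by unfold_locales (auto simp: A'_def B'_def C'_def)
  have PRv: "P *\<^sub>v (R *\<^sub>v w) = w" if "w \<in> carrier_vec k" for w
    using that PR assoc_mult_mat_vec[OF P R that] by simp
  \<comment> \<open>\<open>P\<close> kills the difference \<open>w\<close> of \<open>v\<close> and
    \<open>R *\<^sub>v (P *\<^sub>v v)\<close>, so \<open>w\<close> and with it
    \<open>A *\<^sub>v w\<close> are unobservable.\<close>
  have proj: "C *\<^sub>v (R *\<^sub>v (P *\<^sub>v v)) = C *\<^sub>v v" "P *\<^sub>v (A *\<^sub>v (R *\<^sub>v (P *\<^sub>v v))) = P *\<^sub>v (A *\<^sub>v v)"
    if v: "v \<in> carrier_vec n" for v
  proof -
    define w where "w = v - R *\<^sub>v (P *\<^sub>v v)"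
    have Pv: "P *\<^sub>v v \<in> carrier_vec k" using P v by simp
    have RPv: "R *\<^sub>v (P *\<^sub>v v) \<in> carrier_vec n" using R Pv by simp
    have w: "w \<in> carrier_vec n" using v RPv by (simp add: w_def)
    have "P *\<^sub>v w = P *\<^sub>v v - P *\<^sub>v v"
      unfolding w_def mult_minus_distrib_mat_vec[OF P v RPv] PRv[OF Pv] ..
    then have Pw: "P *\<^sub>v w = 0\<^sub>v k" using Pv by simp
    have "C *\<^sub>v w = 0\<^sub>v p" using ker[OF w] Pw w by (metis A carrier_matD(1) one_mult_mat_vec pow_mat.simps(1))
    then have "C *\<^sub>v v - C *\<^sub>v (R *\<^sub>v (P *\<^sub>v v)) = 0\<^sub>v p"
      unfolding w_def mult_minus_distrib_mat_vec[OF C v RPv] .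
    then show "C *\<^sub>v (R *\<^sub>v (P *\<^sub>v v)) = C *\<^sub>v v" using v RPv by (auto simp: vec_eq_iff simp del: index_mult_mat_vec)
    have "C *\<^sub>v (A ^\<^sub>m t *\<^sub>v (A *\<^sub>v w)) = 0\<^sub>v p" for t
      using ker[OF w] Pw pow_mat_add_vec[OF A w, of t 1] w by (auto dest: spec[of _ "Suc t"])
    then have "P *\<^sub>v (A *\<^sub>v w) = 0\<^sub>v k" using ker[of "A *\<^sub>v w"] w by simp
    then have "P *\<^sub>v (A *\<^sub>v v) - P *\<^sub>v (A *\<^sub>v (R *\<^sub>v (P *\<^sub>v v))) = 0\<^sub>v k"
      unfolding w_def using v RPv by (simp add: mult_minus_distrib_mat_vec[OF A v RPv] mult_minus_distrib_mat_vec[OF P])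
    then show "P *\<^sub>v (A *\<^sub>v (R *\<^sub>v (P *\<^sub>v v))) = P *\<^sub>v (A *\<^sub>v v)"
      using P by (auto simp: vec_eq_iff simp del: index_mult_mat_vec)
  qed
  have vecs: "A' *\<^sub>v z = P *\<^sub>v (A *\<^sub>v (R *\<^sub>v z))" "C' *\<^sub>v z = C *\<^sub>v (R *\<^sub>v z)" if z: "z \<in> carrier_vec k" for z
  proof -
    have "A * R \<in> carrier_mat n k" by (rule mult_carrier_mat[OF A R])
    from assoc_mult_mat_vec[OF P this z] assoc_mult_mat_vec[OF A R z] assoc_mult_mat_vec[OF C R z]
    show "A' *\<^sub>v z = P *\<^sub>v (A *\<^sub>v (R *\<^sub>v z))" "C' *\<^sub>v z = C *\<^sub>v (R *\<^sub>v z)"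
      unfolding A'_def C'_def by simp_all
  qed
  have vecB: "B' *\<^sub>v w = P *\<^sub>v (B *\<^sub>v w)" if "w \<in> carrier_vec m" for w
    unfolding B'_def by (rule assoc_mult_mat_vec[OF P B that])
  have project: "red.trajectory (\<lambda>t. P *\<^sub>v x t) u y" if tr: "trajectory x u y" for x u y
  proof -
    have c: "x t \<in> carrier_vec n" "u t \<in> carrier_vec m" for t using tr by auto
    have "P *\<^sub>v x (Suc t) = A' *\<^sub>v (P *\<^sub>v x t) + B' *\<^sub>v u t" for t
      unfolding trajectory_state[OF tr] using c P
      by (simp add: vecs vecB proj mult_add_distrib_mat_vec[OF P])
    moreover have "y t = C' *\<^sub>v (P *\<^sub>v x t) + D *\<^sub>v u t" for t
      unfolding trajectory_output[OF tr] using c P by (simp add: vecs proj)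
    ultimately show ?thesis using tr c P by (auto simp: state_trajectory_def intro!: signalsI)
  qed
  \<comment> \<open>The lift starts at \<open>R *\<^sub>v z 0\<close>. Its projection is a reduced
    trajectory with the initial state and the input of the given one, so the outputs
    coincide.\<close>
  have lift: "\<exists>x. trajectory x u y" if tr: "red.trajectory z u y" for z u y
  proof -
    have z: "z 0 \<in> carrier_vec k" and u: "u \<in> signals m" using tr by auto
    obtain x y' where x: "trajectory x u y'" "x 0 = R *\<^sub>v z 0"
      using trajectory_exists[of "R *\<^sub>v z 0" u] u z R by auto
    have "y' t = y t" for t
      using red.trajectory_agree(2)[OF project[OF x(1)] tr, of "Suc t" t] x(2) PRv[OF z] by simp
    then have "y' = y" by auto
    with x show ?thesis by blast
  qed
  have "state_rep m p \<B> k A' B' C' D"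
    using rep red.linear_system_axioms project lift
    unfolding state_rep_def linear_system_def by (smt (verit) Collect_cong)
  then have "mcmillan_degree m p \<B> \<le> k"
    unfolding mcmillan_degree_def by (intro Least_le) blast
  then have "\<not> k < n" using min by (simp add: minimal_rep_def)
  then have "P *\<^sub>v v = 0\<^sub>v k \<Longrightarrow> v = 0\<^sub>v n" if "v \<in> carrier_vec n" for v
    using right_inverse_dims[OF P R PR that] by blast
  then show ?thesis
    unfolding observable_def using ker unobservable_all_times by metis
qed

section \<open>Markov parameters and reachability\<close>

lemma mat_eqI_action:
  fixes A B :: "real mat"
  assumes A: "A \<in> carrier_mat nr nc" and B: "B \<in> carrier_mat nr nc"
    and eq: "\<And>e. e \<in> carrier_vec nc \<Longrightarrow> A *\<^sub>v e = B *\<^sub>v e"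
  shows "A = B"
proof (rule eq_matI)
  fix i j assume ij: "i < dim_row B" "j < dim_col B"
  have "(A *\<^sub>v unit_vec nc j) $ i = (B *\<^sub>v unit_vec nc j) $ i" by (simp add: eq)
  then show "A $$ (i,j) = B $$ (i,j)" using ij A B by simp
qed (use A B in auto)

text \<open>An impulse response of the first representation is realized by the second with some
  initial state, possibly nonzero. Zero input and output before the impulse make that state
  unobservable, so it contributes to no later output.\<close>

lemma markov_action_unique:
  assumes rep: "state_rep m p \<B> n A B C D" and rep': "state_rep m p \<B> n' A' B' C' D'"
    and e: "e \<in> carrier_vec m"
  shows "D *\<^sub>v e = D' *\<^sub>v e" and "C *\<^sub>v (A ^\<^sub>m k *\<^sub>v (B *\<^sub>v e)) = C' *\<^sub>v (A' ^\<^sub>m k *\<^sub>v (B' *\<^sub>v e))"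
proof -
  interpret S: linear_system n m p A B C D by (rule state_rep_linear_system[OF rep])
  interpret S': linear_system n' m p A' B' C' D' by (rule state_rep_linear_system[OF rep'])
  \<comment> \<open>This many silent samples before the impulse suffice to show that
    \<open>x' 0\<close> is unobservable.\<close>
  define K where "K = n'"
  define u where "u t = (if t = K then e else 0\<^sub>v m)" for t :: nat
  have u: "u \<in> signals m" using e by (auto simp: u_def intro!: signalsI)
  obtain x y where tr: "S.trajectory x u y" and x0: "x 0 = 0\<^sub>v n"
    using S.trajectory_exists[of "0\<^sub>v n" u] u by auto
  have "(\<lambda>t. u t @\<^sub>v y t) \<in> \<B>" using state_rep_iff[OF rep] tr by blast
  then obtain x' where tr': "S'.trajectory x' u y"
    using state_rep_iff[OF rep'] tr by blast
  have x0': "x' 0 \<in> carrier_vec n'" using tr' by auto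
  have uK: "u t = 0\<^sub>v m" if "t < K" for t using that by (simp add: u_def)
  have Az: "A ^\<^sub>m t *\<^sub>v 0\<^sub>v n = 0\<^sub>v n" for t by (rule mult_mat_zero_vec) simp
  have unobs: "C' *\<^sub>v (A' ^\<^sub>m t *\<^sub>v x' 0) = 0\<^sub>v p" for t
  proof (rule S'.unobservable_all_times[OF x0'])
    fix t assume "t < n'"
    then show "C' *\<^sub>v (A' ^\<^sub>m t *\<^sub>v x' 0) = 0\<^sub>v p"
      using S.zero_input_output[OF tr uK, of K t] S'.zero_input_output[OF tr' uK, of K t]
      by (simp add: K_def x0 Az)
  qed
  have "y K = D *\<^sub>v e"
    using S.trajectory_output[OF tr, of K] S.zero_input_state[OF tr uK, of K K] e
    by (simp add: x0 Az u_def)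
  moreover have "y K = D' *\<^sub>v e"
    using S'.trajectory_output[OF tr', of K] S'.zero_input_state[OF tr' uK, of K K] e unobs[of K]
    by (simp add: u_def)
  ultimately show "D *\<^sub>v e = D' *\<^sub>v e" by simp
  have c: "A ^\<^sub>m k *\<^sub>v (B *\<^sub>v e) \<in> carrier_vec n" "A' ^\<^sub>m k *\<^sub>v (B' *\<^sub>v e) \<in> carrier_vec n'"
    "A' ^\<^sub>m Suc (K + k) *\<^sub>v x' 0 \<in> carrier_vec n'"
    using e x0' by (auto simp del: pow_mat.simps)
  have "y (Suc (K + k)) = C *\<^sub>v (A ^\<^sub>m k *\<^sub>v (B *\<^sub>v e))"
    using S.trajectory_output[OF tr, of "Suc (K + k)"] S.impulse_state[OF tr e u_def, of k] c
    by (simp add: x0 Az u_def del: pow_mat.simps)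
  moreover have "y (Suc (K + k)) = C' *\<^sub>v (A' ^\<^sub>m k *\<^sub>v (B' *\<^sub>v e))"
    using S'.trajectory_output[OF tr', of "Suc (K + k)"] S'.impulse_state[OF tr' e u_def, of k] c
      unobs[of "Suc (K + k)"]
    by (simp add: u_def mult_add_distrib_mat_vec[OF S'.C] del: pow_mat.simps)
  ultimately show "C *\<^sub>v (A ^\<^sub>m k *\<^sub>v (B *\<^sub>v e)) = C' *\<^sub>v (A' ^\<^sub>m k *\<^sub>v (B' *\<^sub>v e))" by simp
qed

lemma markov_parameters_unique:
  assumes rep: "state_rep m p \<B> n A B C D" and rep': "state_rep m p \<B> n' A' B' C' D'"
  shows "D = D'" and "C * A ^\<^sub>m k * B = C' * A' ^\<^sub>m k * B'"
proof -
  interpret S: linear_system n m p A B C D by (rule state_rep_linear_system[OF rep])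
  interpret S': linear_system n' m p A' B' C' D' by (rule state_rep_linear_system[OF rep'])
  show "D = D'"
    by (rule mat_eqI_action[OF S.D S'.D markov_action_unique(1)[OF assms]])
  have Ak: "A ^\<^sub>m k \<in> carrier_mat n n" "A' ^\<^sub>m k \<in> carrier_mat n' n'" by simp_all
  have CA: "C * A ^\<^sub>m k \<in> carrier_mat p n" "C' * A' ^\<^sub>m k \<in> carrier_mat p n'"
    by (rule mult_carrier_mat[OF S.C Ak(1)], rule mult_carrier_mat[OF S'.C Ak(2)])
  show "C * A ^\<^sub>m k * B = C' * A' ^\<^sub>m k * B'"
  proof (rule mat_eqI_action[OF mult_carrier_mat[OF CA(1) S.B] mult_carrier_mat[OF CA(2) S'.B]])
    fix e :: "real vec" assume e: "e \<in> carrier_vec m"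
    have Be: "B *\<^sub>v e \<in> carrier_vec n" "B' *\<^sub>v e \<in> carrier_vec n'" using e by auto
    show "C * A ^\<^sub>m k * B *\<^sub>v e = C' * A' ^\<^sub>m k * B' *\<^sub>v e"
      unfolding assoc_mult_mat_vec[OF CA(1) S.B e] assoc_mult_mat_vec[OF CA(2) S'.B e]
        assoc_mult_mat_vec[OF S.C Ak(1) Be(1)] assoc_mult_mat_vec[OF S'.C Ak(2) Be(2)]
      by (rule markov_action_unique(2)[OF assms e])
  qed
qed

context linear_system
begin

text \<open>The difference of the two trajectories has zero input and zero output for
  \<open>n\<close> steps.\<close>

lemma observable_state_eq:
  assumes obs: observable and tr: "trajectory x u y" and tr': "trajectory x' u' y'"
    and u: "\<And>t. t < n \<Longrightarrow> u t = u' t" and y: "\<And>t. t < n \<Longrightarrow> y t = y' t"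
  shows "x 0 = x' 0"
proof -
  note d = trajectory_diff[OF tr tr']
  have c: "u t \<in> carrier_vec m" "y t \<in> carrier_vec p" "x t \<in> carrier_vec n" "x' t \<in> carrier_vec n" for t
    using tr tr' by auto
  have "C *\<^sub>v (A ^\<^sub>m t *\<^sub>v (x 0 - x' 0)) = 0\<^sub>v p" if "t < n" for t
  proof -
    have "u s - u' s = 0\<^sub>v m" if "s < n" for s using u[OF that] c(1)[of s] by simp
    from zero_input_output[OF d this that] show ?thesis using y[OF that] c(2)[of t] by simp
  qed
  moreover have "x 0 - x' 0 \<in> carrier_vec n" using c by simp
  ultimately have "x 0 - x' 0 = 0\<^sub>v n" using obs unfolding observable_def by blast
  then show ?thesis using c[of 0] by (auto simp: vec_eq_iff)
qed

lemma zero_trajectory: "trajectory (\<lambda>t. 0\<^sub>v n) (\<lambda>t. 0\<^sub>v m) (\<lambda>t. 0\<^sub>v p)"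
  by (auto simp: state_trajectory_def intro!: signalsI)

text \<open>Controllability joins the zero trajectory to the free motion from \<open>\<xi>\<close>.
  Observability identifies the states at the two ends as zero and \<open>\<xi>\<close>; every state
  reached from zero is orthogonal to \<open>\<xi>\<close>, so
  \<open>\<xi> \<bullet> \<xi> = 0\<close>.\<close>

lemma controllable_reachable:
  assumes rep: "state_rep m p \<B> n A B C D" and ctrl: "controllable \<B>" and obs: observable
  shows reachable
  unfolding reachable_def
proof (intro ballI impI)
  fix \<xi> :: "real vec" assume \<xi>: "\<xi> \<in> carrier_vec n"
    and z: "\<forall>k. \<forall>w\<in>carrier_vec m. \<xi> \<bullet> (A ^\<^sub>m k *\<^sub>v (B *\<^sub>v w)) = 0"
  define z0 where "z0 = (\<lambda>t::nat. 0\<^sub>v m @\<^sub>v 0\<^sub>v p :: real vec)"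
  have z0: "z0 \<in> \<B>" unfolding z0_def using state_rep_iff[OF rep, of "\<lambda>t. 0\<^sub>v m" "\<lambda>t. 0\<^sub>v p"] zero_trajectory by blast
  obtain xf yf where trf: "trajectory xf (\<lambda>t. 0\<^sub>v m) yf" and xf0: "xf 0 = \<xi>"
    using trajectory_exists[OF \<xi>, of "\<lambda>t. 0\<^sub>v m"] zero_trajectory by metis
  define wf where "wf = (\<lambda>t. 0\<^sub>v m @\<^sub>v yf t)"
  have wf: "wf \<in> \<B>" unfolding wf_def using state_rep_iff[OF rep, of "\<lambda>t. 0\<^sub>v m" yf] trf by blast
  \<comment> \<open>Long enough for \<open>n\<close> zero samples to fix the initial state, and at
    least 1 even for \<open>n = 0\<close>.\<close>
  define T where "T = Suc n"
  have "restrict z0 {0..T} \<in> restr \<B> 0 T" using z0 by (simp add: restr_def)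
  then obtain T' v where v: "v \<in> \<B>" "restrict v {0..T} = restrict z0 {0..T}"
    "\<And>t. t \<ge> T + T' \<Longrightarrow> v t = wf (t - T - T')"
    using ctrl wf unfolding controllable_def T_def by (metis le_add1 plus_1_eq_Suc)
  obtain u y x where vv: "v = (\<lambda>t. u t @\<^sub>v y t)" and tr: "trajectory x u y"
    using state_rep_cases[OF rep v(1)] by metis
  have uc: "u t \<in> carrier_vec m" for t using tr by auto
  have past: "u t = 0\<^sub>v m \<and> y t = 0\<^sub>v p" if "t < n" for t
  proof -
    have "v t = z0 t" using v(2) that by (auto simp: T_def dest!: fun_cong[of _ _ t])
    then show ?thesis using append_vec_eq[OF uc[of t], of "0\<^sub>v m"] by (simp add: vv z0_def)
  qed
  have x0: "x 0 = 0\<^sub>v n"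
    using observable_state_eq[OF obs tr zero_trajectory] past by simp
  have fut: "u (T + T' + t) = 0\<^sub>v m \<and> y (T + T' + t) = yf t" for t
    using v(3)[of "T + T' + t"] append_vec_eq[OF uc, of "0\<^sub>v m"] by (simp add: vv wf_def)
  have "x (T + T') = \<xi>"
    using observable_state_eq[OF obs trajectory_shift[OF tr, of "T + T'"] trf] fut xf0 by simp
  \<comment> \<open>The power is generalized because one time step turns \<open>k\<close> into
    \<open>Suc k\<close>.\<close>
  moreover have "\<xi> \<bullet> (A ^\<^sub>m k *\<^sub>v x t) = 0" for k t
  proof (induction t arbitrary: k)
    case 0
    have "A ^\<^sub>m k *\<^sub>v 0\<^sub>v n = 0\<^sub>v n" by (rule mult_mat_zero_vec) simp
    then show ?case unfolding x0 using \<xi> by (metis scalar_prod_right_zero)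
  next
    case (Suc t)
    have c: "x t \<in> carrier_vec n" "u t \<in> carrier_vec m" using tr by auto
    have Ak: "A ^\<^sub>m k \<in> carrier_mat n n" by simp
    have "\<xi> \<bullet> (A ^\<^sub>m k *\<^sub>v x (Suc t)) = \<xi> \<bullet> (A ^\<^sub>m Suc k *\<^sub>v x t) + \<xi> \<bullet> (A ^\<^sub>m k *\<^sub>v (B *\<^sub>v u t))"
      unfolding trajectory_state[OF tr] using c \<xi>
      by (simp add: mult_add_distrib_mat_vec[OF Ak] scalar_prod_add_distrib[of _ n] assoc_mult_mat_vec[OF Ak A])
    then show ?case using Suc.IH[of "Suc k"] z c by (simp del: pow_mat.simps)
  qed
  from this[of 0 "T + T'"] have "\<xi> \<bullet> x (T + T') = 0" using tr by simp
  ultimately show "\<xi> = 0\<^sub>v n" using conjugate_square_eq_0_vec[OF \<xi>] by simp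
qed

end

section \<open>The fundamental lemma\<close>

lemma sum_blocks:
  fixes f :: "nat \<Rightarrow> nat \<Rightarrow> real"
  shows "(\<Sum>i<L * m. f (i div m) (i mod m)) = (\<Sum>s<L. \<Sum>q<m. f s q)"
proof -
  have "(\<Sum>i<L * m. f (i div m) (i mod m)) = (\<Sum>s<L. \<Sum>i\<in>{s * m..<s * m + m}. f (i div m) (i mod m))"
    by (rule sum.nat_group[symmetric])
  also have "\<dots> = (\<Sum>s<L. \<Sum>q<m. f s q)"
  proof (rule sum.cong[OF refl])
    fix s
    have "(\<Sum>i\<in>{s * m..<s * m + m}. f (i div m) (i mod m))
        = (\<Sum>q\<in>{0..<m}. f ((q + s * m) div m) ((q + s * m) mod m))"
      using sum.shift_bounds_nat_ivl[of "\<lambda>i. f (i div m) (i mod m)" 0 "s * m" m] by (simp add: add.commute)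
    also have "\<dots> = (\<Sum>q<m. f s q)"
      unfolding lessThan_atLeast0 by (rule sum.cong) auto
    finally show "(\<Sum>i\<in>{s * m..<s * m + m}. f (i div m) (i mod m)) = (\<Sum>q<m. f s q)" .
  qed
  finally show ?thesis .
qed

lemma block_index_less:
  fixes s q m L :: nat
  assumes "s < L" "q < m"
  shows "s * m + q < L * m"
proof -
  have "s * m + q < Suc s * m" using assms by simp
  also have "\<dots> \<le> L * m" using assms by (intro mult_le_mono1) simp
  finally show ?thesis .
qed

lemma div_mod_less:
  fixes i m L :: nat
  assumes "i < L * m"
  shows "i div m < L" "i mod m < m"
  using assms by (auto simp: less_mult_imp_div_less intro!: mod_less_divisor gr0I)

lemma dim_stack [simp]: "dim_vec (stack m L u) = L * m"
  by (simp add: stack_def)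

lemma stack_carrier [simp]: "stack m L u \<in> carrier_vec (L * m)"
  by (rule carrier_vecI) simp

lemma stack_index: "i < L * m \<Longrightarrow> stack m L u $ i = u (i div m) $ (i mod m)"
  by (simp add: stack_def)

lemma stack_scalar_prod:
  assumes "\<And>s. s < L \<Longrightarrow> \<phi> s \<in> carrier_vec m"
  shows "stack m L \<theta> \<bullet> stack m L \<phi> = (\<Sum>s<L. \<theta> s \<bullet> \<phi> s)"
proof -
  have "stack m L \<theta> \<bullet> stack m L \<phi> = (\<Sum>i<L * m. \<theta> (i div m) $ (i mod m) * \<phi> (i div m) $ (i mod m))"
    by (simp add: scalar_prod_def stack_index lessThan_atLeast0)
  also have "\<dots> = (\<Sum>s<L. \<Sum>q<m. \<theta> s $ q * \<phi> s $ q)"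
    by (rule sum_blocks)
  also have "\<dots> = (\<Sum>s<L. \<theta> s \<bullet> \<phi> s)"
    using carrier_vecD[OF assms] by (intro sum.cong) (auto simp: scalar_prod_def lessThan_atLeast0)
  finally show ?thesis .
qed

lemma stack_eq_iff:
  assumes "\<And>s. s < L \<Longrightarrow> \<theta> s \<in> carrier_vec m" "\<And>s. s < L \<Longrightarrow> \<phi> s \<in> carrier_vec m"
  shows "stack m L \<theta> = stack m L \<phi> \<longleftrightarrow> (\<forall>s<L. \<theta> s = \<phi> s)"
proof
  assume eq: "stack m L \<theta> = stack m L \<phi>"
  show "\<forall>s<L. \<theta> s = \<phi> s"
  proof (intro allI impI eq_vecI)
    fix s q assume s: "s < L" and "q < dim_vec (\<phi> s)"
    then have q: "q < m" using assms(2)[OF s] by simp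
    then show "\<theta> s $ q = \<phi> s $ q"
      using arg_cong[OF eq, of "\<lambda>v. v $ (s * m + q)"] stack_index[OF block_index_less[OF s q]] by simp
  next
    fix s assume "s < L"
    then show "dim_vec (\<theta> s) = dim_vec (\<phi> s)" using assms[of s] by simp
  qed
next
  assume "\<forall>s<L. \<theta> s = \<phi> s"
  then show "stack m L \<theta> = stack m L \<phi>"
    by (intro eq_vecI) (auto simp: stack_index div_mod_less)
qed

lemma stack_zero: "stack m L (\<lambda>t. 0\<^sub>v m) = 0\<^sub>v (L * m)"
  by (intro eq_vecI) (auto simp: stack_index div_mod_less)

lemma stack_surj:
  assumes "v \<in> carrier_vec (L * m)"
  obtains \<theta> where "\<theta> \<in> signals m" "v = stack m L \<theta>"
proof
  show "(\<lambda>s. vec m (\<lambda>q. v $ (s * m + q))) \<in> signals m" by (intro signalsI) simp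
  show "v = stack m L (\<lambda>s. vec m (\<lambda>q. v $ (s * m + q)))"
    using assms by (intro eq_vecI) (auto simp: stack_index div_mod_less)
qed

lemma hankel_carrier [simp]: "hankel m T L f \<in> carrier_mat (L * m) (T + 2 - L)"
  by (simp add: hankel_def)

lemma col_hankel: "j < T + 2 - L \<Longrightarrow> col (hankel m T L f) j = stack m L (\<lambda>s. f (s + j))"
  by (intro eq_vecI) (auto simp: hankel_def stack_index)

text \<open>The columns of the Hankel matrix are the stacked windows of \<open>u\<close>, so
  \<open>\<theta>\<close> is a left annihilator of a matrix of full row rank.\<close>

lemma persistently_exciting_annihilator:
  assumes pe: "persistently_exciting m T K u" and u: "u \<in> signals m" and \<theta>: "\<theta> \<in> signals m"
    and zero: "\<And>j. j < T + 2 - K \<Longrightarrow> (\<Sum>s<K. \<theta> s \<bullet> u (s + j)) = 0" and s: "s < K"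
  shows "\<theta> s = 0\<^sub>v m"
proof -
  have "stack m K \<theta> = 0\<^sub>v (K * m)"
  proof (rule full_row_rank_left_kernel[OF hankel_carrier])
    show "vec_space.rank (K * m) (hankel m T K u) = K * m"
      using pe by (simp add: persistently_exciting_def)
    show "stack m K \<theta> \<bullet> col (hankel m T K u) j = 0" if "j < T + 2 - K" for j
      using zero[OF that] u by (simp add: col_hankel[OF that] stack_scalar_prod)
  qed simp
  then show ?thesis using stack_eq_iff[of K \<theta> m "\<lambda>_. 0\<^sub>v m"] \<theta> s by (simp add: stack_zero)
qed

lemma transpose_pow_scalar_prod:
  fixes A :: "real mat"
  assumes A: "A \<in> carrier_mat n n" and x: "x \<in> carrier_vec n" and y: "y \<in> carrier_vec n"
  shows "((A\<^sup>T) ^\<^sub>m k *\<^sub>v x) \<bullet> y = x \<bullet> (A ^\<^sub>m k *\<^sub>v y)"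
  using y
proof (induction k arbitrary: y)
  case (Suc k)
  have At: "A\<^sup>T \<in> carrier_mat n n" using A by simp
  have c: "(A\<^sup>T) ^\<^sub>m k *\<^sub>v x \<in> carrier_vec n" "A *\<^sub>v y \<in> carrier_vec n" using A At x Suc.prems by auto
  have "((A\<^sup>T) ^\<^sub>m Suc k *\<^sub>v x) \<bullet> y = ((A\<^sup>T) ^\<^sub>m k *\<^sub>v x) \<bullet> (A *\<^sub>v y)"
    unfolding pow_mat_Suc_vec[OF At x] by (rule transpose_vec_mult_scalar[OF A Suc.prems c(1)])
  also have "\<dots> = x \<bullet> (A ^\<^sub>m k *\<^sub>v (A *\<^sub>v y))" by (rule Suc.IH[OF c(2)])
  also have "A ^\<^sub>m k *\<^sub>v (A *\<^sub>v y) = A ^\<^sub>m Suc k *\<^sub>v y"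
    using pow_mat_add_vec[OF A Suc.prems, of k 1] A Suc.prems by simp
  finally show ?case .
qed (use A x in simp)

context linear_system
begin

text \<open>A left annihilator \<open>(\<xi>, \<eta>)\<close> of the state and input data yields, by pushing the states forward
  and eliminating them with a monic polynomial relation of degree \<open>k0 \<le> n\<close>, an annihilator \<open>\<theta>\<close> of the
  Hankel matrix of depth \<open>L + n\<close>. The sequence \<open>\<omega>\<close> lists \<open>\<eta>\<close> backwards, followed by the functionals
  \<open>\<xi> A^k B\<close>; that \<open>\<theta>\<close> vanishes is a linear recursion forcing \<open>\<omega>\<close> to vanish.\<close>

lemma data_left_kernel_trivial:
  assumes tr: "trajectory x u y" and reach: reachable
    and pe: "persistently_exciting m T (L + n) u"
    and \<xi>: "\<xi> \<in> carrier_vec n" and \<eta>: "\<eta> \<in> signals m"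
    and zero: "\<And>j. j < T + 2 - L \<Longrightarrow> \<xi> \<bullet> x j + (\<Sum>i<L. \<eta> i \<bullet> u (i + j)) = 0"
  shows "\<xi> = 0\<^sub>v n" and "i < L \<Longrightarrow> \<eta> i = 0\<^sub>v m"
proof -
  have x: "x t \<in> carrier_vec n" and u: "u t \<in> carrier_vec m" for t using tr by auto
  have At: "A\<^sup>T \<in> carrier_mat n n" and Bt: "B\<^sup>T \<in> carrier_mat m n" by simp_all
  have Atk: "(A\<^sup>T) ^\<^sub>m k *\<^sub>v \<xi> \<in> carrier_vec n" for k using \<xi> At by simp
  define \<omega> where "\<omega> i = (if i < L then \<eta> (L - 1 - i) else B\<^sup>T *\<^sub>v ((A\<^sup>T) ^\<^sub>m (i - L) *\<^sub>v \<xi>))" for i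
  have \<omega>: "\<omega> i \<in> carrier_vec m" for i
    using \<eta> mult_mat_vec_carrier[OF Bt Atk] by (simp add: \<omega>_def)
  have \<omega>_ge: "\<omega> (L + k) \<bullet> w = \<xi> \<bullet> (A ^\<^sub>m k *\<^sub>v (B *\<^sub>v w))" if w: "w \<in> carrier_vec m" for k w
    unfolding \<omega>_def
    using transpose_vec_mult_scalar[OF B w Atk[of k]] transpose_pow_scalar_prod[OF A \<xi>, of "B *\<^sub>v w" k] w
    by simp
  \<comment> \<open>Each step takes the relation one sample later and substitutes the state equation
    there; the new term in \<open>u j\<close> comes in front with coefficient
    \<open>\<omega> (L + k)\<close>.\<close>
  have push: "\<xi> \<bullet> (A ^\<^sub>m k *\<^sub>v x j) + (\<Sum>s<L + k. \<omega> (L + k - 1 - s) \<bullet> u (s + j)) = 0"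
    if "j + k < T + 2 - L" for j k
    using that
  proof (induction k arbitrary: j)
    case 0
    have "(\<Sum>s<L. \<omega> (L - 1 - s) \<bullet> u (s + j)) = (\<Sum>i<L. \<eta> i \<bullet> u (i + j))"
      by (intro sum.cong refl) (auto simp: \<omega>_def)
    then show ?case using zero[of j] 0 x by simp
  next
    case (Suc k)
    have Ak: "A ^\<^sub>m k \<in> carrier_mat n n" by simp
    have "0 = \<xi> \<bullet> (A ^\<^sub>m k *\<^sub>v x (Suc j)) + (\<Sum>s<L + k. \<omega> (L + k - 1 - s) \<bullet> u (s + Suc j))"
      using Suc.IH[of "Suc j"] Suc.prems by simp
    also have "\<xi> \<bullet> (A ^\<^sub>m k *\<^sub>v x (Suc j)) = \<xi> \<bullet> (A ^\<^sub>m Suc k *\<^sub>v x j) + \<omega> (L + k) \<bullet> u j"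
      unfolding trajectory_state[OF tr] \<omega>_ge[OF u] using x[of j] u[of j] \<xi>
      by (simp add: mult_add_distrib_mat_vec[OF Ak] scalar_prod_add_distrib[of _ n] assoc_mult_mat_vec[OF Ak A])
    moreover have "\<omega> (L + k) \<bullet> u j + (\<Sum>s<L + k. \<omega> (L + k - 1 - s) \<bullet> u (s + Suc j))
        = (\<Sum>s<L + Suc k. \<omega> (L + Suc k - 1 - s) \<bullet> u (s + j))"
      by (simp add: sum.lessThan_Suc_shift del: sum.lessThan_Suc)
    ultimately show ?case by linarith
  qed
  obtain k0 \<alpha> where k0: "k0 \<le> n" and \<alpha>: "\<And>t v. v \<in> carrier_vec n \<Longrightarrow>
      v \<bullet> ((A\<^sup>T) ^\<^sub>m (k0 + t) *\<^sub>v \<xi>) = (\<Sum>i<k0. \<alpha> i * (v \<bullet> ((A\<^sup>T) ^\<^sub>m (i + t) *\<^sub>v \<xi>)))"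
    using annihilating_polynomial[OF At \<xi>] by metis
  have rel: "\<xi> \<bullet> (A ^\<^sub>m (k0 + t) *\<^sub>v v) = (\<Sum>i<k0. \<alpha> i * (\<xi> \<bullet> (A ^\<^sub>m (i + t) *\<^sub>v v)))"
    if v: "v \<in> carrier_vec n" for t v
    using \<alpha>[OF v, of t] by (simp only: comm_scalar_prod[OF v Atk] transpose_pow_scalar_prod[OF A \<xi> v])
  \<comment> \<open>The monic relation becomes one vanishing combination over
    \<open>k \<le> k0\<close> with leading coefficient \<open>- 1\<close>.\<close>
  define \<beta> where "\<beta> k = (if k < k0 then \<alpha> k else - 1)" for k
  \<comment> \<open>The relations \<open>push\<close> are combined with weights
    \<open>\<beta> k\<close>, which cancels the state terms; the relation for \<open>k\<close>
    involves only the first \<open>L + k\<close> inputs.\<close>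
  define \<theta> where "\<theta> s = vec m (\<lambda>q. \<Sum>k\<le>k0. if s < L + k then \<beta> k * \<omega> (L + k - 1 - s) $ q else 0)" for s
  have \<theta>: "\<theta> \<in> signals m" by (intro signalsI) (simp add: \<theta>_def)
  have \<theta>_scalar: "\<theta> s \<bullet> w = (\<Sum>k\<le>k0. if s < L + k then \<beta> k * (\<omega> (L + k - 1 - s) \<bullet> w) else 0)"
    if w: "w \<in> carrier_vec m" for s w
  proof -
    have "\<theta> s \<bullet> w = (\<Sum>q<m. \<Sum>k\<le>k0. (if s < L + k then \<beta> k * (\<omega> (L + k - 1 - s) $ q) else 0) * w $ q)"
      using w by (simp add: scalar_prod_def \<theta>_def lessThan_atLeast0 sum_distrib_right)
    also have "\<dots> = (\<Sum>k\<le>k0. \<Sum>q<m. (if s < L + k then \<beta> k * (\<omega> (L + k - 1 - s) $ q) else 0) * w $ q)"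
      by (rule sum.swap)
    also have "\<dots> = (\<Sum>k\<le>k0. if s < L + k then \<beta> k * (\<omega> (L + k - 1 - s) \<bullet> w) else 0)"
      using w by (intro sum.cong) (auto simp: scalar_prod_def lessThan_atLeast0 sum_distrib_left mult.assoc)
    finally show ?thesis .
  qed
  have \<theta>0: "\<theta> s = 0\<^sub>v m" if "s < L + n" for s
  proof (rule persistently_exciting_annihilator[OF pe _ \<theta> _ that])
    show "u \<in> signals m" using tr by auto
    fix j assume j: "j < T + 2 - (L + n)"
    have "(\<Sum>s<L + n. \<theta> s \<bullet> u (s + j))
        = (\<Sum>k\<le>k0. \<Sum>s<L + n. if s < L + k then \<beta> k * (\<omega> (L + k - 1 - s) \<bullet> u (s + j)) else 0)"
      unfolding \<theta>_scalar[OF u] by (rule sum.swap)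
    also have "\<dots> = (\<Sum>k\<le>k0. \<beta> k * (\<Sum>s<L + k. \<omega> (L + k - 1 - s) \<bullet> u (s + j)))"
    proof (rule sum.cong[OF refl])
      fix k assume k: "k \<in> {..k0}"
      have "(\<Sum>s<L + n. if s < L + k then \<beta> k * (\<omega> (L + k - 1 - s) \<bullet> u (s + j)) else 0)
          = (\<Sum>s<L + k. if s < L + k then \<beta> k * (\<omega> (L + k - 1 - s) \<bullet> u (s + j)) else 0)"
        using k k0 by (intro sum.mono_neutral_right) auto
      then show "(\<Sum>s<L + n. if s < L + k then \<beta> k * (\<omega> (L + k - 1 - s) \<bullet> u (s + j)) else 0)
          = \<beta> k * (\<Sum>s<L + k. \<omega> (L + k - 1 - s) \<bullet> u (s + j))"
        by (simp add: sum_distrib_left)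
    qed
    also have "\<dots> = (\<Sum>k\<le>k0. - (\<beta> k * (\<xi> \<bullet> (A ^\<^sub>m k *\<^sub>v x j))))"
    proof (rule sum.cong[OF refl])
      fix k assume "k \<in> {..k0}"
      \<comment> \<open>Excitation of order \<open>L + n\<close> rather than \<open>L\<close> leaves
        room to push by up to \<open>k0 \<le> n\<close> steps.\<close>
      then have "j + k < T + 2 - L" using j k0 by auto
      from push[OF this]
      have "(\<Sum>s<L + k. \<omega> (L + k - 1 - s) \<bullet> u (s + j)) = - (\<xi> \<bullet> (A ^\<^sub>m k *\<^sub>v x j))" by linarith
      then show "\<beta> k * (\<Sum>s<L + k. \<omega> (L + k - 1 - s) \<bullet> u (s + j)) = - (\<beta> k * (\<xi> \<bullet> (A ^\<^sub>m k *\<^sub>v x j)))"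
        by simp
    qed
    also have "\<dots> = - (\<Sum>k<Suc k0. \<beta> k * (\<xi> \<bullet> (A ^\<^sub>m k *\<^sub>v x j)))"
      by (simp add: sum_negf lessThan_Suc_atMost)
    also have "\<dots> = 0"
      using rel[OF x[of j], of 0] by (simp add: \<beta>_def)
    finally show "(\<Sum>s<L + n. \<theta> s \<bullet> u (s + j)) = 0" .
  qed
  \<comment> \<open>At \<open>s = L + k0 - 1 - i\<close> the term \<open>k = k0\<close> of
    \<open>\<theta> s\<close> is \<open>- \<omega> i\<close>, and the terms \<open>k < k0\<close>
    contain \<open>\<omega>\<close> only at indices below \<open>i\<close>.\<close>
  have \<omega>0: "\<omega> i = 0\<^sub>v m" if "i < L + k0" for i
    using that
  proof (induction i rule: less_induct)
    case (less i)
    define s where "s = L + k0 - 1 - i"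
    have s: "s < L + k0" "L + k0 - 1 - s = i" using less.prems by (auto simp: s_def)
    show ?case
    proof (intro eq_vecI)
      fix q assume "q < dim_vec (0\<^sub>v m :: real vec)"
      then have q: "q < m" by simp
      have "\<theta> s $ q = 0" using \<theta>0[of s] s k0 q by simp
      then have "0 = (\<Sum>k<Suc k0. if s < L + k then \<beta> k * \<omega> (L + k - 1 - s) $ q else 0)"
        using q by (simp add: \<theta>_def lessThan_Suc_atMost)
      also have "\<dots> = (\<Sum>k<k0. if s < L + k then \<beta> k * \<omega> (L + k - 1 - s) $ q else 0) - \<omega> i $ q"
        using s by (simp add: \<beta>_def)
      also have "(\<Sum>k<k0. if s < L + k then \<beta> k * \<omega> (L + k - 1 - s) $ q else 0) = 0"
      proof (rule sum.neutral, rule ballI)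
        fix k assume k: "k \<in> {..<k0}"
        have "\<omega> (L + k - 1 - s) $ q = 0" if "s < L + k"
        proof -
          have "L + k - 1 - s < i" "L + k - 1 - s < L + k0"
            using that k less.prems s by (auto simp: s_def)
          then show ?thesis using less.IH q by simp
        qed
        then show "(if s < L + k then \<beta> k * \<omega> (L + k - 1 - s) $ q else 0) = 0" by simp
      qed
      finally show "\<omega> i $ q = 0\<^sub>v m $ q" using q by simp
    qed (use \<omega>[of i] in simp)
  qed
  show "\<eta> i = 0\<^sub>v m" if "i < L"
    using \<omega>0[of "L - 1 - i"] that by (simp add: \<omega>_def)
  \<comment> \<open>The zeros of \<open>\<omega>\<close> cover the powers \<open>k < k0\<close>; the
    recursion of order \<open>k0\<close> gives the others.\<close>
  have "\<xi> \<bullet> (A ^\<^sub>m k *\<^sub>v (B *\<^sub>v w)) = 0" if w: "w \<in> carrier_vec m" for k w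
  proof (induction k rule: less_induct)
    case (less k)
    show ?case
    proof (cases "k < k0")
      case True
      then show ?thesis using \<omega>_ge[OF w, of k] \<omega>0[of "L + k"] w by simp
    next
      case False
      then have "\<xi> \<bullet> (A ^\<^sub>m k *\<^sub>v (B *\<^sub>v w)) = (\<Sum>i<k0. \<alpha> i * (\<xi> \<bullet> (A ^\<^sub>m (i + (k - k0)) *\<^sub>v (B *\<^sub>v w))))"
        using rel[of "B *\<^sub>v w" "k - k0"] w by simp
      also have "\<dots> = 0" using False less.IH by (intro sum.neutral) auto
      finally show ?thesis .
    qed
  qed
  then show "\<xi> = 0\<^sub>v n" using reach \<xi> unfolding reachable_def by blast
qed

section \<open>Superpositions of shifted data\<close>

text \<open>This is block row \<open>t\<close> of a Hankel matrix with \<open>J\<close> columns.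
  Multiplication by \<open>g\<close> superposes \<open>J\<close> time shifts of \<open>f\<close>,
  and since \<open>t\<close> is unbounded the result is a signal on all times.\<close>

definition window :: "nat \<Rightarrow> nat \<Rightarrow> signal \<Rightarrow> nat \<Rightarrow> real mat" where
  "window q J f t = mat q J (\<lambda>(i, j). f (t + j) $ i)"

lemma window_carrier [simp]: "window q J f t \<in> carrier_mat q J"
  by (simp add: window_def)

lemma window_dims [simp]: "dim_row (window q J f t) = q" "dim_col (window q J f t) = J"
  by (simp_all add: window_def)

lemma col_window:
  assumes "f \<in> signals q" "j < J"
  shows "col (window q J f t) j = f (t + j)"
proof -
  have "dim_vec (f (t + j)) = q" using assms(1) by (intro carrier_vecD signals_carrier)
  then show ?thesis using assms(2) by (intro eq_vecI) (auto simp: window_def)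
qed

lemma hankel_mult_vec:
  assumes "g \<in> carrier_vec (T + 2 - L)"
  shows "hankel q T L f *\<^sub>v g = stack q L (\<lambda>t. window q (T + 2 - L) f t *\<^sub>v g)"
proof (intro eq_vecI)
  fix i assume "i < dim_vec (stack q L (\<lambda>t. window q (T + 2 - L) f t *\<^sub>v g))"
  then have i: "i < L * q" by simp
  have "row (hankel q T L f) i = row (window q (T + 2 - L) f (i div q)) (i mod q)"
    using i div_mod_less[OF i] by (intro eq_vecI) (auto simp: hankel_def window_def)
  then show "(hankel q T L f *\<^sub>v g) $ i = stack q L (\<lambda>t. window q (T + 2 - L) f t *\<^sub>v g) $ i"
    using i div_mod_less[OF i] carrier_matD[OF hankel_carrier[of q T L f]] by (simp add: stack_index)
qed (simp add: carrier_matD[OF hankel_carrier])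

text \<open>Linearity and time invariance: only shifts of the one trajectory are superposed.\<close>

lemma window_trajectory:
  assumes tr: "trajectory x u y" and g: "g \<in> carrier_vec J"
  shows "trajectory (\<lambda>t. window n J x t *\<^sub>v g) (\<lambda>t. window m J u t *\<^sub>v g) (\<lambda>t. window p J y t *\<^sub>v g)"
proof -
  have sig: "x \<in> signals n" "u \<in> signals m" "y \<in> signals p" using tr by auto
  have c: "x t \<in> carrier_vec n" "u t \<in> carrier_vec m" "y t \<in> carrier_vec p" for t using sig by auto
  have lin: "window q J f t' *\<^sub>v g = F *\<^sub>v (window n J x t *\<^sub>v g) + G *\<^sub>v (window m J u t *\<^sub>v g)"
    if F: "F \<in> carrier_mat q n" and G: "G \<in> carrier_mat q m"
      and f: "\<And>j. f (t' + j) = F *\<^sub>v x (t + j) + G *\<^sub>v u (t + j)" for q f F G t t'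
  proof -
    have FX: "F * window n J x t \<in> carrier_mat q J" and GU: "G * window m J u t \<in> carrier_mat q J"
      using F G by (auto intro!: mult_carrier_mat)
    have "window q J f t' = F * window n J x t + G * window m J u t"
    proof (rule eq_matI)
      fix i j assume "i < dim_row (F * window n J x t + G * window m J u t)"
        "j < dim_col (F * window n J x t + G * window m J u t)"
      then have ij: "i < q" "j < J" using F G by auto
      then show "window q J f t' $$ (i,j) = (F * window n J x t + G * window m J u t) $$ (i,j)"
        using F G c f[of j] by (simp add: col_window[OF sig(1)] col_window[OF sig(2)]) (simp add: window_def)
    qed (use F G in auto)
    then show ?thesis
      using add_mult_distrib_mat_vec[OF FX GU g] assoc_mult_mat_vec[OF F _ g] assoc_mult_mat_vec[OF G _ g]
      by simp
  qed
  have "window n J x (Suc t) *\<^sub>v g = A *\<^sub>v (window n J x t *\<^sub>v g) + B *\<^sub>v (window m J u t *\<^sub>v g)" for t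
    by (rule lin[OF A B]) (simp add: trajectory_state[OF tr])
  moreover have "window p J y t *\<^sub>v g = C *\<^sub>v (window n J x t *\<^sub>v g) + D *\<^sub>v (window m J u t *\<^sub>v g)" for t
    by (rule lin[OF C D]) (simp add: trajectory_output[OF tr])
  moreover have "(\<lambda>t. window q J f t *\<^sub>v g) \<in> signals q" for q f
    by (intro signalsI mult_mat_vec_carrier[OF window_carrier g])
  ultimately show ?thesis unfolding state_trajectory_def Suc_eq_plus1[symmetric] by blast
qed

text \<open>The matrix \<open>W\<close> of states on top of input windows has trivial left kernel by
  \<open>data_left_kernel_trivial\<close>, hence a right inverse; \<open>g\<close> is its value at
  the prescribed initial state and inputs.\<close>

lemma data_generates:
  assumes tr: "trajectory x u y" and reach: reachable
    and pe: "persistently_exciting m T (L + n) u"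
    and x0: "x0 \<in> carrier_vec n" and v: "v \<in> signals m"
  obtains g where "g \<in> carrier_vec (T + 2 - L)" "window n (T + 2 - L) x 0 *\<^sub>v g = x0"
    "\<And>t. t < L \<Longrightarrow> window m (T + 2 - L) u t *\<^sub>v g = v t"
proof -
  define J where "J = T + 2 - L"
  have sig: "x \<in> signals n" "u \<in> signals m" using tr by auto
  have dx: "dim_vec (x j) = n" for j using sig by (intro carrier_vecD signals_carrier)
  define W where "W = mat_of_cols (n + L * m) (map (\<lambda>j. x j @\<^sub>v stack m L (\<lambda>s. u (s + j))) [0..<J])"
  have W: "W \<in> carrier_mat (n + L * m) J" by (simp add: W_def carrier_matI)
  have colW: "col W j = x j @\<^sub>v stack m L (\<lambda>s. u (s + j))" if "j < J" for j
    using that sig unfolding W_def by (subst col_mat_of_cols) (auto intro!: append_carrier_vec)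
  have ker: "z = 0\<^sub>v (n + L * m)" if z: "z \<in> carrier_vec (n + L * m)" "W\<^sup>T *\<^sub>v z = 0\<^sub>v J" for z
  proof -
    define \<xi> where "\<xi> = vec_first z n"
    have \<xi>: "\<xi> \<in> carrier_vec n" by (simp add: \<xi>_def)
    obtain \<eta> where \<eta>: "\<eta> \<in> signals m" "vec_last z (L * m) = stack m L \<eta>"
      using stack_surj[of "vec_last z (L * m)" L m] by auto
    have zz: "z = \<xi> @\<^sub>v stack m L \<eta>" using vec_first_last_append[OF z(1)] \<eta> by (simp add: \<xi>_def)
    have "\<xi> \<bullet> x j + (\<Sum>i<L. \<eta> i \<bullet> u (i + j)) = 0" if "j < T + 2 - L" for j
    proof -
      have j: "j < J" using that by (simp add: J_def)
      have "0 = (W\<^sup>T *\<^sub>v z) $ j" unfolding z(2) using j by simp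
      also have "\<dots> = col W j \<bullet> z" using j W by simp
      also have "\<dots> = z \<bullet> col W j"
        using col_dim[of W j] carrier_matD(1)[OF W] z(1) by (intro comm_scalar_prod[of _ "n + L * m"]) auto
      also have "\<dots> = \<xi> \<bullet> x j + stack m L \<eta> \<bullet> stack m L (\<lambda>s. u (s + j))"
        unfolding colW[OF j] zz using \<xi> sig by (intro scalar_prod_append[of _ n _ "L * m"]) auto
      also have "stack m L \<eta> \<bullet> stack m L (\<lambda>s. u (s + j)) = (\<Sum>i<L. \<eta> i \<bullet> u (i + j))"
        using sig by (intro stack_scalar_prod) auto
      finally show ?thesis by simp
    qed
    from data_left_kernel_trivial[OF tr reach pe \<xi> \<eta>(1) this]
    have "\<xi> = 0\<^sub>v n" "stack m L \<eta> = stack m L (\<lambda>_. 0\<^sub>v m)"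
      using stack_eq_iff[of L \<eta> m "\<lambda>_. 0\<^sub>v m"] \<eta> by auto
    then show ?thesis unfolding zz stack_zero by (intro eq_vecI) auto
  qed
  obtain R where R: "R \<in> carrier_mat J (n + L * m)" "W * R = 1\<^sub>m (n + L * m)"
    using right_inverse_exists[OF W ker] by blast
  define b where "b = x0 @\<^sub>v stack m L v"
  define g where "g = R *\<^sub>v b"
  have b: "b \<in> carrier_vec (n + L * m)" using x0 by (simp add: b_def)
  have g: "g \<in> carrier_vec J" using R b by (simp add: g_def)
  have "W *\<^sub>v g = b" using R b assoc_mult_mat_vec[OF W R(1) b] by (simp add: g_def)
  moreover have "W *\<^sub>v g = window n J x 0 *\<^sub>v g @\<^sub>v hankel m T L u *\<^sub>v g"
  proof (intro eq_vecI)
    fix i assume "i < dim_vec (window n J x 0 *\<^sub>v g @\<^sub>v hankel m T L u *\<^sub>v g)"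
    then have i: "i < n + L * m" by (simp add: carrier_matD[OF hankel_carrier])
    have entry: "W $$ (i, j) = (x j @\<^sub>v stack m L (\<lambda>s. u (s + j))) $ i" if "j < J" for j
      using colW[OF that] that i W by (metis carrier_matD(1,2) index_col)
    have "(W *\<^sub>v g) $ i = (\<Sum>j<J. W $$ (i, j) * g $ j)"
      using i W g by (simp add: scalar_prod_def lessThan_atLeast0)
    also have "\<dots> = (window n J x 0 *\<^sub>v g @\<^sub>v hankel m T L u *\<^sub>v g) $ i"
    proof (cases "i < n")
      case True
      then have "(window n J x 0 *\<^sub>v g @\<^sub>v hankel m T L u *\<^sub>v g) $ i = (\<Sum>j<J. window n J x 0 $$ (i, j) * g $ j)"
        using g by (simp add: scalar_prod_def lessThan_atLeast0)
      also have "\<dots> = (\<Sum>j<J. W $$ (i, j) * g $ j)"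
        using True by (intro sum.cong) (auto simp: window_def entry dx)
      finally show ?thesis by simp
    next
      case False
      then have k: "i - n < L * m" using i by simp
      have "(window n J x 0 *\<^sub>v g @\<^sub>v hankel m T L u *\<^sub>v g) $ i = (\<Sum>j<J. hankel m T L u $$ (i - n, j) * g $ j)"
        using g False k carrier_matD[OF hankel_carrier[of m T L u]]
        by (simp add: scalar_prod_def lessThan_atLeast0 J_def)
      moreover have "hankel m T L u $$ (i - n, j) = W $$ (i, j)" if "j < J" for j
        using False k i that by (simp add: entry stack_index dx) (simp add: hankel_def J_def)
      ultimately have "(window n J x 0 *\<^sub>v g @\<^sub>v hankel m T L u *\<^sub>v g) $ i = (\<Sum>j<J. W $$ (i, j) * g $ j)"
        by simp
      then show ?thesis by simp
    qed
    finally show "(W *\<^sub>v g) $ i = (window n J x 0 *\<^sub>v g @\<^sub>v hankel m T L u *\<^sub>v g) $ i" .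
  qed (use W in \<open>simp add: carrier_matD[OF hankel_carrier]\<close>)
  ultimately have "window n J x 0 *\<^sub>v g = x0" and h: "hankel m T L u *\<^sub>v g = stack m L v"
    using append_vec_eq[OF mult_mat_vec_carrier[OF window_carrier g] x0] unfolding b_def by metis+
  moreover have "window m J u t *\<^sub>v g = v t" if "t < L" for t
    using h hankel_mult_vec[of g T L m u] g that v mult_mat_vec_carrier[OF window_carrier g]
      stack_eq_iff[of L "\<lambda>t. window m J u t *\<^sub>v g" m v] by (simp add: J_def)
  ultimately show thesis using that[of g] g by (simp add: J_def)
qed

text \<open>With \<open>L > 0\<close> the window \<open>{0..L - 1}\<close> has exactly
  \<open>L\<close> samples; for \<open>L = 0\<close> truncated subtraction would leave the sample at
  time 0.\<close>

lemma zero_output_inputs_iff: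
  assumes rep: "state_rep m p \<B> n A B C D" and L: "L > 0"
  shows "s \<in> zero_output_inputs m p \<B> L \<longleftrightarrow>
    (\<exists>x u y. trajectory x u y \<and> s = stack m L u \<and> (\<forall>t<L. y t = 0\<^sub>v p))"
proof
  assume "s \<in> zero_output_inputs m p \<B> L"
  then obtain v where s: "s = stack m L v" and v: "v \<in> signals m"
    and "restrict (\<lambda>t. v t @\<^sub>v 0\<^sub>v p) {0..L - 1} \<in> restr \<B> 0 (L - 1)"
    unfolding zero_output_inputs_def by blast
  then obtain w where w: "w \<in> \<B>" "restrict (\<lambda>t. v t @\<^sub>v 0\<^sub>v p) {0..L - 1} = restrict w {0..L - 1}"
    unfolding restr_def by auto
  obtain u y x where w2: "w = (\<lambda>t. u t @\<^sub>v y t)" and tr: "trajectory x u y"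
    using state_rep_cases[OF rep w(1)] by metis
  have uc: "u t \<in> carrier_vec m" for t using tr by auto
  have vu: "v t = u t \<and> y t = 0\<^sub>v p" if "t < L" for t
  proof -
    have "t \<in> {0..L - 1}" using that by auto
    then have "v t @\<^sub>v 0\<^sub>v p = u t @\<^sub>v y t"
      using fun_cong[OF w(2), of t] by (simp add: w2)
    then show ?thesis using append_vec_eq[OF signals_carrier[OF v] uc] by metis
  qed
  then have "s = stack m L u" unfolding s using v uc by (subst stack_eq_iff) auto
  with tr vu show "\<exists>x u y. trajectory x u y \<and> s = stack m L u \<and> (\<forall>t<L. y t = 0\<^sub>v p)" by blast
next
  assume "\<exists>x u y. trajectory x u y \<and> s = stack m L u \<and> (\<forall>t<L. y t = 0\<^sub>v p)"
  then obtain x u y where tr: "trajectory x u y" and s: "s = stack m L u" and y: "\<forall>t<L. y t = 0\<^sub>v p"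
    by blast
  then have "(\<lambda>t. u t @\<^sub>v y t) \<in> \<B>" using state_rep_iff[OF rep] by blast
  moreover have "restrict (\<lambda>t. u t @\<^sub>v 0\<^sub>v p) {0..L - 1} = restrict (\<lambda>t. u t @\<^sub>v y t) {0..L - 1}"
    using y L by (intro restrict_ext) auto
  ultimately have "restrict (\<lambda>t. u t @\<^sub>v 0\<^sub>v p) {0..L - 1} \<in> restr \<B> 0 (L - 1)"
    unfolding restr_def by auto
  then show "s \<in> zero_output_inputs m p \<B> L"
    unfolding zero_output_inputs_def s using tr by blast
qed

text \<open>Given a zero-output window, the data are superposed so as to match its initial state and
  its first \<open>L\<close> inputs; then the outputs match too, hence vanish. Conversely, each
  superposition of the data is itself a trajectory.\<close>

lemma zero_output_inputs_eq_data:
  assumes rep: "state_rep m p \<B> n A B C D" and tr: "trajectory x u y" and reach: reachable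
    and pe: "persistently_exciting m T (L + n) u" and L: "L > 0"
  shows "zero_output_inputs m p \<B> L = zero_output_data m p T L u y"
proof (intro equalityI subsetI)
  fix s assume "s \<in> zero_output_inputs m p \<B> L"
  then obtain x2 u2 y2 where tr2: "trajectory x2 u2 y2" and s: "s = stack m L u2"
    and y2: "\<And>t. t < L \<Longrightarrow> y2 t = 0\<^sub>v p"
    using zero_output_inputs_iff[OF rep L] by blast
  have v: "u2 \<in> signals m" "x2 0 \<in> carrier_vec n" using tr2 by auto
  obtain g where g: "g \<in> carrier_vec (T + 2 - L)" "window n (T + 2 - L) x 0 *\<^sub>v g = x2 0"
    "\<And>t. t < L \<Longrightarrow> window m (T + 2 - L) u t *\<^sub>v g = u2 t"
    using data_generates[OF tr reach pe v(2) v(1)] by blast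
  have "window p (T + 2 - L) y t *\<^sub>v g = 0\<^sub>v p" if "t < L" for t
    using trajectory_agree(2)[OF window_trajectory[OF tr g(1)] tr2 g(2) _ that] g(3) y2 that by simp
  then have "hankel p T L y *\<^sub>v g = 0\<^sub>v (L * p)"
    unfolding hankel_mult_vec[OF g(1)] stack_zero[symmetric]
    using mult_mat_vec_carrier[OF window_carrier g(1)] by (subst stack_eq_iff) auto
  moreover have "hankel m T L u *\<^sub>v g = s"
    unfolding hankel_mult_vec[OF g(1)] s
    using g v mult_mat_vec_carrier[OF window_carrier g(1)] by (subst stack_eq_iff) auto
  ultimately show "s \<in> zero_output_data m p T L u y"
    using g(1) unfolding zero_output_data_def by blast
next
  fix s assume "s \<in> zero_output_data m p T L u y"
  then obtain g where g: "g \<in> carrier_vec (T + 2 - L)" and s: "s = hankel m T L u *\<^sub>v g"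
    and "hankel p T L y *\<^sub>v g = 0\<^sub>v (L * p)"
    unfolding zero_output_data_def by blast
  then have "stack p L (\<lambda>t. window p (T + 2 - L) y t *\<^sub>v g) = stack p L (\<lambda>_. 0\<^sub>v p)"
    by (simp add: stack_zero hankel_mult_vec[OF g])
  then have y0: "window p (T + 2 - L) y t *\<^sub>v g = 0\<^sub>v p" if "t < L" for t
    using that mult_mat_vec_carrier[OF window_carrier g]
      stack_eq_iff[of L "\<lambda>t. window p (T + 2 - L) y t *\<^sub>v g" p "\<lambda>_. 0\<^sub>v p"] by auto
  let ?u = "\<lambda>t. window m (T + 2 - L) u t *\<^sub>v g" and ?y = "\<lambda>t. window p (T + 2 - L) y t *\<^sub>v g"
  have tr': "trajectory (\<lambda>t. window n (T + 2 - L) x t *\<^sub>v g) ?u ?y"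
    by (rule window_trajectory[OF tr g])
  with y0 show "s \<in> zero_output_inputs m p \<B> L"
    unfolding zero_output_inputs_iff[OF rep L] s hankel_mult_vec[OF g] by blast
qed

end

section \<open>The zero dynamics as a feedback system\<close>

lemma obs_mat_carrier [simp]: "obs_mat n p A C L \<in> carrier_mat (L * p) n"
  by (simp add: obs_mat_def)

lemma row_mult_pow:
  fixes A C :: "real mat"
  assumes A: "A \<in> carrier_mat n n" and C: "C \<in> carrier_mat p n" and v: "v \<in> carrier_vec n" and j: "j < p"
  shows "row (C * A ^\<^sub>m k) j \<bullet> v = (C *\<^sub>v (A ^\<^sub>m k *\<^sub>v v)) $ j"
proof -
  have Ak: "A ^\<^sub>m k \<in> carrier_mat n n" using A by simp
  have "(C *\<^sub>v (A ^\<^sub>m k *\<^sub>v v)) $ j = (C * A ^\<^sub>m k *\<^sub>v v) $ j"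
    using assoc_mult_mat_vec[OF C Ak v] by simp
  also have "\<dots> = row (C * A ^\<^sub>m k) j \<bullet> v" using C j by (intro index_mult_mat_vec) simp
  finally show ?thesis by simp
qed

lemma obs_mat_mult_vec:
  assumes A: "A \<in> carrier_mat n n" and C: "C \<in> carrier_mat p n" and v: "v \<in> carrier_vec n"
  shows "obs_mat n p A C L *\<^sub>v v = stack p L (\<lambda>t. C *\<^sub>v (A ^\<^sub>m t *\<^sub>v v))"
proof (intro eq_vecI)
  fix i assume "i < dim_vec (stack p L (\<lambda>t. C *\<^sub>v (A ^\<^sub>m t *\<^sub>v v)))"
  then have i: "i < L * p" by simp
  have "row (obs_mat n p A C L) i = row (C * A ^\<^sub>m (i div p)) (i mod p)"
  proof (rule eq_vecI)
    fix c assume "c < dim_vec (row (C * A ^\<^sub>m (i div p)) (i mod p))"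
    then have c: "c < n" using A by (simp split: if_splits)
    show "row (obs_mat n p A C L) i $ c = row (C * A ^\<^sub>m (i div p)) (i mod p) $ c"
      using c i div_mod_less[OF i] A C by (simp add: obs_mat_def del: index_mult_mat(1))
  qed (use A in \<open>simp add: obs_mat_def\<close>)
  then show "(obs_mat n p A C L *\<^sub>v v) $ i = stack p L (\<lambda>t. C *\<^sub>v (A ^\<^sub>m t *\<^sub>v v)) $ i"
    using i carrier_matD[OF obs_mat_carrier[of n p A C L]] row_mult_pow[OF A C v div_mod_less(2)[OF i]]
    by (simp add: stack_index)
qed (simp add: carrier_matD[OF obs_mat_carrier])

lemma proj_blocks_stack:
  assumes "k \<le> L"
  shows "vec_first (stack m L u) (k * m) = stack m k u"
proof -
  have "i < L * m" if "i < k * m" for i using that assms by (meson less_le_trans mult_le_mono1)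
  then show ?thesis by (intro eq_vecI) (auto simp: vec_first_def stack_def)
qed

lemma (in linear_system) pow_step:
  assumes v: "v \<in> carrier_vec n" and w: "w \<in> carrier_vec m" and j: "j < p"
  shows "(C *\<^sub>v (A ^\<^sub>m k *\<^sub>v (A *\<^sub>v v + B *\<^sub>v w))) $ j
    = (C *\<^sub>v (A ^\<^sub>m Suc k *\<^sub>v v)) $ j + (C *\<^sub>v (A ^\<^sub>m k *\<^sub>v (B *\<^sub>v w))) $ j"
proof -
  have Ak: "A ^\<^sub>m k \<in> carrier_mat n n" by simp
  have "A ^\<^sub>m k *\<^sub>v (A *\<^sub>v v + B *\<^sub>v w) = A ^\<^sub>m Suc k *\<^sub>v v + A ^\<^sub>m k *\<^sub>v (B *\<^sub>v w)"
    using mult_add_distrib_mat_vec[OF Ak, of "A *\<^sub>v v" "B *\<^sub>v w"] assoc_mult_mat_vec[OF Ak A v] v w by simp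
  moreover have "C *\<^sub>v (A ^\<^sub>m Suc k *\<^sub>v v + A ^\<^sub>m k *\<^sub>v (B *\<^sub>v w))
      = C *\<^sub>v (A ^\<^sub>m Suc k *\<^sub>v v) + C *\<^sub>v (A ^\<^sub>m k *\<^sub>v (B *\<^sub>v w))"
    using v w by (intro mult_add_distrib_mat_vec[OF C]) (auto simp del: pow_mat.simps)
  ultimately show ?thesis using j by (simp del: index_mult_mat_vec pow_mat.simps)
qed

text \<open>The relative degree conditions are phrased through their action on vectors in one fixed
  representation, with full rank of the decoupling matrix as a trivial kernel.\<close>

locale square_system = linear_system n m m A B C D for n m :: nat and A B C D :: "real mat" +
  fixes r :: "nat \<Rightarrow> nat"
  assumes markov_zero: "\<lbrakk>j < m; k + 2 \<le> r j; w \<in> carrier_vec m\<rbrakk> \<Longrightarrow> (C *\<^sub>v (A ^\<^sub>m k *\<^sub>v (B *\<^sub>v w))) $ j = 0"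
    and direct_zero: "\<lbrakk>j < m; r j > 0; w \<in> carrier_vec m\<rbrakk> \<Longrightarrow> (D *\<^sub>v w) $ j = 0"
    and decoupling_inj: "\<lbrakk>w \<in> carrier_vec m; decoupling_mat m m A B C D r *\<^sub>v w = 0\<^sub>v m\<rbrakk> \<Longrightarrow> w = 0\<^sub>v m"
begin

definition G :: "real mat" where "G = decoupling_mat m m A B C D r"

definition H :: "real mat" where "H = mat\<^sub>r m n (\<lambda>j. row (C * A ^\<^sub>m r j) j)"

lemma G_carrier [simp]: "G \<in> carrier_mat m m"
  by (simp add: G_def decoupling_mat_def)

lemma H_carrier [simp]: "H \<in> carrier_mat m n"
  by (simp add: H_def)

lemma GH_dims [simp]: "dim_row G = m" "dim_col G = m" "dim_row H = m" "dim_col H = n"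
  using carrier_matD[OF G_carrier] carrier_matD[OF H_carrier] by auto

lemma H_index:
  assumes v: "v \<in> carrier_vec n" and j: "j < m"
  shows "(H *\<^sub>v v) $ j = (C *\<^sub>v (A ^\<^sub>m r j *\<^sub>v v)) $ j"
proof -
  have "row H j = row (C * A ^\<^sub>m r j) j" unfolding H_def by (rule row_mat_of_row_fun) (use j in \<open>auto intro: carrier_vecI\<close>)
  then show ?thesis using row_mult_pow[OF A C v j] j carrier_matD[OF H_carrier] by simp
qed

lemma G_index:
  assumes w: "w \<in> carrier_vec m" and j: "j < m"
  shows "(G *\<^sub>v w) $ j = (if r j = 0 then (D *\<^sub>v w) $ j else (C *\<^sub>v (A ^\<^sub>m (r j - 1) *\<^sub>v (B *\<^sub>v w))) $ j)"
proof -
  have CA: "C * A ^\<^sub>m k \<in> carrier_mat m n" for k by (rule mult_carrier_mat[of _ m n]) simp_all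
  have "row G j = (if r j = 0 then row D j else row (C * A ^\<^sub>m (r j - 1) * B) j)"
    unfolding G_def decoupling_mat_def by (rule row_mat_of_row_fun) (use j in \<open>auto intro: carrier_vecI\<close>)
  moreover have "row (C * A ^\<^sub>m k * B) j \<bullet> w = (C *\<^sub>v (A ^\<^sub>m k *\<^sub>v (B *\<^sub>v w))) $ j" for k
  proof -
    have "row (C * A ^\<^sub>m k * B) j \<bullet> w = (C * A ^\<^sub>m k * B *\<^sub>v w) $ j"
      using j by (intro index_mult_mat_vec[symmetric]) simp
    also have "\<dots> = (C * A ^\<^sub>m k *\<^sub>v (B *\<^sub>v w)) $ j" unfolding assoc_mult_mat_vec[OF CA B w] ..
    also have "\<dots> = (C *\<^sub>v (A ^\<^sub>m k *\<^sub>v (B *\<^sub>v w))) $ j"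
      using assoc_mult_mat_vec[OF C, of "A ^\<^sub>m k" n "B *\<^sub>v w"] w by simp
    finally show ?thesis .
  qed
  ultimately show ?thesis using j carrier_matD[OF G_carrier] by simp
qed

lemma feedback_exists:
  "\<exists>F\<in>carrier_mat m n. \<forall>v\<in>carrier_vec n. \<forall>w\<in>carrier_vec m. H *\<^sub>v v + G *\<^sub>v w = 0\<^sub>v m \<longleftrightarrow> w = F *\<^sub>v v"
proof -
  obtain K where K: "K \<in> carrier_mat m m" "G * K = 1\<^sub>m m" "K * G = 1\<^sub>m m"
    using square_trivial_kernel_inverse[OF G_carrier] decoupling_inj unfolding G_def by blast
  let ?F = "- (K * H)"
  have KH: "K * H \<in> carrier_mat m n" using K by (intro mult_carrier_mat[of _ m m]) auto
  have "H *\<^sub>v v + G *\<^sub>v w = 0\<^sub>v m \<longleftrightarrow> w = ?F *\<^sub>v v" if v: "v \<in> carrier_vec n" and w: "w \<in> carrier_vec m" for v w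
  proof -
    have Hv: "H *\<^sub>v v \<in> carrier_vec m" and Gw: "G *\<^sub>v w \<in> carrier_vec m"
      using v w by (auto intro: mult_mat_vec_carrier[OF H_carrier] mult_mat_vec_carrier[OF G_carrier])
    have Fv: "?F *\<^sub>v v = - (K *\<^sub>v (H *\<^sub>v v))"
      unfolding assoc_mult_mat_vec[OF K(1) H_carrier v, symmetric]
      by (rule uminus_mult_mat_vec) (use v in simp)
    have KHv: "K *\<^sub>v (H *\<^sub>v v) \<in> carrier_vec m" using K Hv by simp
    show ?thesis
    proof
      assume "H *\<^sub>v v + G *\<^sub>v w = 0\<^sub>v m"
      then have "K *\<^sub>v (H *\<^sub>v v + G *\<^sub>v w) = 0\<^sub>v m" using K by simp
      moreover have "K *\<^sub>v (H *\<^sub>v v + G *\<^sub>v w) = K *\<^sub>v (H *\<^sub>v v) + w"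
        using mult_add_distrib_mat_vec[OF K(1) Hv Gw] assoc_mult_mat_vec[OF K(1) G_carrier w] K w by simp
      ultimately have eq: "K *\<^sub>v (H *\<^sub>v v) + w = 0\<^sub>v m" by simp
      show "w = ?F *\<^sub>v v"
        unfolding Fv
      proof (rule eq_vecI)
        fix i assume "i < dim_vec (- (K *\<^sub>v (H *\<^sub>v v)))"
        then have i: "i < m" using K by simp
        have "(K *\<^sub>v (H *\<^sub>v v)) $ i + w $ i = 0"
          using arg_cong[OF eq, of "\<lambda>z. z $ i"] i w by (simp del: index_mult_mat_vec)
        moreover have "(- (K *\<^sub>v (H *\<^sub>v v))) $ i = - (K *\<^sub>v (H *\<^sub>v v)) $ i"
          using i K by (intro index_uminus_vec) simp
        ultimately show "w $ i = (- (K *\<^sub>v (H *\<^sub>v v))) $ i" by linarith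
      qed (use w K in simp)
    next
      assume "w = ?F *\<^sub>v v"
      moreover have "G *\<^sub>v (- z) = - (G *\<^sub>v z)" if "z \<in> carrier_vec m" for z
        by (rule eq_vecI) (use that in auto)
      ultimately have "G *\<^sub>v w = - (G *\<^sub>v (K *\<^sub>v (H *\<^sub>v v)))"
        unfolding Fv using KHv by simp
      also have "G *\<^sub>v (K *\<^sub>v (H *\<^sub>v v)) = H *\<^sub>v v"
        using assoc_mult_mat_vec[OF G_carrier K(1) Hv] K Hv by simp
      finally show "H *\<^sub>v v + G *\<^sub>v w = 0\<^sub>v m" using Hv by simp
    qed
  qed
  then show ?thesis using KH by (intro bexI[of _ ?F]) auto
qed

definition F :: "real mat" where
  "F = (SOME F. F \<in> carrier_mat m n \<and>
     (\<forall>v\<in>carrier_vec n. \<forall>w\<in>carrier_vec m. H *\<^sub>v v + G *\<^sub>v w = 0\<^sub>v m \<longleftrightarrow> w = F *\<^sub>v v))"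

lemma F_carrier [simp]: "F \<in> carrier_mat m n"
  and F_iff: "v \<in> carrier_vec n \<Longrightarrow> w \<in> carrier_vec m \<Longrightarrow> H *\<^sub>v v + G *\<^sub>v w = 0\<^sub>v m \<longleftrightarrow> w = F *\<^sub>v v"
proof -
  have "F \<in> carrier_mat m n \<and>
     (\<forall>v\<in>carrier_vec n. \<forall>w\<in>carrier_vec m. H *\<^sub>v v + G *\<^sub>v w = 0\<^sub>v m \<longleftrightarrow> w = F *\<^sub>v v)"
    unfolding F_def by (rule someI_ex[OF feedback_exists[unfolded Bex_def]])
  then show "F \<in> carrier_mat m n"
    "v \<in> carrier_vec n \<Longrightarrow> w \<in> carrier_vec m \<Longrightarrow> H *\<^sub>v v + G *\<^sub>v w = 0\<^sub>v m \<longleftrightarrow> w = F *\<^sub>v v"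
    by blast+
qed

definition AF :: "real mat" where "AF = A + B * F"

lemma AF_carrier [simp]: "AF \<in> carrier_mat n n"
  unfolding AF_def by (intro add_carrier_mat mult_carrier_mat[OF B F_carrier])

lemma F_mult_carrier [simp]: "v \<in> carrier_vec n \<Longrightarrow> F *\<^sub>v v \<in> carrier_vec m"
  by (rule mult_mat_vec_carrier[OF F_carrier])

lemma AF_mult_carrier [simp]: "v \<in> carrier_vec n \<Longrightarrow> AF *\<^sub>v v \<in> carrier_vec n"
  by (rule mult_mat_vec_carrier[OF AF_carrier])

lemma AF_mult: "v \<in> carrier_vec n \<Longrightarrow> AF *\<^sub>v v = A *\<^sub>v v + B *\<^sub>v (F *\<^sub>v v)"
  unfolding AF_def
  by (simp add: add_mult_distrib_mat_vec[OF A mult_carrier_mat[OF B F_carrier]] assoc_mult_mat_vec[OF B F_carrier])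

definition V :: "real vec set" where
  "V = {v \<in> carrier_vec n. \<forall>j<m. \<forall>k<r j. (C *\<^sub>v (A ^\<^sub>m k *\<^sub>v v)) $ j = 0}"

lemma V_carrier [simp]: "v \<in> V \<Longrightarrow> v \<in> carrier_vec n"
  by (simp add: V_def)

lemma V_D: "v \<in> V \<Longrightarrow> j < m \<Longrightarrow> k < r j \<Longrightarrow> (C *\<^sub>v (A ^\<^sub>m k *\<^sub>v v)) $ j = 0"
  unfolding V_def by blast

text \<open>For fewer than \<open>r j\<close> steps the input could act on component
  \<open>j\<close> only through \<open>D\<close> and the products \<open>C A^k B\<close> with
  \<open>k + 2 \<le> r j\<close>, whose row \<open>j\<close> is zero; after \<open>r j\<close> steps
  it acts through row \<open>j\<close> of \<open>G\<close>.\<close>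

lemma output_advance:
  assumes tr: "trajectory x u y" and j: "j < m"
  shows "k < r j \<Longrightarrow> y (t + k) $ j = (C *\<^sub>v (A ^\<^sub>m k *\<^sub>v x t)) $ j"
    and "y (t + r j) $ j = (H *\<^sub>v x t) $ j + (G *\<^sub>v u t) $ j"
proof -
  have x: "x t \<in> carrier_vec n" and u: "u t \<in> carrier_vec m" for t using tr by auto
  have y: "y t $ j = (C *\<^sub>v x t) $ j + (D *\<^sub>v u t) $ j" for t
    unfolding trajectory_output[OF tr] using j by (simp del: index_mult_mat_vec)
  have *: "y (t + k) $ j = (C *\<^sub>v (A ^\<^sub>m k *\<^sub>v x t)) $ j" if "k < r j" for k t
    using that
  proof (induction k arbitrary: t)
    case 0
    then show ?case using y[of t] direct_zero[OF j _ u] x by simp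
  next
    case (Suc k)
    have "y (t + Suc k) $ j = (C *\<^sub>v (A ^\<^sub>m k *\<^sub>v x (Suc t))) $ j"
      using Suc.IH[of "Suc t"] Suc.prems by simp
    also have "\<dots> = (C *\<^sub>v (A ^\<^sub>m Suc k *\<^sub>v x t)) $ j"
      unfolding trajectory_state[OF tr] pow_step[OF x u j]
      using markov_zero[OF j _ u, of k] Suc.prems by simp
    finally show ?case .
  qed
  show "k < r j \<Longrightarrow> y (t + k) $ j = (C *\<^sub>v (A ^\<^sub>m k *\<^sub>v x t)) $ j" by (rule *)
  show "y (t + r j) $ j = (H *\<^sub>v x t) $ j + (G *\<^sub>v u t) $ j"
  proof (cases "r j")
    case 0
    then show ?thesis using y[of t] x by (simp add: H_index[OF x j] G_index[OF u j] del: index_mult_mat_vec)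
  next
    case (Suc k)
    have "y (t + r j) $ j = (C *\<^sub>v (A ^\<^sub>m k *\<^sub>v x (Suc t))) $ j"
      using *[of k "Suc t"] Suc by simp
    then show ?thesis
      unfolding trajectory_state[OF tr] pow_step[OF x u j] H_index[OF x j] G_index[OF u j] using Suc
      by (simp del: index_mult_mat_vec pow_mat.simps)
  qed
qed

text \<open>The outputs at the times \<open>t + k\<close> with \<open>k \<le> r j\<close> are the
  quantities whose vanishing defines \<open>V\<close> and \<open>F\<close>; hence the look-ahead by
  \<open>rmax\<close>.\<close>

lemma zero_output_feedback:
  assumes tr: "trajectory x u y" and y: "\<And>t. t < K \<Longrightarrow> y t = 0\<^sub>v m"
    and r: "\<And>j. j < m \<Longrightarrow> r j \<le> rmax" and t: "t + rmax < K"
  shows "x t \<in> V" and "u t = F *\<^sub>v x t"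
proof -
  have x: "x t \<in> carrier_vec n" and u: "u t \<in> carrier_vec m" using tr by auto
  show "x t \<in> V"
    unfolding V_def
  proof (intro CollectI conjI allI impI)
    fix j k assume jk: "j < m" "k < r j"
    then show "(C *\<^sub>v (A ^\<^sub>m k *\<^sub>v x t)) $ j = 0"
      using output_advance(1)[OF tr jk, of t] y[of "t + k"] r[OF jk(1)] t by (simp del: index_mult_mat_vec)
  qed (rule x)
  have "H *\<^sub>v x t + G *\<^sub>v u t = 0\<^sub>v m"
  proof (rule eq_vecI)
    fix j assume "j < dim_vec (0\<^sub>v m :: real vec)"
    then have j: "j < m" by simp
    then show "(H *\<^sub>v x t + G *\<^sub>v u t) $ j = 0\<^sub>v m $ j"
      using output_advance(2)[OF tr j, of t] y[of "t + r j"] r[OF j] t carrier_matD[OF G_carrier]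
      by (simp del: index_mult_mat_vec)
  qed (simp add: carrier_matD[OF G_carrier])
  then show "u t = F *\<^sub>v x t" using F_iff[OF x u] by simp
qed

lemma feedback_zero:
  assumes v: "v \<in> carrier_vec n" and j: "j < m"
  shows "(H *\<^sub>v v) $ j + (G *\<^sub>v (F *\<^sub>v v)) $ j = 0"
proof -
  have "H *\<^sub>v v + G *\<^sub>v (F *\<^sub>v v) = 0\<^sub>v m" using F_iff[OF v F_mult_carrier[OF v]] by simp
  from arg_cong[OF this, of "\<lambda>z. z $ j"] show ?thesis
    using j carrier_matD[OF G_carrier] by (simp del: index_mult_mat_vec)
qed

text \<open>For \<open>k + 1 < r j\<close> the input term vanishes and the next condition in
  \<open>V\<close> applies. For \<open>k + 1 = r j\<close> the expression is component
  \<open>j\<close> of \<open>H v + G F v\<close>, which the feedback makes zero.\<close>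

lemma AF_V:
  assumes v: "v \<in> V"
  shows "AF *\<^sub>v v \<in> V"
proof -
  have c: "v \<in> carrier_vec n" "F *\<^sub>v v \<in> carrier_vec m" using v by auto
  have "(C *\<^sub>v (A ^\<^sub>m k *\<^sub>v (AF *\<^sub>v v))) $ j = 0" if jk: "j < m" "k < r j" for j k
  proof (cases "k + 2 \<le> r j")
    case True
    then have "Suc k < r j" by simp
    then have "(C *\<^sub>v (A ^\<^sub>m Suc k *\<^sub>v v)) $ j = 0" by (rule V_D[OF v jk(1)])
    then show ?thesis
      unfolding AF_mult[OF c(1)] pow_step[OF c jk(1)] using markov_zero[OF jk(1) True c(2)] by simp
  next
    case False
    then have "r j = Suc k" using jk by simp
    then show ?thesis
      unfolding AF_mult[OF c(1)] pow_step[OF c jk(1)]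
      using feedback_zero[OF c(1) jk(1)] by (auto simp: H_index[OF c(1) jk(1)] G_index[OF c(2) jk(1)] simp del: index_mult_mat_vec pow_mat.simps)
  qed
  then show ?thesis using c unfolding V_def by simp
qed

lemma AF_pow_V: "v \<in> V \<Longrightarrow> AF ^\<^sub>m t *\<^sub>v v \<in> V"
proof (induction t)
  case (Suc t)
  then show ?case using AF_V pow_mat_Suc_vec[OF AF_carrier V_carrier[OF Suc.prems]] by simp
qed (simp add: carrier_matD[OF AF_carrier])

text \<open>Only the output needs an argument: for \<open>r j = 0\<close> its component is the
  feedback equation itself, and for \<open>r j > 0\<close> the contributions of \<open>C\<close> and
  \<open>D\<close> vanish separately.\<close>

lemma zero_dynamics_trajectory:
  assumes v: "v \<in> V"
  shows "trajectory (\<lambda>t. AF ^\<^sub>m t *\<^sub>v v) (\<lambda>t. F *\<^sub>v (AF ^\<^sub>m t *\<^sub>v v)) (\<lambda>t. 0\<^sub>v m)"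
proof -
  have V: "AF ^\<^sub>m t *\<^sub>v v \<in> V" for t by (rule AF_pow_V[OF v])
  have out: "C *\<^sub>v w + D *\<^sub>v (F *\<^sub>v w) = 0\<^sub>v m" if w: "w \<in> V" for w
  proof (rule eq_vecI)
    fix j assume "j < dim_vec (0\<^sub>v m :: real vec)"
    then have j: "j < m" by simp
    have c: "w \<in> carrier_vec n" "F *\<^sub>v w \<in> carrier_vec m" using w by auto
    have "(C *\<^sub>v w) $ j + (D *\<^sub>v (F *\<^sub>v w)) $ j = 0"
    proof (cases "r j")
      case 0
      then show ?thesis
        using feedback_zero[OF c(1) j] c by (simp add: H_index[OF c(1) j] G_index[OF c(2) j] del: index_mult_mat_vec)
    next
      case (Suc k)
      then have rj: "0 < r j" by simp
      then have "(C *\<^sub>v (A ^\<^sub>m 0 *\<^sub>v w)) $ j = 0"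
        by (rule V_D[OF w j])
      moreover have "A ^\<^sub>m 0 *\<^sub>v w = w" using c(1) by simp
      ultimately have "(C *\<^sub>v w) $ j = 0" by (simp only:)
      then show ?thesis unfolding direct_zero[OF j rj c(2)] by (simp only: add_0)
    qed
    then show "(C *\<^sub>v w + D *\<^sub>v (F *\<^sub>v w)) $ j = 0\<^sub>v m $ j" using j by (simp del: index_mult_mat_vec)
  qed simp
  have step: "AF ^\<^sub>m Suc t *\<^sub>v v = A *\<^sub>v (AF ^\<^sub>m t *\<^sub>v v) + B *\<^sub>v (F *\<^sub>v (AF ^\<^sub>m t *\<^sub>v v))" for t
    unfolding pow_mat_Suc_vec[OF AF_carrier V_carrier[OF v]] by (rule AF_mult[OF V_carrier[OF V]])
  have sig: "(\<lambda>t. AF ^\<^sub>m t *\<^sub>v v) \<in> signals n" by (rule signalsI) (rule V_carrier[OF V])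
  have sig': "(\<lambda>t. F *\<^sub>v (AF ^\<^sub>m t *\<^sub>v v)) \<in> signals m"
    by (rule signalsI) (rule F_mult_carrier[OF V_carrier[OF V]])
  have sig0: "(\<lambda>t. 0\<^sub>v m) \<in> signals m" by (rule signalsI) (rule zero_carrier_vec)
  show ?thesis
    unfolding state_trajectory_def Suc_eq_plus1[symmetric]
    using sig sig' sig0 step out[OF V, symmetric] by blast
qed

lemma feedback_orbit:
  assumes tr: "trajectory x u y" and u: "\<And>t. t < K \<Longrightarrow> u t = F *\<^sub>v x t" and t: "t \<le> K"
  shows "x t = AF ^\<^sub>m t *\<^sub>v x 0"
  using t
proof (induction t)
  case (Suc t)
  have c: "x t \<in> carrier_vec n" "x 0 \<in> carrier_vec n" using tr by auto
  have "x (Suc t) = AF *\<^sub>v x t" using trajectory_state[OF tr, of t] u[of t] Suc.prems AF_mult[OF c(1)] by simp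
  then show ?case using Suc pow_mat_Suc_vec[OF AF_carrier c(2), of t] by simp
qed (use tr in \<open>simp add: carrier_matD[OF AF_carrier]\<close>)

text \<open>The block rows of \<open>obs_mat n m AF F k\<close> are \<open>F AF^t\<close>, so it
  sends a state in \<open>V\<close> to its first \<open>k\<close> feedback inputs. The last
  \<open>rmax\<close> inputs of a zero-output window may deviate from the feedback, hence
  \<open>k + rmax \<le> L\<close>.\<close>

lemma proj_zero_output_inputs:
  assumes rep: "state_rep m m \<B> n A B C D" and r: "\<And>j. j < m \<Longrightarrow> r j \<le> rmax"
    and L: "rmax < L" "k + rmax \<le> L"
  shows "proj_blocks m k (zero_output_inputs m m \<B> L) = (\<lambda>v. obs_mat n m AF F k *\<^sub>v v) ` V"
proof (intro equalityI subsetI)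
  have k: "k \<le> L" and L0: "L > 0" using L by auto
  {
    fix s assume "s \<in> proj_blocks m k (zero_output_inputs m m \<B> L)"
    then obtain x u y where tr: "trajectory x u y" and y: "\<And>t. t < L \<Longrightarrow> y t = 0\<^sub>v m"
      and s: "s = vec_first (stack m L u) (k * m)"
      unfolding proj_blocks_def using zero_output_inputs_iff[OF rep L0] by auto
    have x0: "x 0 \<in> V" by (rule zero_output_feedback(1)[OF tr, of L rmax]) (use y r L in auto)
    have uF: "u t = F *\<^sub>v x t" if "t < k" for t
      by (rule zero_output_feedback(2)[OF tr, of L rmax]) (use y r L that in auto)
    have "u t = F *\<^sub>v (AF ^\<^sub>m t *\<^sub>v x 0)" if "t < k" for t
    proof -
      have "x t = AF ^\<^sub>m t *\<^sub>v x 0" by (rule feedback_orbit[OF tr, of k]) (use uF that in auto)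
      from uF[OF that] arg_cong[OF this, of "(*\<^sub>v) F"] show ?thesis by (rule trans)
    qed
    moreover have "u t \<in> carrier_vec m" "F *\<^sub>v (AF ^\<^sub>m t *\<^sub>v x 0) \<in> carrier_vec m" for t
      using tr x0 by (auto simp del: pow_mat.simps)
    ultimately have "stack m k u = stack m k (\<lambda>t. F *\<^sub>v (AF ^\<^sub>m t *\<^sub>v x 0))"
      by (subst stack_eq_iff) blast+
    then show "s \<in> (\<lambda>v. obs_mat n m AF F k *\<^sub>v v) ` V"
      unfolding s proj_blocks_stack[OF k] using x0 obs_mat_mult_vec[OF AF_carrier F_carrier V_carrier[OF x0]] by (metis image_eqI)
  next
    fix s assume "s \<in> (\<lambda>v. obs_mat n m AF F k *\<^sub>v v) ` V"
    then obtain v where v: "v \<in> V" and s: "s = obs_mat n m AF F k *\<^sub>v v" by auto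
    have "stack m L (\<lambda>t. F *\<^sub>v (AF ^\<^sub>m t *\<^sub>v v)) \<in> zero_output_inputs m m \<B> L"
      unfolding zero_output_inputs_iff[OF rep L0] using zero_dynamics_trajectory[OF v] by blast
    then show "s \<in> proj_blocks m k (zero_output_inputs m m \<B> L)"
      unfolding proj_blocks_def s obs_mat_mult_vec[OF AF_carrier F_carrier V_carrier[OF v]]
      using proj_blocks_stack[OF k] by (metis image_eqI)
  }
qed

end

section \<open>Dimension of \<open>V\<close> and convergence of observable states\<close>

lemma mat_vec_cancel:
  fixes A :: "real mat"
  assumes A: "A \<in> carrier_mat nr nc"
    and ker: "\<And>v. v \<in> carrier_vec nc \<Longrightarrow> A *\<^sub>v v = 0\<^sub>v nr \<Longrightarrow> v = 0\<^sub>v nc"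
    and a: "a \<in> carrier_vec nc" and b: "b \<in> carrier_vec nc" and eq: "A *\<^sub>v a = A *\<^sub>v b"
  shows "a = b"
proof -
  have "A *\<^sub>v (a - b) = 0\<^sub>v nr"
    using mult_minus_distrib_mat_vec[OF A a b] eq mult_mat_vec_carrier[OF A b] by simp
  then have "a - b = 0\<^sub>v nc" using ker a b by simp
  then show ?thesis using a b by (auto simp: vec_eq_iff)
qed

text \<open>Rank-nullity: with \<open>Y\<close> a right inverse of \<open>K\<close>, the columns of
  \<open>E\<close> span the kernel and those of \<open>Y\<close> a complement, so the matrix
  \<open>N\<close> composed of both has trivial kernel on both sides.\<close>

lemma kernel_basis_card:
  fixes E K :: "real mat"
  assumes E: "E \<in> carrier_mat n d" and K: "K \<in> carrier_mat R n"
    and injE: "\<And>c. c \<in> carrier_vec d \<Longrightarrow> E *\<^sub>v c = 0\<^sub>v n \<Longrightarrow> c = 0\<^sub>v d"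
    and lkK: "\<And>a. a \<in> carrier_vec R \<Longrightarrow> K\<^sup>T *\<^sub>v a = 0\<^sub>v n \<Longrightarrow> a = 0\<^sub>v R"
    and ker: "\<And>v. v \<in> carrier_vec n \<Longrightarrow> K *\<^sub>v v = 0\<^sub>v R \<longleftrightarrow> (\<exists>c\<in>carrier_vec d. v = E *\<^sub>v c)"
  shows "d + R = n"
proof -
  obtain Y where Y: "Y \<in> carrier_mat n R" "K * Y = 1\<^sub>m R"
    using right_inverse_exists[OF K lkK] by blast
  have KY: "K *\<^sub>v (Y *\<^sub>v e) = e" if "e \<in> carrier_vec R" for e
    using assoc_mult_mat_vec[OF K Y(1) that] Y that by simp
  have KE: "K *\<^sub>v (E *\<^sub>v c) = 0\<^sub>v R" if "c \<in> carrier_vec d" for c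
    using ker[of "E *\<^sub>v c"] mult_mat_vec_carrier[OF E that] that by blast
  define N where "N = mat n (d + R) (\<lambda>(i, c). if c < d then E $$ (i, c) else Y $$ (i, c - d))"
  have N: "N \<in> carrier_mat n (d + R)" by (simp add: N_def)
  have Nv: "N *\<^sub>v (c @\<^sub>v e) = E *\<^sub>v c + Y *\<^sub>v e" if c: "c \<in> carrier_vec d" and e: "e \<in> carrier_vec R" for c e
  proof (rule eq_vecI)
    fix i assume "i < dim_vec (E *\<^sub>v c + Y *\<^sub>v e)"
    then have i: "i < n" using Y by simp
    have "row N i = row E i @\<^sub>v row Y i" using i E Y by (intro eq_vecI) (auto simp: N_def)
    then have "(N *\<^sub>v (c @\<^sub>v e)) $ i = (row E i @\<^sub>v row Y i) \<bullet> (c @\<^sub>v e)" using i N by simp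
    also have "\<dots> = row E i \<bullet> c + row Y i \<bullet> e"
      by (rule scalar_prod_append[of _ d _ R]) (use E Y c e in \<open>auto intro: carrier_vecI\<close>)
    finally show "(N *\<^sub>v (c @\<^sub>v e)) $ i = (E *\<^sub>v c + Y *\<^sub>v e) $ i" using i E Y by simp
  qed (use N Y in simp)
  have "z = 0\<^sub>v (d + R)" if z: "z \<in> carrier_vec (d + R)" "N *\<^sub>v z = 0\<^sub>v n" for z
  proof -
    obtain c e where ce: "c \<in> carrier_vec d" "e \<in> carrier_vec R" "z = c @\<^sub>v e"
      using vec_first_last_append[OF z(1)] vec_first_carrier vec_last_carrier by metis
    have Ec: "E *\<^sub>v c \<in> carrier_vec n" and Ye: "Y *\<^sub>v e \<in> carrier_vec n" using E Y ce by auto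
    have eq: "E *\<^sub>v c + Y *\<^sub>v e = 0\<^sub>v n" using z ce Nv by simp
    have "K *\<^sub>v (E *\<^sub>v c + Y *\<^sub>v e) = e"
      unfolding mult_add_distrib_mat_vec[OF K Ec Ye] KE[OF ce(1)] KY[OF ce(2)] using ce by simp
    then have e0: "e = 0\<^sub>v R" using eq K by simp
    then have "E *\<^sub>v c = 0\<^sub>v n" using eq Ec Y by simp
    then have "c = 0\<^sub>v d" using injE ce by blast
    then show ?thesis unfolding ce(3) e0 by (intro eq_vecI) auto
  qed
  then have "d + R \<le> n" by (rule trivial_kernel_le[OF N])
  moreover have "n \<le> d + R"
  proof (rule trivial_kernel_le[of "N\<^sup>T"])
    show "N\<^sup>T \<in> carrier_mat (d + R) n" using N by simp
    fix z :: "real vec" assume z: "z \<in> carrier_vec n" "N\<^sup>T *\<^sub>v z = 0\<^sub>v (d + R)"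
    \<comment> \<open>Subtracting \<open>Y *\<^sub>v (K *\<^sub>v x)\<close> from \<open>x\<close>
      leaves an element of the kernel of \<open>K\<close>, so \<open>x\<close> is a combination of
      the columns of \<open>N\<close>.\<close>
    have "z \<bullet> x = 0" if x: "x \<in> carrier_vec n" for x
    proof -
      define e where "e = K *\<^sub>v x"
      have e: "e \<in> carrier_vec R" using K x by (simp add: e_def)
      have Ye: "Y *\<^sub>v e \<in> carrier_vec n" using Y e by simp
      have "K *\<^sub>v (x - Y *\<^sub>v e) = 0\<^sub>v R"
        unfolding mult_minus_distrib_mat_vec[OF K x Ye] KY[OF e] using e by (simp add: e_def)
      then obtain c where c: "c \<in> carrier_vec d" "x - Y *\<^sub>v e = E *\<^sub>v c" using ker[of "x - Y *\<^sub>v e"] x Ye by auto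
      have "x = (x - Y *\<^sub>v e) + Y *\<^sub>v e" using x Ye Y(1)
        by (intro eq_vecI) (auto simp del: index_mult_mat_vec)
      then have "x = N *\<^sub>v (c @\<^sub>v e)" unfolding Nv[OF c(1) e] c(2) .
      then have "z \<bullet> x = (N\<^sup>T *\<^sub>v z) \<bullet> (c @\<^sub>v e)"
        using transpose_vec_mult_scalar[OF N _ z(1), of "c @\<^sub>v e"] c e by simp
      then show ?thesis unfolding z(2) using c e by simp
    qed
    then show "z = 0\<^sub>v n" using conjugate_square_eq_0_vec[OF z(1)] z(1) by simp
  qed
  ultimately show ?thesis by simp
qed

lemma stack_Suc:
  assumes "f l \<in> carrier_vec m"
  shows "stack m (Suc l) f = stack m l f @\<^sub>v f l"
proof (rule eq_vecI)
  have d: "dim_vec (f l) = m" using assms by (rule carrier_vecD)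
  show "dim_vec (stack m (Suc l) f) = dim_vec (stack m l f @\<^sub>v f l)" by (simp add: d)
  fix i assume "i < dim_vec (stack m l f @\<^sub>v f l)"
  then have i: "i < Suc l * m" by (simp add: d)
  show "stack m (Suc l) f $ i = (stack m l f @\<^sub>v f l) $ i"
  proof (cases "i < l * m")
    case False
    then obtain q where q: "i = l * m + q" by (metis le_add_diff_inverse not_less)
    then have "q < m" using i by simp
    then show ?thesis using i q by (simp add: stack_index d)
  qed (use i in \<open>simp add: stack_index d\<close>)
qed

lemma vec_last_stack_Suc: "vec_last (stack m (Suc l) f) (l * m) = stack m l (\<lambda>t. f (Suc t))"
proof (rule eq_vecI)
  fix i assume "i < dim_vec (stack m l (\<lambda>t. f (Suc t)))"
  then have i: "i < l * m" by simp
  then have "m > 0" by (auto intro: gr0I)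
  then show "vec_last (stack m (Suc l) f) (l * m) $ i = stack m l (\<lambda>t. f (Suc t)) $ i"
    using i by (simp add: vec_last_def stack_index)
qed simp

context linear_system
begin

lemma observable_obs_mat_kernel:
  assumes obs: observable and v: "v \<in> carrier_vec n" "obs_mat n p A C n *\<^sub>v v = 0\<^sub>v (n * p)"
  shows "v = 0\<^sub>v n"
proof -
  have "stack p n (\<lambda>t. C *\<^sub>v (A ^\<^sub>m t *\<^sub>v v)) = stack p n (\<lambda>t. 0\<^sub>v p)"
    using v obs_mat_mult_vec[OF A C v(1)] by (simp add: stack_zero)
  then have "\<forall>t<n. C *\<^sub>v (A ^\<^sub>m t *\<^sub>v v) = 0\<^sub>v p" using v by (subst (asm) stack_eq_iff) simp_all
  then show ?thesis using obs v unfolding observable_def by blast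
qed

text \<open>Zero output means \<open>C x = - D u\<close>, and
  \<open>C A^(s+1) x(t) = C A^s x(t+1) - C A^s B u(t)\<close>. So each \<open>C A^s x(t)\<close>
  tends to zero by induction on \<open>s\<close>, and a left inverse of the observability matrix
  recovers the state.\<close>

lemma observable_state_converges:
  assumes obs: observable and tr: "trajectory x u (\<lambda>t. 0\<^sub>v p)" and conv: "vec_converges m u (0\<^sub>v m)"
  shows "vec_converges n x (0\<^sub>v n)"
proof -
  have c: "x t \<in> carrier_vec n" "u t \<in> carrier_vec m" for t using tr by auto
  have lim: "(\<lambda>t. (C *\<^sub>v (A ^\<^sub>m s *\<^sub>v x t)) $ q) \<longlonglongrightarrow> 0" if q: "q < p" for s q
  proof (induction s)
    case 0
    have "vec_converges p (\<lambda>t. D *\<^sub>v u t) (0\<^sub>v p)" by (rule vec_converges_mult_mat[OF D c(2) conv])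
    then have "(\<lambda>t. - (D *\<^sub>v u t) $ q) \<longlonglongrightarrow> - 0"
      using q unfolding vec_converges_zero_iff by (intro tendsto_minus) auto
    moreover have "(C *\<^sub>v (A ^\<^sub>m 0 *\<^sub>v x t)) $ q = - (D *\<^sub>v u t) $ q" for t
    proof -
      have "A ^\<^sub>m 0 *\<^sub>v x t = x t" using c by simp
      moreover have "(C *\<^sub>v x t) $ q + (D *\<^sub>v u t) $ q = 0"
        using arg_cong[OF trajectory_output[OF tr, of t], of "\<lambda>z. z $ q"] q by (simp del: index_mult_mat_vec)
      ultimately show ?thesis by (simp del: index_mult_mat_vec pow_mat.simps)
    qed
    ultimately show ?case by (simp del: index_mult_mat_vec pow_mat.simps)
  next
    case (Suc s)
    have As: "A ^\<^sub>m s \<in> carrier_mat n n" by simp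
    have "vec_converges p (\<lambda>t. C *\<^sub>v (A ^\<^sub>m s *\<^sub>v (B *\<^sub>v u t))) (0\<^sub>v p)"
      by (rule vec_converges_mult_mat[OF C _ vec_converges_mult_mat[OF As _ vec_converges_mult_mat[OF B c(2) conv]]])
        (use c in simp_all)
    then have "(\<lambda>t. (C *\<^sub>v (A ^\<^sub>m s *\<^sub>v x (Suc t))) $ q - (C *\<^sub>v (A ^\<^sub>m s *\<^sub>v (B *\<^sub>v u t))) $ q) \<longlonglongrightarrow> 0 - 0"
      using q Suc unfolding vec_converges_zero_iff by (intro tendsto_diff LIMSEQ_Suc) auto
    moreover have "(C *\<^sub>v (A ^\<^sub>m s *\<^sub>v x (Suc t))) $ q - (C *\<^sub>v (A ^\<^sub>m s *\<^sub>v (B *\<^sub>v u t))) $ q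
        = (C *\<^sub>v (A ^\<^sub>m Suc s *\<^sub>v x t)) $ q" for t
      unfolding trajectory_state[OF tr] pow_step[OF c q] by (simp only: add_diff_cancel_right')
    ultimately show ?case by (simp only: diff_0_right)
  qed
  let ?O = "obs_mat n p A C n"
  obtain Z where Z: "Z \<in> carrier_mat n (n * p)" "Z * ?O = 1\<^sub>m n"
    using left_inverse_exists[OF obs_mat_carrier] observable_obs_mat_kernel[OF obs] by blast
  have "vec_converges (n * p) (\<lambda>t. ?O *\<^sub>v x t) (0\<^sub>v (n * p))"
    unfolding vec_converges_zero_iff
  proof (intro allI impI)
    fix i assume i: "i < n * p"
    have "(?O *\<^sub>v x t) $ i = (C *\<^sub>v (A ^\<^sub>m (i div p) *\<^sub>v x t)) $ (i mod p)" for t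
      unfolding obs_mat_mult_vec[OF A C c(1)] by (rule stack_index[OF i])
    then show "(\<lambda>t. (?O *\<^sub>v x t) $ i) \<longlonglongrightarrow> 0"
      using lim[OF div_mod_less(2)[OF i], of "i div p"] by (simp only:)
  qed
  from vec_converges_mult_mat[OF Z(1) mult_mat_vec_carrier[OF obs_mat_carrier c(1)] this]
  have "vec_converges n (\<lambda>t. Z *\<^sub>v (?O *\<^sub>v x t)) (0\<^sub>v n)" .
  moreover have "Z *\<^sub>v (?O *\<^sub>v x t) = x t" for t
    using assoc_mult_mat_vec[OF Z(1) obs_mat_carrier[of n p A C n] c(1)[of t]] one_mult_mat_vec[OF c(1)]
    unfolding Z(2) by metis
  ultimately show ?thesis by simp
qed

end

context square_system
begin

text \<open>Independence of the rows \<open>C_j A^k\<close>, \<open>k < r_j\<close>: applied to \<open>A^s B\<close> for \<open>s = 0, 1, \<dots>\<close>, a vanishing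
  combination has only the terms \<open>k = r_j - 1 - s\<close> left, and these give rows of the invertible decoupling
  matrix.\<close>

lemma V_as_mat_kernel:
  obtains K where "K \<in> carrier_mat (\<Sum>j<m. r j) n"
    "\<And>v. v \<in> carrier_vec n \<Longrightarrow> K *\<^sub>v v = 0\<^sub>v (\<Sum>j<m. r j) \<longleftrightarrow> v \<in> V"
    "\<And>a. a \<in> carrier_vec (\<Sum>j<m. r j) \<Longrightarrow> K\<^sup>T *\<^sub>v a = 0\<^sub>v n \<Longrightarrow> a = 0\<^sub>v (\<Sum>j<m. r j)"
proof -
  define R where "R = (\<Sum>j<m. r j)"
  define S where "S = (SIGMA j:{..<m}. {..<r j})"
  have finS: "finite S" by (simp add: S_def)
  have "card S = R" by (simp add: S_def R_def card_SigmaI)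
  then obtain h where h: "bij_betw h {0..<R} S" using ex_bij_betw_nat_finite[OF finS] by auto
  have hS: "fst (h i) < m" "snd (h i) < r (fst (h i))" if "i < R" for i
  proof -
    have "h i \<in> S" using bij_betwE[OF h] that by simp
    then show "fst (h i) < m" "snd (h i) < r (fst (h i))" by (auto simp: S_def)
  qed
  define K where "K = mat\<^sub>r R n (\<lambda>i. row (C * A ^\<^sub>m snd (h i)) (fst (h i)))"
  have K: "K \<in> carrier_mat R n" by (simp add: K_def)
  define \<phi> where "\<phi> v jk = (C *\<^sub>v (A ^\<^sub>m snd jk *\<^sub>v v)) $ fst jk" for v and jk :: "nat \<times> nat"
  have Kv: "(K *\<^sub>v v) $ i = \<phi> v (h i)" if v: "v \<in> carrier_vec n" and i: "i < R" for v i
  proof -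
    have "row K i = row (C * A ^\<^sub>m snd (h i)) (fst (h i))"
      unfolding K_def by (rule row_mat_of_row_fun) (use i in \<open>auto intro: carrier_vecI\<close>)
    then show ?thesis using row_mult_pow[OF A C v hS(1)[OF i]] i K by (simp add: \<phi>_def)
  qed
  show thesis
  proof (rule that[of K, folded R_def])
    show "K \<in> carrier_mat R n" by (rule K)
  next
    fix v :: "real vec" assume v: "v \<in> carrier_vec n"
    have "K *\<^sub>v v = 0\<^sub>v R \<longleftrightarrow> (\<forall>i<R. (K *\<^sub>v v) $ i = 0)"
      using K by (auto simp: vec_eq_iff simp del: index_mult_mat_vec)
    also have "\<dots> \<longleftrightarrow> (\<forall>i\<in>{0..<R}. \<phi> v (h i) = 0)" using Kv[OF v] by auto
    also have "\<dots> \<longleftrightarrow> (\<forall>jk\<in>S. \<phi> v jk = 0)"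
      unfolding bij_betw_imp_surj_on[OF h, symmetric] by blast
    also have "\<dots> \<longleftrightarrow> v \<in> V" using v unfolding S_def V_def \<phi>_def by auto
    finally show "K *\<^sub>v v = 0\<^sub>v R \<longleftrightarrow> v \<in> V" .
  next
    fix a :: "real vec" assume a: "a \<in> carrier_vec R" "K\<^sup>T *\<^sub>v a = 0\<^sub>v n"
    define b where "b jk = a $ inv_into {0..<R} h jk" for jk
    have bh: "b (h i) = a $ i" if "i < R" for i
      unfolding b_def using bij_betw_inv_into_left[OF h, of i] that by simp
    have rel: "(\<Sum>j<m. \<Sum>k<r j. b (j, k) * (C *\<^sub>v (A ^\<^sub>m k *\<^sub>v v)) $ j) = 0" if v: "v \<in> carrier_vec n" for v
    proof -
      have "0 = (K\<^sup>T *\<^sub>v a) \<bullet> v" unfolding a(2) using v by simp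
      also have "\<dots> = a \<bullet> (K *\<^sub>v v)" by (rule transpose_vec_mult_scalar[OF K v a(1)])
      also have "\<dots> = (\<Sum>i\<in>{0..<R}. a $ i * (K *\<^sub>v v) $ i)" using K by (simp add: scalar_prod_def del: index_mult_mat_vec)
      also have "\<dots> = (\<Sum>i\<in>{0..<R}. b (h i) * \<phi> v (h i))"
        using Kv[OF v] bh by (intro sum.cong) auto
      also have "\<dots> = (\<Sum>jk\<in>S. b jk * \<phi> v jk)"
        by (rule sum.reindex_bij_betw[OF h])
      also have "\<dots> = (\<Sum>j<m. \<Sum>k<r j. b (j, k) * \<phi> v (j, k))"
        unfolding S_def by (subst sum.Sigma) auto
      finally show ?thesis by (simp add: \<phi>_def del: index_mult_mat_vec)
    qed
    obtain Gi where Gi: "Gi \<in> carrier_mat m m" "G * Gi = 1\<^sub>m m"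
      using square_trivial_kernel_inverse[OF G_carrier] decoupling_inj unfolding G_def by blast
    have "\<forall>j<m. s < r j \<longrightarrow> b (j, r j - Suc s) = 0" for s
    proof (induction s rule: less_induct)
      case (less s)
      define c where "c = vec m (\<lambda>j. if s < r j then b (j, r j - Suc s) else 0)"
      have c: "c \<in> carrier_vec m" by (simp add: c_def)
      have "c \<bullet> (G *\<^sub>v w) = 0" if w: "w \<in> carrier_vec m" for w
      proof -
        have Bw: "B *\<^sub>v w \<in> carrier_vec n" "A ^\<^sub>m s *\<^sub>v (B *\<^sub>v w) \<in> carrier_vec n" using w by auto
        have "(\<Sum>k<r j. b (j, k) * (C *\<^sub>v (A ^\<^sub>m k *\<^sub>v (A ^\<^sub>m s *\<^sub>v (B *\<^sub>v w)))) $ j) = c $ j * (G *\<^sub>v w) $ j"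
          if j: "j < m" for j
        proof -
          let ?f = "\<lambda>k. b (j, k) * (C *\<^sub>v (A ^\<^sub>m (k + s) *\<^sub>v (B *\<^sub>v w))) $ j"
          \<comment> \<open>For \<open>k + s + 1 < r j\<close> the Markov term vanishes. For
            \<open>k + s + 1 > r j\<close> the coefficient was shown to be zero at the earlier stage
            \<open>r j - Suc k < s\<close>.\<close>
          have z: "?f k = 0" if k: "k < r j" "k + Suc s \<noteq> r j" for k
          proof (cases "k + Suc s < r j")
            case True
            then show ?thesis using markov_zero[OF j _ w, of "k + s"] by simp
          next
            case False
            then have "r j - Suc k < s" "r j - Suc k < r j" "r j - Suc (r j - Suc k) = k" using k by auto
            then have "b (j, k) = 0" using less.IH[of "r j - Suc k"] j by metis
            then show ?thesis by simp
          qed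
          have "(\<Sum>k<r j. ?f k) = c $ j * (G *\<^sub>v w) $ j"
          proof (cases "s < r j")
            case True
            have "(\<Sum>k<r j. ?f k) = (\<Sum>k\<in>{r j - Suc s}. ?f k)"
            proof (rule sum.mono_neutral_right)
              show "\<forall>k\<in>{..<r j} - {r j - Suc s}. ?f k = 0"
              proof
                fix k assume "k \<in> {..<r j} - {r j - Suc s}"
                then have "k < r j" "k + Suc s \<noteq> r j" by auto
                then show "?f k = 0" by (rule z)
              qed
            qed (use True in auto)
            moreover have "r j - Suc s + s = r j - 1" using True by simp
            ultimately show ?thesis using True j by (simp add: c_def G_index[OF w j] del: index_mult_mat_vec)
          next
            case False
            have "(\<Sum>k<r j. ?f k) = 0"
            proof (rule sum.neutral, rule ballI)
              fix k assume "k \<in> {..<r j}"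
              then show "?f k = 0" using False by (intro z) auto
            qed
            then show ?thesis using False j by (simp add: c_def del: index_mult_mat_vec)
          qed
          then show ?thesis unfolding pow_mat_add_vec[OF A Bw(1)] .
        qed
        then have "(\<Sum>j<m. c $ j * (G *\<^sub>v w) $ j) = 0" using rel[OF Bw(2)] by (simp del: index_mult_mat_vec)
        then show ?thesis by (simp add: scalar_prod_def[of c] lessThan_atLeast0 del: index_mult_mat_vec)
      qed
      \<comment> \<open>The vector \<open>w\<close> is chosen as the preimage of \<open>c\<close>
        under \<open>G\<close>.\<close>
      from this[OF mult_mat_vec_carrier[OF Gi(1) c]] have "c \<bullet> c = 0"
        using assoc_mult_mat_vec[OF G_carrier Gi(1) c] Gi c by simp
      then have "c = 0\<^sub>v m" using conjugate_square_eq_0_vec[OF c] by simp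
      then show ?case by (auto simp: c_def vec_eq_iff split: if_splits)
    qed
    then have b0: "b (j, k) = 0" if "j < m" "k < r j" for j k
      using that by (auto dest!: spec[of _ j] meta_spec[of _ "r j - Suc k"])
    show "a = 0\<^sub>v R"
    proof (rule eq_vecI)
      fix i assume "i < dim_vec (0\<^sub>v R :: real vec)"
      then have i: "i < R" by simp
      then show "a $ i = 0\<^sub>v R $ i" using b0[OF hS[OF i]] bh[OF i] by simp
    qed (use a in simp)
  qed
qed

end

section \<open>The matrix of the zero dynamics\<close>

lemma vec_converges_append_iff:
  assumes "\<And>t. f t \<in> carrier_vec a" "\<And>t. g t \<in> carrier_vec b"
  shows "vec_converges (a + b) (\<lambda>t. f t @\<^sub>v g t) (0\<^sub>v (a + b))
    \<longleftrightarrow> vec_converges a f (0\<^sub>v a) \<and> vec_converges b g (0\<^sub>v b)"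
proof -
  have f: "(f t @\<^sub>v g t) $ i = f t $ i" if "i < a" for t i
    using that carrier_vecD[OF assms(1), of t] carrier_vecD[OF assms(2), of t] by auto
  have g: "(f t @\<^sub>v g t) $ (a + i) = g t $ i" if "i < b" for t i
    using that carrier_vecD[OF assms(1), of t] carrier_vecD[OF assms(2), of t] by auto
  have "(\<forall>i<a + b. P i) \<longleftrightarrow> (\<forall>i<a. P i) \<and> (\<forall>i<b. P (a + i))" for P
    by (metis add_less_cancel_left le_add_diff_inverse not_less trans_less_add1)
  then show ?thesis unfolding vec_converges_zero_iff by (simp add: f g)
qed

text \<open>Each column ends at a sample not later than \<open>T\<close>, so data given only up to
  \<open>T\<close> may be replaced by a full trajectory extending them.\<close>

lemma hankel_cong:
  assumes "\<And>t. t \<le> T \<Longrightarrow> f t = g t" "L \<le> T + 1"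
  shows "hankel m T L f = hankel m T L g"
proof (rule eq_matI)
  fix i j assume "i < dim_row (hankel m T L g)" "j < dim_col (hankel m T L g)"
  then have ij: "i < L * m" "j < T + 2 - L" by (auto simp: hankel_def)
  then have "i div m + j \<le> T" using div_mod_less(1)[OF ij(1)] by linarith
  then show "hankel m T L f $$ (i, j) = hankel m T L g $$ (i, j)"
    using ij assms(1) by (simp add: hankel_def)
qed (simp_all add: hankel_def)

context square_system
begin

text \<open>This is where the lag enters. The difference \<open>z\<close> lies in \<open>V\<close>;
  its feedback input vanishes for \<open>l\<close> steps, so its zero output is that of a free
  motion, that is, \<open>C A^t z = 0\<close> for \<open>t < l\<close>.\<close>

lemma zero_dynamics_window_inj:
  assumes obs: "\<And>v. v \<in> carrier_vec n \<Longrightarrow> obs_mat n m A C l *\<^sub>v v = 0\<^sub>v (l * m) \<Longrightarrow> v = 0\<^sub>v n"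
    and v: "v \<in> V" and v': "v' \<in> V" and eq: "obs_mat n m AF F l *\<^sub>v v = obs_mat n m AF F l *\<^sub>v v'"
  shows "v = v'"
proof -
  obtain K where K: "K \<in> carrier_mat (\<Sum>j<m. r j) n"
    "\<And>v. v \<in> carrier_vec n \<Longrightarrow> K *\<^sub>v v = 0\<^sub>v (\<Sum>j<m. r j) \<longleftrightarrow> v \<in> V"
    by (rule V_as_mat_kernel) blast
  have c: "v \<in> carrier_vec n" "v' \<in> carrier_vec n" using v v' by auto
  define z where "z = v - v'"
  have zc: "z \<in> carrier_vec n" using c by (simp add: z_def)
  have "K *\<^sub>v z = K *\<^sub>v v - K *\<^sub>v v'" unfolding z_def by (rule mult_minus_distrib_mat_vec[OF K(1) c])
  also have "\<dots> = 0\<^sub>v (\<Sum>j<m. r j)" using K(2)[OF c(1)] K(2)[OF c(2)] v v' by simp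
  finally have z: "z \<in> V" using K(2)[OF zc] by simp
  have "obs_mat n m AF F l *\<^sub>v z = 0\<^sub>v (l * m)"
    unfolding z_def mult_minus_distrib_mat_vec[OF obs_mat_carrier c] eq
    using mult_mat_vec_carrier[OF obs_mat_carrier c(2), of m AF F l] by simp
  then have st: "stack m l (\<lambda>t. F *\<^sub>v (AF ^\<^sub>m t *\<^sub>v z)) = stack m l (\<lambda>_. 0\<^sub>v m)"
    by (simp add: obs_mat_mult_vec[OF AF_carrier F_carrier zc] stack_zero)
  have u0: "F *\<^sub>v (AF ^\<^sub>m t *\<^sub>v z) = 0\<^sub>v m" if "t < l" for t
    using st that V_carrier[OF AF_pow_V[OF z]]
      stack_eq_iff[of l "\<lambda>t. F *\<^sub>v (AF ^\<^sub>m t *\<^sub>v z)" m "\<lambda>_. 0\<^sub>v m"] by simp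
  have "C *\<^sub>v (A ^\<^sub>m t *\<^sub>v z) = 0\<^sub>v m" if "t < l" for t
    using zero_input_output[OF zero_dynamics_trajectory[OF z] u0 that] zc by (simp add: carrier_matD[OF AF_carrier])
  then have "stack m l (\<lambda>t. C *\<^sub>v (A ^\<^sub>m t *\<^sub>v z)) = stack m l (\<lambda>_. 0\<^sub>v m)"
    using zc by (subst stack_eq_iff) simp_all
  then have "obs_mat n m A C l *\<^sub>v z = 0\<^sub>v (l * m)"
    unfolding obs_mat_mult_vec[OF A C zc] stack_zero .
  then have "z = 0\<^sub>v n" by (rule obs[OF zc])
  then show ?thesis using c by (auto simp: z_def vec_eq_iff)
qed

text \<open>The first \<open>l\<close> blocks determine the state, hence the next input, so the
  \<open>THE\<close> in \<open>shift_window\<close> is well defined. Without its first block, the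
  sequence of feedback inputs is the window of the successor state.\<close>

lemma shift_window_eq:
  assumes obs: "\<And>v. v \<in> carrier_vec n \<Longrightarrow> obs_mat n m A C l *\<^sub>v v = 0\<^sub>v (l * m) \<Longrightarrow> v = 0\<^sub>v n"
    and M: "proj_blocks m (l + 1) M = (\<lambda>v. obs_mat n m AF F (l + 1) *\<^sub>v v) ` V" and v: "v \<in> V"
  shows "shift_window m l M (obs_mat n m AF F l *\<^sub>v v) = obs_mat n m AF F l *\<^sub>v (AF *\<^sub>v v)"
proof -
  have vc: "w \<in> carrier_vec n" "F *\<^sub>v (AF ^\<^sub>m t *\<^sub>v w) \<in> carrier_vec m" if "w \<in> V" for w t
    using that V_carrier[OF AF_pow_V[OF that]] by auto
  have split: "obs_mat n m AF F (l + 1) *\<^sub>v w = obs_mat n m AF F l *\<^sub>v w @\<^sub>v F *\<^sub>v (AF ^\<^sub>m l *\<^sub>v w)" if w: "w \<in> V" for w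
    unfolding obs_mat_mult_vec[OF AF_carrier F_carrier vc(1)[OF w]] Suc_eq_plus1[symmetric]
    by (rule stack_Suc) (rule vc(2)[OF w])
  let ?\<Omega> = "obs_mat n m AF F l"
  have \<Omega>c: "?\<Omega> *\<^sub>v w \<in> carrier_vec (l * m)" if "w \<in> V" for w
    by (rule mult_mat_vec_carrier[OF obs_mat_carrier vc(1)[OF that]])
  have the: "(THE u. u \<in> carrier_vec m \<and> ?\<Omega> *\<^sub>v v @\<^sub>v u \<in> proj_blocks m (l + 1) M) = F *\<^sub>v (AF ^\<^sub>m l *\<^sub>v v)"
  proof (rule the_equality)
    show "F *\<^sub>v (AF ^\<^sub>m l *\<^sub>v v) \<in> carrier_vec m \<and> ?\<Omega> *\<^sub>v v @\<^sub>v F *\<^sub>v (AF ^\<^sub>m l *\<^sub>v v) \<in> proj_blocks m (l + 1) M"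
      unfolding M split[OF v, symmetric] using v vc(2)[OF v] by blast
    fix u assume "u \<in> carrier_vec m \<and> ?\<Omega> *\<^sub>v v @\<^sub>v u \<in> proj_blocks m (l + 1) M"
    then obtain w where w: "w \<in> V" "?\<Omega> *\<^sub>v v @\<^sub>v u = ?\<Omega> *\<^sub>v w @\<^sub>v F *\<^sub>v (AF ^\<^sub>m l *\<^sub>v w)"
      unfolding M using split by auto
    then have "?\<Omega> *\<^sub>v v = ?\<Omega> *\<^sub>v w \<and> u = F *\<^sub>v (AF ^\<^sub>m l *\<^sub>v w)"
      using append_vec_eq[OF \<Omega>c[OF v] \<Omega>c[OF w(1)]] by metis
    moreover from this have "v = w" using zero_dynamics_window_inj[OF obs v w(1)] by blast
    ultimately show "u = F *\<^sub>v (AF ^\<^sub>m l *\<^sub>v v)" by simp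
  qed
  have Suc_vec: "AF ^\<^sub>m Suc t *\<^sub>v v = AF ^\<^sub>m t *\<^sub>v (AF *\<^sub>v v)" for t
    using pow_mat_add_vec[OF AF_carrier vc(1)[OF v], of t 1] vc(1)[OF v] by (simp add: carrier_matD[OF AF_carrier])
  have "shift_window m l M (?\<Omega> *\<^sub>v v) = vec_last (stack m (Suc l) (\<lambda>t. F *\<^sub>v (AF ^\<^sub>m t *\<^sub>v v))) (l * m)"
    unfolding shift_window_def the split[OF v, symmetric]
    unfolding obs_mat_mult_vec[OF AF_carrier F_carrier vc(1)[OF v]] by simp
  also have "\<dots> = ?\<Omega> *\<^sub>v (AF *\<^sub>v v)"
    unfolding vec_last_stack_Suc obs_mat_mult_vec[OF AF_carrier F_carrier vc(1)[OF AF_V[OF v]]] Suc_vec ..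
  finally show ?thesis .
qed

text \<open>The columns of \<open>E\<close> are the states in \<open>V\<close> whose windows are the
  basis vectors. As windows determine states, \<open>E\<close> parametrizes \<open>V\<close>, and
  the coordinates of a shifted window are also those of the successor state; they form a row of
  \<open>Q\<close>, whence \<open>AF * E = E * Q\<^sup>T\<close>.\<close>

lemma Q_tilde_realization:
  assumes rep: "state_rep m m \<B> n A B C D"
    and obs: "\<And>v. v \<in> carrier_vec n \<Longrightarrow> obs_mat n m A C l *\<^sub>v v = 0\<^sub>v (l * m) \<Longrightarrow> v = 0\<^sub>v n"
    and r: "\<And>j. j < m \<Longrightarrow> r j \<le> rmax" and L: "L \<ge> l + rmax + 1"
    and M: "M = zero_output_inputs m m \<B> L"
    and basis: "basis_list (l * m) (proj_blocks m l M) vs" and d: "d = length vs"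
  shows "d + (\<Sum>j<m. r j) = n" and "Q_tilde m l M vs \<in> carrier_mat d d"
    and "\<exists>E\<in>carrier_mat n d. V = {E *\<^sub>v c | c. c \<in> carrier_vec d}
      \<and> (\<forall>c\<in>carrier_vec d. E *\<^sub>v c = 0\<^sub>v n \<longrightarrow> c = 0\<^sub>v d)
      \<and> (\<forall>c\<in>carrier_vec d. AF *\<^sub>v (E *\<^sub>v c) = E *\<^sub>v ((Q_tilde m l M vs)\<^sup>T *\<^sub>v c))"
proof -
  let ?\<Omega> = "obs_mat n m AF F l"
  have projl: "proj_blocks m l M = (\<lambda>v. ?\<Omega> *\<^sub>v v) ` V"
    unfolding M by (rule proj_zero_output_inputs[OF rep r]) (use L in auto)
  have projSl: "proj_blocks m (l + 1) M = (\<lambda>v. obs_mat n m AF F (l + 1) *\<^sub>v v) ` V"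
    unfolding M by (rule proj_zero_output_inputs[OF rep r]) (use L in auto)
  define Vs where "Vs = mat_of_cols (l * m) vs"
  have Vs: "Vs \<in> carrier_mat (l * m) d" by (simp add: Vs_def d)
  have span: "(\<lambda>v. ?\<Omega> *\<^sub>v v) ` V = {Vs *\<^sub>v c | c. c \<in> carrier_vec d}"
    using basis_list_span[OF basis] unfolding projl Vs_def d .
  have indep: "c = 0\<^sub>v d" if "c \<in> carrier_vec d" "Vs *\<^sub>v c = 0\<^sub>v (l * m)" for c
    using basis_list_indep[OF basis] that unfolding Vs_def d by blast
  have vs_carrier: "set vs \<subseteq> carrier_vec (l * m)" using basis by (simp add: basis_list_def)
  have colVs: "col Vs k = vs ! k" if "k < d" for k
    using that vs_carrier unfolding Vs_def d by (intro col_mat_of_cols) auto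
  have unit: "X *\<^sub>v unit_vec d k = col X k" if "X \<in> carrier_mat a d" "k < d" for X :: "real mat" and a k
    using that by (intro eq_vecI) auto
  have "\<exists>v\<in>V. ?\<Omega> *\<^sub>v v = vs ! k" if k: "k < d" for k
  proof -
    have "vs ! k \<in> {Vs *\<^sub>v c | c. c \<in> carrier_vec d}"
      using unit[OF Vs k] colVs[OF k] by (metis (mono_tags, lifting) mem_Collect_eq unit_vec_carrier)
    then show ?thesis unfolding span[symmetric] by auto
  qed
  then obtain xs where xs: "\<And>k. k < d \<Longrightarrow> xs k \<in> V" "\<And>k. k < d \<Longrightarrow> ?\<Omega> *\<^sub>v xs k = vs ! k" by metis
  define E where "E = mat_of_cols n (map xs [0..<d])"
  have E: "E \<in> carrier_mat n d" by (simp add: E_def carrier_matI)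
  have colE: "col E k = xs k" if "k < d" for k
    using that V_carrier[OF xs(1)] unfolding E_def by (subst col_mat_of_cols) auto
  have \<Omega>: "?\<Omega> \<in> carrier_mat (l * m) n" by simp
  have "?\<Omega> * E = Vs"
  proof (rule mat_col_eqI)
    fix k assume "k < dim_col Vs"
    then have k: "k < d" using Vs by simp
    show "col (?\<Omega> * E) k = col Vs k"
      unfolding col_mult2[OF \<Omega> E k] colE[OF k] colVs[OF k] by (rule xs(2)[OF k])
  qed (use Vs E carrier_matD[OF \<Omega>] in auto)
  then have \<Omega>E: "?\<Omega> *\<^sub>v (E *\<^sub>v c) = Vs *\<^sub>v c" if "c \<in> carrier_vec d" for c
    using assoc_mult_mat_vec[OF \<Omega> E that] by simp
  obtain K where K: "K \<in> carrier_mat (\<Sum>j<m. r j) n"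
    "\<And>v. v \<in> carrier_vec n \<Longrightarrow> K *\<^sub>v v = 0\<^sub>v (\<Sum>j<m. r j) \<longleftrightarrow> v \<in> V"
    "\<And>a. a \<in> carrier_vec (\<Sum>j<m. r j) \<Longrightarrow> K\<^sup>T *\<^sub>v a = 0\<^sub>v n \<Longrightarrow> a = 0\<^sub>v (\<Sum>j<m. r j)"
    by (rule V_as_mat_kernel) blast
  have KE: "K * E = 0\<^sub>m (\<Sum>j<m. r j) d"
  proof (rule mat_col_eqI)
    fix k assume "k < dim_col (0\<^sub>m (\<Sum>j<m. r j) d :: real mat)"
    then have k: "k < d" by simp
    then show "col (K * E) k = col (0\<^sub>m (\<Sum>j<m. r j) d) k"
      unfolding col_mult2[OF K(1) E k] colE[OF k] using K(2)[OF V_carrier[OF xs(1)[OF k]]] xs(1)[OF k] by simp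
  qed (use K E in auto)
  have EV: "E *\<^sub>v c \<in> V" if c: "c \<in> carrier_vec d" for c
  proof -
    have "0\<^sub>m (\<Sum>j<m. r j) d *\<^sub>v c = 0\<^sub>v (\<Sum>j<m. r j)" using c by (intro eq_vecI) auto
    then show ?thesis
      using assoc_mult_mat_vec[OF K(1) E c] K(2)[OF mult_mat_vec_carrier[OF E c]] KE by simp
  qed
  have VE: "\<exists>c\<in>carrier_vec d. v = E *\<^sub>v c" if v: "v \<in> V" for v
  proof -
    obtain c where c: "c \<in> carrier_vec d" "?\<Omega> *\<^sub>v v = Vs *\<^sub>v c" using span v by blast
    then have "v = E *\<^sub>v c" using zero_dynamics_window_inj[OF obs v EV[OF c(1)]] \<Omega>E[OF c(1)] by simp
    with c show ?thesis by blast
  qed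
  have Einj: "c = 0\<^sub>v d" if c: "c \<in> carrier_vec d" "E *\<^sub>v c = 0\<^sub>v n" for c
    using indep[OF c(1)] \<Omega>E[OF c(1)] unfolding c(2) mult_mat_zero_vec[OF \<Omega>] by simp
  show "d + (\<Sum>j<m. r j) = n"
  proof (rule kernel_basis_card[OF E K(1) Einj K(3)])
    fix v :: "real vec" assume v: "v \<in> carrier_vec n"
    show "K *\<^sub>v v = 0\<^sub>v (\<Sum>j<m. r j) \<longleftrightarrow> (\<exists>c\<in>carrier_vec d. v = E *\<^sub>v c)"
      unfolding K(2)[OF v] using VE EV by blast
  qed
  have "\<exists>c\<in>carrier_vec d. AF *\<^sub>v xs k = E *\<^sub>v c" if "k < d" for k
    by (rule VE[OF AF_V[OF xs(1)[OF that]]])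
  then obtain q where q: "\<And>k. k < d \<Longrightarrow> q k \<in> carrier_vec d" "\<And>k. k < d \<Longrightarrow> AF *\<^sub>v xs k = E *\<^sub>v q k" by metis
  define Q where "Q = mat\<^sub>r d d q"
  have Q: "Q \<in> carrier_mat d d" by (simp add: Q_def)
  have rowQ: "row Q k = q k" if "k < d" for k
    unfolding Q_def using that q(1)[OF that] by (intro row_mat_of_row_fun) auto
  have shift: "shift_window m l M (vs ! k) = Vs *\<^sub>v q k" if k: "k < d" for k
  proof -
    have "shift_window m l M (?\<Omega> *\<^sub>v xs k) = ?\<Omega> *\<^sub>v (AF *\<^sub>v xs k)"
      by (rule shift_window_eq[OF obs projSl xs(1)[OF k]])
    then show ?thesis unfolding xs(2)[OF k] q(2)[OF k] \<Omega>E[OF q(1)[OF k]] .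
  qed
  \<comment> \<open>The \<open>THE\<close> is resolved by existence from the successor states and
    uniqueness from the independence of the basis windows.\<close>
  have Q_eq: "Q_tilde m l M vs = Q"
    unfolding Q_tilde_def d[symmetric] Vs_def[symmetric]
  proof (rule the_equality)
    show "Q \<in> carrier_mat d d \<and> (\<forall>k<d. shift_window m l M (vs ! k) = Vs *\<^sub>v row Q k)"
      using Q shift rowQ by simp
    fix Q' assume Q': "Q' \<in> carrier_mat d d \<and> (\<forall>k<d. shift_window m l M (vs ! k) = Vs *\<^sub>v row Q' k)"
    show "Q' = Q"
    proof (rule eq_rowI)
      fix k assume "k < dim_row Q"
      then have k: "k < d" using Q by simp
      have "row Q' k \<in> carrier_vec d" using Q' row_carrier[of Q' k] by auto
      moreover have "Vs *\<^sub>v row Q' k = Vs *\<^sub>v q k" using Q' shift[OF k] k by simp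
      ultimately show "row Q' k = row Q k"
        unfolding rowQ[OF k] using mat_vec_cancel[OF Vs indep _ q(1)[OF k]] by blast
    qed (use Q Q' in auto)
  qed
  then show "Q_tilde m l M vs \<in> carrier_mat d d" using Q by simp
  have Qt: "Q\<^sup>T \<in> carrier_mat d d" using Q by simp
  have "AF * E = E * Q\<^sup>T"
  proof (rule mat_col_eqI)
    fix k assume "k < dim_col (E * Q\<^sup>T)"
    then have k: "k < d" using Q by simp
    have "col Q\<^sup>T k = q k" using rowQ[OF k] k Q by simp
    then show "col (AF * E) k = col (E * Q\<^sup>T) k"
      unfolding col_mult2[OF AF_carrier E k] col_mult2[OF E Qt k] colE[OF k] using q(2)[OF k] by simp
  qed (use E Q carrier_matD[OF AF_carrier] in auto)
  then have "AF *\<^sub>v (E *\<^sub>v c) = E *\<^sub>v (Q\<^sup>T *\<^sub>v c)" if "c \<in> carrier_vec d" for c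
    using assoc_mult_mat_vec[OF AF_carrier E that] assoc_mult_mat_vec[OF E Qt that] by simp
  then show "\<exists>E\<in>carrier_mat n d. V = {E *\<^sub>v c | c. c \<in> carrier_vec d}
      \<and> (\<forall>c\<in>carrier_vec d. E *\<^sub>v c = 0\<^sub>v n \<longrightarrow> c = 0\<^sub>v d)
      \<and> (\<forall>c\<in>carrier_vec d. AF *\<^sub>v (E *\<^sub>v c) = E *\<^sub>v ((Q_tilde m l M vs)\<^sup>T *\<^sub>v c))"
    unfolding Q_eq using E EV VE Einj by (intro bexI[of _ E] conjI) blast+
qed

text \<open>Stability of \<open>Q\<close> is drawn from trajectories of the given representation
  alone. The converse must cover every minimal representation: the given state tends to zero, hence
  so does the input \<open>F x\<close>, and observability passes this on to the state of any
  other.\<close>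

lemma stable_zero_dynamics_iff:
  assumes min: "minimal_rep m m \<B> n A B C D" and E: "E \<in> carrier_mat n d" and Q: "Q \<in> carrier_mat d d"
    and V: "V = {E *\<^sub>v c | c. c \<in> carrier_vec d}"
    and Einj: "\<And>c. c \<in> carrier_vec d \<Longrightarrow> E *\<^sub>v c = 0\<^sub>v n \<Longrightarrow> c = 0\<^sub>v d"
    and AE: "\<And>c. c \<in> carrier_vec d \<Longrightarrow> AF *\<^sub>v (E *\<^sub>v c) = E *\<^sub>v (Q\<^sup>T *\<^sub>v c)"
  shows "stable_zero_dynamics m m \<B> \<longleftrightarrow> stable_mat Q"
proof -
  have rep: "state_rep m m \<B> n A B C D" using min unfolding minimal_rep_def by blast
  have Qt: "Q\<^sup>T \<in> carrier_mat d d" using Q by simp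
  have Qc: "(Q\<^sup>T) ^\<^sub>m t *\<^sub>v c \<in> carrier_vec d" if "c \<in> carrier_vec d" for t c
    by (rule pow_mat_vec_carrier[OF Qt that])
  have orbit: "AF ^\<^sub>m t *\<^sub>v (E *\<^sub>v c) = E *\<^sub>v ((Q\<^sup>T) ^\<^sub>m t *\<^sub>v c)" if c: "c \<in> carrier_vec d" for t c
  proof (induction t)
    case 0
    then show ?case using c E Q by (simp add: carrier_matD[OF AF_carrier])
  next
    case (Suc t)
    then show ?case
      unfolding pow_mat_Suc_vec[OF AF_carrier mult_mat_vec_carrier[OF E c]] pow_mat_Suc_vec[OF Qt c]
      using AE[OF Qc[OF c]] by simp
  qed
  show ?thesis
    unfolding stable_mat_iff_powers_converge[OF Q]
  proof
    assume stable: "stable_zero_dynamics m m \<B>"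
    obtain Z where Z: "Z \<in> carrier_mat d n" "Z * E = 1\<^sub>m d" using left_inverse_exists[OF E Einj] by blast
    show "\<forall>c\<in>carrier_vec d. vec_converges d (\<lambda>t. (Q\<^sup>T) ^\<^sub>m t *\<^sub>v c) (0\<^sub>v d)"
    proof
      fix c :: "real vec" assume c: "c \<in> carrier_vec d"
      have Ec: "E *\<^sub>v c \<in> V" using V c by blast
      let ?x = "\<lambda>t. AF ^\<^sub>m t *\<^sub>v (E *\<^sub>v c)"
      let ?u = "\<lambda>t. F *\<^sub>v ?x t"
      have tr: "trajectory ?x ?u (\<lambda>t. 0\<^sub>v m)" by (rule zero_dynamics_trajectory[OF Ec])
      then have "?u \<in> zero_dynamics m m \<B>"
        unfolding zero_dynamics_def using state_rep_iff[OF rep] by blast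
      then have "vec_converges (n + m) (\<lambda>i. ?x i @\<^sub>v ?u i) (0\<^sub>v (n + m))"
        using stable min tr unfolding stable_zero_dynamics_def by blast
      moreover have xc: "?x t \<in> carrier_vec n" "?u t \<in> carrier_vec m" for t
        using V_carrier[OF AF_pow_V[OF Ec]] F_mult_carrier[OF V_carrier[OF AF_pow_V[OF Ec]]] by blast+
      ultimately have "vec_converges n ?x (0\<^sub>v n)" using vec_converges_append_iff[of ?x n ?u m] by blast
      from vec_converges_mult_mat[OF Z(1) xc(1) this]
      have "vec_converges d (\<lambda>t. Z *\<^sub>v ?x t) (0\<^sub>v d)" .
      moreover have "Z *\<^sub>v ?x t = (Q\<^sup>T) ^\<^sub>m t *\<^sub>v c" for t
        unfolding orbit[OF c] using assoc_mult_mat_vec[OF Z(1) E Qc[OF c, of t]] one_mult_mat_vec[OF Qc[OF c, of t]]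
        unfolding Z(2) by metis
      ultimately show "vec_converges d (\<lambda>t. (Q\<^sup>T) ^\<^sub>m t *\<^sub>v c) (0\<^sub>v d)" by (simp only:)
    qed
  next
    assume conv: "\<forall>c\<in>carrier_vec d. vec_converges d (\<lambda>t. (Q\<^sup>T) ^\<^sub>m t *\<^sub>v c) (0\<^sub>v d)"
    show "stable_zero_dynamics m m \<B>"
      unfolding stable_zero_dynamics_def
    proof (intro ballI allI impI)
      fix u n' A' B' C' D' x'
      assume u: "u \<in> zero_dynamics m m \<B>" and min': "minimal_rep m m \<B> n' A' B' C' D'"
        and x': "x' \<in> signals n'" and st': "state_trajectory A' B' C' D' x' u (\<lambda>t. 0\<^sub>v m)"
      have us: "u \<in> signals m" and uB: "(\<lambda>t. u t @\<^sub>v 0\<^sub>v m) \<in> \<B>" using u by (auto simp: zero_dynamics_def)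
      have z: "(\<lambda>t. 0\<^sub>v m) \<in> signals m" by (rule signalsI) simp
      obtain x where tr: "trajectory x u (\<lambda>t. 0\<^sub>v m)" using state_rep_iff[OF rep us z] uB us z by blast
      \<comment> \<open>Any common bound of the \<open>r j\<close> serves here, since the output is
        zero at all times.\<close>
      define rmax where "rmax = (\<Sum>j<m. r j)"
      have rmax: "r j \<le> rmax" if "j < m" for j
        unfolding rmax_def using that by (intro member_le_sum) auto
      have x0: "x 0 \<in> V" by (rule zero_output_feedback(1)[OF tr, of "Suc rmax" rmax]) (use rmax in auto)
      have uF: "u t = F *\<^sub>v x t" for t
        by (rule zero_output_feedback(2)[OF tr, of "Suc (t + rmax)" rmax]) (use rmax in auto)
      obtain c where c: "c \<in> carrier_vec d" "x 0 = E *\<^sub>v c" using x0 V by blast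
      have xt: "x t = E *\<^sub>v ((Q\<^sup>T) ^\<^sub>m t *\<^sub>v c)" for t
        using feedback_orbit[OF tr uF, of t t] orbit[OF c(1), of t] c(2) by simp
      have "vec_converges n (\<lambda>t. E *\<^sub>v ((Q\<^sup>T) ^\<^sub>m t *\<^sub>v c)) (0\<^sub>v n)"
        by (rule vec_converges_mult_mat[OF E Qc[OF c(1)]]) (use conv c in blast)
      then have "vec_converges n x (0\<^sub>v n)" by (simp only: xt[symmetric])
      moreover have "x t \<in> carrier_vec n" for t using tr by auto
      ultimately have "vec_converges m (\<lambda>t. F *\<^sub>v x t) (0\<^sub>v m)" by (intro vec_converges_mult_mat[OF F_carrier])
      then have uconv: "vec_converges m u (0\<^sub>v m)" by (simp only: uF[symmetric])
      have rep': "state_rep m m \<B> n' A' B' C' D'" using min' unfolding minimal_rep_def by blast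
      have tr': "x' \<in> signals n' \<and> u \<in> signals m \<and> (\<lambda>t. 0\<^sub>v m) \<in> signals m \<and> state_trajectory A' B' C' D' x' u (\<lambda>t. 0\<^sub>v m)"
        using x' us z st' by blast
      have "vec_converges n' x' (0\<^sub>v n')"
        by (rule linear_system.observable_state_converges[OF state_rep_linear_system[OF rep']
          minimal_rep_observable[OF min'] tr' uconv])
      then show "vec_converges (n' + m) (\<lambda>i. x' i @\<^sub>v u i) (0\<^sub>v (n' + m))"
        using vec_converges_append_iff[of x' n' u m] uconv signals_carrier[OF x'] signals_carrier[OF us] by blast
    qed
  qed
qed

end


section \<open>From the behavior to a suitable representation\<close>

lemma minimal_rep_exists:
  assumes "state_rep m p \<B> n A B C D"
  obtains A' B' C' D' where "minimal_rep m p \<B> (mcmillan_degree m p \<B>) A' B' C' D'"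
proof -
  have "\<exists>A B C D. state_rep m p \<B> (mcmillan_degree m p \<B>) A B C D"
    unfolding mcmillan_degree_def by (rule LeastI_ex) (use assms in blast)
  with that show thesis unfolding minimal_rep_def by blast
qed

text \<open>By observability \<open>n\<close> block rows have full column rank, so the minimum
  defining the lag is over a nonempty set and some minimal representation attains it.\<close>

lemma lag_rep_exists:
  assumes "state_rep m p \<B> n0 A0 B0 C0 D0" and n: "n = mcmillan_degree m p \<B>"
  obtains A B C D where "minimal_rep m p \<B> n A B C D"
    "\<And>v. v \<in> carrier_vec n \<Longrightarrow> obs_mat n p A C (lag m p \<B>) *\<^sub>v v = 0\<^sub>v (lag m p \<B> * p) \<Longrightarrow> v = 0\<^sub>v n"
proof -
  let ?P = "\<lambda>L. \<exists>n A B C D. minimal_rep m p \<B> n A B C D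
      \<and> vec_space.rank (L * p) (obs_mat n p A C L) = mcmillan_degree m p \<B>"
  obtain A B C D where min: "minimal_rep m p \<B> n A B C D"
    using minimal_rep_exists[OF assms(1)] n by blast
  then have "state_rep m p \<B> n A B C D" unfolding minimal_rep_def by blast
  then interpret linear_system n m p A B C D by (rule state_rep_linear_system)
  have "vec_space.rank (n * p) (obs_mat n p A C n) = n"
    unfolding full_col_rank_iff[OF obs_mat_carrier]
    using observable_obs_mat_kernel[OF minimal_rep_observable[OF min]] by blast
  then have "?P n" using min n by blast
  then have "?P (lag m p \<B>)" unfolding lag_def by (rule LeastI)
  then obtain n' A' B' C' D' where min': "minimal_rep m p \<B> n' A' B' C' D'"
    and rk: "vec_space.rank (lag m p \<B> * p) (obs_mat n' p A' C' (lag m p \<B>)) = mcmillan_degree m p \<B>"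
    by blast
  have "n' = n" using min' n unfolding minimal_rep_def by blast
  with min' rk n show thesis
    using that[of A' B' C' D'] full_col_rank_iff[OF obs_mat_carrier[of n p A' C' "lag m p \<B>"]] by blast
qed

text \<open>\<open>D\<close> and the products \<open>C A^k B\<close> agree with those of the
  representation in which the relative degree is given, and so does the decoupling matrix.\<close>

lemma square_system_of_relative_degree:
  assumes rep: "state_rep m m \<B> n A B C D" and rd: "has_vector_relative_degree m m \<B> r"
  shows "square_system n m A B C D r"
proof -
  obtain n' A' B' C' D' where rep': "state_rep m m \<B> n' A' B' C' D'"
    and zero: "\<And>j k. j < m \<Longrightarrow> k + 2 \<le> r j \<Longrightarrow> row (C' * A' ^\<^sub>m k * B') j = 0\<^sub>v m"
      "\<And>j. j < m \<Longrightarrow> r j > 0 \<Longrightarrow> row D' j = 0\<^sub>v m"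
    and rk: "vec_space.rank m (decoupling_mat m m A' B' C' D' r) = m"
    using rd unfolding has_vector_relative_degree_def by blast
  note mk = markov_parameters_unique[OF rep rep']
  interpret linear_system n m m A B C D by (rule state_rep_linear_system[OF rep])
  have dec: "decoupling_mat m m A B C D r = decoupling_mat m m A' B' C' D' r"
    unfolding decoupling_mat_def mk ..
  show ?thesis
  proof
    fix j k and w :: "real vec" assume j: "j < m" "k + 2 \<le> r j" and w: "w \<in> carrier_vec m"
    have Ak: "A ^\<^sub>m k \<in> carrier_mat n n" by simp
    have CA: "C * A ^\<^sub>m k \<in> carrier_mat m n" by (rule mult_carrier_mat[OF C Ak])
    have "(C *\<^sub>v (A ^\<^sub>m k *\<^sub>v (B *\<^sub>v w))) $ j = (C * A ^\<^sub>m k * B *\<^sub>v w) $ j"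
      unfolding assoc_mult_mat_vec[OF CA B w] assoc_mult_mat_vec[OF C Ak mult_carriers(2)[OF w]] ..
    also have "\<dots> = row (C * A ^\<^sub>m k * B) j \<bullet> w" using j by (intro index_mult_mat_vec) simp
    also have "\<dots> = 0" unfolding mk zero(1)[OF j] using w by simp
    finally show "(C *\<^sub>v (A ^\<^sub>m k *\<^sub>v (B *\<^sub>v w))) $ j = 0" .
  next
    fix j and w :: "real vec" assume j: "j < m" "0 < r j" and w: "w \<in> carrier_vec m"
    have "(D *\<^sub>v w) $ j = row D j \<bullet> w" using j by (intro index_mult_mat_vec) simp
    also have "\<dots> = 0" unfolding mk(1) zero(2)[OF j] using w by simp
    finally show "(D *\<^sub>v w) $ j = 0" .
  next
    fix w :: "real vec" assume "w \<in> carrier_vec m" "decoupling_mat m m A B C D r *\<^sub>v w = 0\<^sub>v m"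
    moreover have "decoupling_mat m m A' B' C' D' r \<in> carrier_mat m m" by (simp add: decoupling_mat_def)
    ultimately show "w = 0\<^sub>v m" using rk full_col_rank_iff[of _ m m] unfolding dec by blast
  qed
qed

text \<open>The conjuncts before the equivalence certify the construction: the windows can be
  computed from the data, the basis has the predicted size, and the description
  \<open>Q_tilde\<close> denotes a matrix of that size.\<close>

theorem theorem21:
  fixes m T L d :: nat
    and \<B> :: "signal set"
    and r :: "nat \<Rightarrow> nat"
    and ud yd :: signal
    and M :: "real vec set"
    and vs :: "real vec list"
  assumes "\<B> \<in> behaviors (2 * m)"
    and "input_cardinality (2 * m) \<B> = m"
    and "mcmillan_degree m m \<B> > 0"
    and "controllable \<B>"
    and "has_vector_relative_degree m m \<B> r"
    and "\<forall>t\<le>T. ud t \<in> carrier_vec m \<and> yd t \<in> carrier_vec m"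
    and "restrict (\<lambda>t. ud t @\<^sub>v yd t) {0..T} \<in> restr \<B> 0 T"
    and "persistently_exciting m T (L + mcmillan_degree m m \<B>) ud"
    and "L \<ge> lag m m \<B> + Max (r ` {..<m}) + 1"
    and "M = zero_output_inputs m m \<B> L"
    and "basis_list (lag m m \<B> * m) (proj_blocks m (lag m m \<B>) M) vs"
    and "d = length vs"
  shows "M = zero_output_data m m T L ud yd
     \<and> int d = int (mcmillan_degree m m \<B>) - (\<Sum>j<m. int (r j))
     \<and> Q_tilde m (lag m m \<B>) M vs \<in> carrier_mat d d
     \<and> (stable_zero_dynamics m m \<B> \<longleftrightarrow> stable_mat (Q_tilde m (lag m m \<B>) M vs))"
proof -
  define l where "l = lag m m \<B>"
  define n where "n = mcmillan_degree m m \<B>"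
  obtain n0 A0 B0 C0 D0 where rep0: "state_rep m m \<B> n0 A0 B0 C0 D0"
    using assms(5) unfolding has_vector_relative_degree_def by blast
  obtain A B C D where min: "minimal_rep m m \<B> n A B C D"
    and obsl: "\<And>v. v \<in> carrier_vec n \<Longrightarrow> obs_mat n m A C l *\<^sub>v v = 0\<^sub>v (l * m) \<Longrightarrow> v = 0\<^sub>v n"
    using lag_rep_exists[OF rep0 n_def] unfolding l_def by blast
  have rep: "state_rep m m \<B> n A B C D" using min unfolding minimal_rep_def by blast
  interpret square_system n m A B C D r by (rule square_system_of_relative_degree[OF rep assms(5)])
  have reach: reachable
    by (rule controllable_reachable[OF rep assms(4) minimal_rep_observable[OF min]])
  \<comment> \<open>The data are a finite piece of a trajectory on all times; excitation and the
    Hankel matrices are transferred to that trajectory.\<close>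
  obtain w where w: "w \<in> \<B>" "restrict (\<lambda>t. ud t @\<^sub>v yd t) {0..T} = restrict w {0..T}"
    using assms(7) unfolding restr_def by blast
  obtain u y x where wuy: "w = (\<lambda>t. u t @\<^sub>v y t)" and tr: "trajectory x u y"
    using state_rep_cases[OF rep w(1)] by metis
  have data: "ud t = u t \<and> yd t = y t" if t: "t \<le> T" for t
  proof -
    have "ud t @\<^sub>v yd t = u t @\<^sub>v y t" using fun_cong[OF w(2), of t] t by (simp add: wuy)
    moreover have "ud t \<in> carrier_vec m" "u t \<in> carrier_vec m" using assms(6) t tr by auto
    ultimately show ?thesis using append_vec_eq by metis
  qed
  have LT: "L + n \<le> T + 1" using assms(8) by (simp add: persistently_exciting_def n_def)
  have pe: "persistently_exciting m T (L + n) u"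
    using assms(8) hankel_cong[of T ud u "L + n" m] data LT by (simp add: persistently_exciting_def n_def)
  \<comment> \<open>For \<open>m = 0\<close> this is the maximum of an empty set, an unspecified
    number, but then there is no \<open>r j\<close> to bound.\<close>
  define rmax where "rmax = Max (r ` {..<m})"
  have rmax: "r j \<le> rmax" if "j < m" for j using that by (simp add: rmax_def)
  have L: "L \<ge> l + rmax + 1" using assms(9) by (simp add: l_def rmax_def)
  have "zero_output_data m m T L ud yd = zero_output_data m m T L u y"
    using hankel_cong[of T ud u L m] hankel_cong[of T yd y L m] data LT by (simp add: zero_output_data_def)
  then have M_data: "M = zero_output_data m m T L ud yd"
    using zero_output_inputs_eq_data[OF rep tr reach pe] L assms(10) by simp
  have basis: "basis_list (l * m) (proj_blocks m l M) vs" using assms(11) by (simp add: l_def)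
  note Q = Q_tilde_realization[OF rep obsl rmax L assms(10) basis assms(12)]
  obtain E where E: "E \<in> carrier_mat n d" "V = {E *\<^sub>v c | c. c \<in> carrier_vec d}"
    "\<And>c. c \<in> carrier_vec d \<Longrightarrow> E *\<^sub>v c = 0\<^sub>v n \<Longrightarrow> c = 0\<^sub>v d"
    "\<And>c. c \<in> carrier_vec d \<Longrightarrow> AF *\<^sub>v (E *\<^sub>v c) = E *\<^sub>v ((Q_tilde m l M vs)\<^sup>T *\<^sub>v c)"
    using Q(3) by blast
  have "stable_zero_dynamics m m \<B> \<longleftrightarrow> stable_mat (Q_tilde m l M vs)"
    by (rule stable_zero_dynamics_iff[OF min E(1) Q(2) E(2-4)])
  moreover have "int d = int n - (\<Sum>j<m. int (r j))" using Q(1) by (simp flip: of_nat_sum)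
  ultimately show ?thesis using M_data Q(2) unfolding l_def n_def by blast
qed

end
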